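(* Let $M$ be an $s\times n$ integer matrix with columns $m_1,\ldots,m_n\in\mathbb{Z}^s$ spanning $\mathbb{R}^s$ and whose convex hull does not contain the origin, and suppose $M$ is a 1-prime matrix. Let $\Omega$ be a fundamental $M$-cone. Then for $\alpha\in\mathbb{Z}^s$, $$f_\Omega(\alpha|M)=P_ef_\Omega(\alpha|M)+\sum_{\theta\in A(M)\setminus\{e\}}\theta^\alpha\frac{1}{|\det(M_\theta)|}\prod_{w\in M\setminus M_\theta}\frac{1}{1-\theta^{-w}}\,1_{\mathrm{cone}(M_\theta)}(\Omega).$$
   Context: Columns of a matrix are treated as a multiset. $\mathscr S_1(M)$ is the set of subsets $Y$ of columns of $M$ with $\#Y=s+1$ spanning $\mathbb{R}^s$, and $\mathscr B(Y)$ the set of subsets of $s$ columns of $Y$ spanning $\mathbb{R}^s$; $M$ is 1-prime if $\gcd\{|\det X|:X\in\mathscr B(Y)\}=1$ for every $Y\in\mathscr S_1(M)$. $t(\alpha|M)=\#\{\beta\in\mathbb{Z}_+^n:M\beta=\alpha\}$. $[[M]]=\{\sum a_jm_j:0\le a_j\le1\}$; $\mathrm{cone}(N)=\{\sum a_jn_j:a_j\ge0\}$ over columns $n_j$ of $N$, $\mathrm{cone}^\circ(M)$ the interior of $\mathrm{cone}(M)$. $\mathscr Y(M)$ = subsets $Y$ of columns with $M\setminus Y$ not spanning $\mathbb{R}^s$; $c(M)=\bigcup_{Y\in\mathscr Y(M)}\mathrm{cone}(M\setminus Y)$; fundamental $M$-cone = connected component of $\mathrm{cone}^\circ(M)\setminus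 c(M)$; $v(\Omega|M)=\mathbb{Z}^s\cap(\Omega-[[M]])$. $\nabla_yf=f-f(\cdot-y)$, $\nabla_Y=\prod_{y\in Y}\nabla_y$, $\nabla(M)=\{f:\mathbb{Z}^s\to\mathbb{C}:\nabla_Yf=0\ \forall Y\in\mathscr Y(M)\}$; $f_\Omega(\cdot|M)$ is the unique element of $\nabla(M)$ agreeing with $t(\cdot|M)$ on $v(\Omega|M)$ (known to exist). $\theta^\alpha=\prod\theta_j^{\alpha_j}$; $M_\theta=\{m\in M:\theta^m=1\}$ (viewed as a matrix); $A(M)=\{\theta\in(\mathbb{C}\setminus0)^s:\mathrm{span}(M_\theta)=\mathbb{R}^s\}$; $e=(1,\ldots,1)$. Each $f\in\nabla(M)$ is uniquely $f(\alpha)=\sum_{\theta\in A(M)}\theta^\alpha p_\theta(\alpha)$ with polynomials $p_\theta$, and $P_\theta f:=p_\theta$. For sets $D_1,D_2$, $1_{D_1}(D_2)=0$ if $D_1\cap D_2=\emptyset$ and $1$ otherwise. *)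

theory Defs
  imports "HOL-Analysis.Analysis"
begin

text \<open>
  An integer matrix \<open>M\<close> with \<open>s\<close> rows and \<open>n\<close> columns has type \<open>int ^ 'n ^ 's\<close>.  The columns form a
  multiset, so a sub-multiset of columns is given by a set of column indices \<open>J :: 'n set\<close>, and
  \<open>M - Y\<close> is the complement of the index set of \<open>Y\<close>.
\<close>

definition of_int_vec :: "int ^ 's \<Rightarrow> real ^ 's" where
  "of_int_vec a = (\<chi> i. real_of_int (a $ i))"

definition rcol :: "int ^ 'n ^ 's \<Rightarrow> 'n \<Rightarrow> real ^ 's" where
  "rcol M j = of_int_vec (column j M)"

definition spanning :: "int ^ 'n ^ 's \<Rightarrow> 'n set \<Rightarrow> bool" where
  "spanning M J \<longleftrightarrow> span (rcol M ` J) = UNIV"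

text \<open>
  \<open>|det X|\<close> for the submatrix \<open>X\<close> on the columns in \<open>J\<close>, meaningful only if \<open>card J = CARD('s)\<close>.
  The absolute value does not depend on the enumeration of \<open>J\<close>.
\<close>

definition absdet :: "int ^ 'n ^ 's \<Rightarrow> 'n set \<Rightarrow> int" where
  "absdet M J = (let \<phi> = (SOME \<phi> :: 's \<Rightarrow> 'n. bij_betw \<phi> UNIV J)
                 in \<bar>det (\<chi> i k. M $ i $ \<phi> k)\<bar>)"

definition S1 :: "int ^ 'n ^ 's \<Rightarrow> 'n set set" where
  "S1 M = {Y. card Y = CARD('s) + 1 \<and> spanning M Y}"

definition bases :: "int ^ 'n ^ 's \<Rightarrow> 'n set \<Rightarrow> 'n set set" where
  "bases M Y = {X. X \<subseteq> Y \<and> card X = CARD('s) \<and> spanning M X}"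

definition one_prime :: "int ^ 'n ^ 's \<Rightarrow> bool" where
  "one_prime M \<longleftrightarrow> (\<forall>Y\<in>S1 M. Gcd (absdet M ` bases M Y) = 1)"

definition vpart :: "int ^ 'n ^ 's \<Rightarrow> int ^ 's \<Rightarrow> nat" where
  "vpart M \<alpha> = card {\<beta> :: int ^ 'n. (\<forall>j. 0 \<le> \<beta> $ j) \<and> M *v \<beta> = \<alpha>}"

definition zonotope :: "int ^ 'n ^ 's \<Rightarrow> (real ^ 's) set" where
  "zonotope M = {\<Sum>j\<in>UNIV. a j *\<^sub>R rcol M j | a :: 'n \<Rightarrow> real. \<forall>j. 0 \<le> a j \<and> a j \<le> 1}"

definition col_cone :: "int ^ 'n ^ 's \<Rightarrow> 'n set \<Rightarrow> (real ^ 's) set" where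
  "col_cone M J = {\<Sum>j\<in>J. a j *\<^sub>R rcol M j | a :: 'n \<Rightarrow> real. \<forall>j\<in>J. 0 \<le> a j}"

definition cospan :: "int ^ 'n ^ 's \<Rightarrow> 'n set set" where
  "cospan M = {Y. \<not> spanning M (- Y)}"

definition cut_set :: "int ^ 'n ^ 's \<Rightarrow> (real ^ 's) set" where
  "cut_set M = (\<Union>Y\<in>cospan M. col_cone M (- Y))"

definition fundamental_cone :: "int ^ 'n ^ 's \<Rightarrow> (real ^ 's) set \<Rightarrow> bool" where
  "fundamental_cone M \<Omega> \<longleftrightarrow> \<Omega> \<in> components (interior (col_cone M UNIV) - cut_set M)"

definition vset :: "int ^ 'n ^ 's \<Rightarrow> (real ^ 's) set \<Rightarrow> (int ^ 's) set" where
  "vset M \<Omega> = {\<alpha>. \<exists>\<omega>\<in>\<Omega>. \<exists>b\<in>zonotope M. of_int_vec \<alpha> = \<omega> - b}"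

definition bdiff :: "int ^ 's \<Rightarrow> (int ^ 's \<Rightarrow> complex) \<Rightarrow> int ^ 's \<Rightarrow> complex" where
  "bdiff y f = (\<lambda>\<alpha>. f \<alpha> - f (\<alpha> - y))"

text \<open>
  The composition of the commuting operators \<open>bdiff (column j M)\<close>, \<open>j \<in> Y\<close>, applied to \<open>f\<close>.
\<close>

definition bdiffs :: "int ^ 'n ^ 's \<Rightarrow> 'n set \<Rightarrow> (int ^ 's \<Rightarrow> complex) \<Rightarrow> int ^ 's \<Rightarrow> complex" where
  "bdiffs M Y f = Finite_Set.fold (\<lambda>j. bdiff (column j M)) f Y"

definition nabla :: "int ^ 'n ^ 's \<Rightarrow> (int ^ 's \<Rightarrow> complex) set" where
  "nabla M = {f. \<forall>Y\<in>cospan M. bdiffs M Y f = (\<lambda>\<alpha>. 0)}"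

definition f_cone :: "int ^ 'n ^ 's \<Rightarrow> (real ^ 's) set \<Rightarrow> int ^ 's \<Rightarrow> complex" where
  "f_cone M \<Omega> = (THE f. f \<in> nabla M \<and> (\<forall>\<alpha>\<in>vset M \<Omega>. f \<alpha> = of_nat (vpart M \<alpha>)))"

definition vpow :: "complex ^ 's \<Rightarrow> int ^ 's \<Rightarrow> complex" where
  "vpow \<theta> \<alpha> = (\<Prod>i\<in>UNIV. (\<theta> $ i) powi (\<alpha> $ i))"

definition cols_at :: "int ^ 'n ^ 's \<Rightarrow> complex ^ 's \<Rightarrow> 'n set" where
  "cols_at M \<theta> = {j. vpow \<theta> (column j M) = 1}"

definition A_set :: "int ^ 'n ^ 's \<Rightarrow> (complex ^ 's) set" where
  "A_set M = {\<theta>. (\<forall>i. \<theta> $ i \<noteq> 0) \<and> spanning M (cols_at M \<theta>)}"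

text \<open>
  Polynomials in \<open>s\<close> variables with complex coefficients, identified with the functions they induce
  on the integer lattice (the lattice is Zariski dense, so nothing is lost).
\<close>

definition lattice_poly :: "(int ^ 's \<Rightarrow> complex) \<Rightarrow> bool" where
  "lattice_poly p \<longleftrightarrow> (\<exists>(K :: ('s \<Rightarrow> nat) set) c. finite K \<and>
     p = (\<lambda>\<alpha>. \<Sum>k\<in>K. c k * (\<Prod>i\<in>UNIV. of_int (\<alpha> $ i) ^ k i)))"

text \<open>
  The polynomial attached to \<open>\<theta>\<close> in the unique expansion of \<open>f \<in> nabla M\<close> over \<open>A_set M\<close>.  Families
  are normalised to vanish outside \<open>A_set M\<close>, so that uniqueness is meant literally.
\<close>

definition P_comp :: "int ^ 'n ^ 's \<Rightarrow> complex ^ 's \<Rightarrow> (int ^ 's \<Rightarrow> complex) \<Rightarrow> int ^ 's \<Rightarrow> complex" where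
  "P_comp M \<theta> f = (THE p :: complex ^ 's \<Rightarrow> int ^ 's \<Rightarrow> complex.
     (\<forall>\<theta>\<in>A_set M. lattice_poly (p \<theta>)) \<and> (\<forall>\<theta>. \<theta> \<notin> A_set M \<longrightarrow> p \<theta> = (\<lambda>\<alpha>. 0)) \<and>
     (\<forall>\<alpha>. f \<alpha> = (\<Sum>\<theta>\<in>A_set M. vpow \<theta> \<alpha> * p \<theta> \<alpha>))) \<theta>"

definition meets :: "'a set \<Rightarrow> 'a set \<Rightarrow> complex" where
  "meets D\<^sub>1 D\<^sub>2 = (if D\<^sub>1 \<inter> D\<^sub>2 = {} then 0 else 1)"

end

(*
  Delete one column at a time.  A difference of the partition function t(.|M) along a column y is
  t(.|M - y), and elements of nabla vanishing on arbitrarily large balls are zero, since all their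
  differences along columns vanish by induction.  Hence the germ of t deep inside Omega, whose
  differences extend to nabla by induction, extends to f_Omega in nabla(M); the two still agree on
  all of v(Omega|M) because Omega is connected.

  For 1-prime M every theta other than e in A(M) has exactly s columns in M_theta, so its
  contribution is a constant times theta^alpha, and the constants satisfy the same column
  recursion.  Subtracting these terms from f_Omega leaves a function all of whose differences along
  columns are polynomials; as soon as there are more than s columns they generate Z^s, and the
  remainder is itself a polynomial.  The recursion starts at a basis X of columns, where t is the
  indicator of the lattice of X, that is the average of the |det X| characters trivial on X.
*)

theory Submission imports Defs begin

section \<open>Polynomial functions on the lattice\<close>

text \<open>The set J of column indices varies while \<Omega> stays fixed. In general \<Omega> is no
  fundamental cone of the submatrix on J, but it is connected and misses the cones of all
  non-spanning subsets of J, and these facts survive the deletion of columns.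

  Two obstacles shape the argument. The column recursion identifies t with elements of nabla only on
  regions attached to \<Omega>, and the columns in J may generate a proper sublattice, so that
  vanishing column differences give periodicity rather than constancy. One integer vector v answers
  both: it lies in an open cone C inside \<Omega> and in the lattice of every spanning J. Each
  lattice point enters the good region by moving along v, and a difference along v is assembled from
  shifted column differences.

  1-primality acts through Cramer's rule and Bezout: |det X| times any integer vector lies in the
  lattice of X, and the gcd of these determinants is 1 as soon as one column exceeds a basis. The
  number |det X| of characters trivial on a basis is obtained as the volume of a parallelepiped. The
  existence of f_\<Omega> comes out of the same induction.\<close>

lemma lattice_poly_const: "lattice_poly (\<lambda>\<alpha> :: int ^ 's. c)"
  unfolding lattice_poly_def
  by (rule exI[of _ "{\<lambda>_. 0}"], rule exI[of _ "\<lambda>_. c"]) simp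

lemma lattice_poly_add:
  fixes p q :: "int ^ 's \<Rightarrow> complex"
  assumes "lattice_poly p" "lattice_poly q"
  shows "lattice_poly (\<lambda>\<alpha>. p \<alpha> + q \<alpha>)"
proof -
  define m :: "('s \<Rightarrow> nat) \<Rightarrow> int ^ 's \<Rightarrow> complex"
    where "m k \<alpha> = (\<Prod>i\<in>UNIV. of_int (\<alpha> $ i) ^ k i)" for k \<alpha>
  obtain K c where K: "finite K" "p = (\<lambda>\<alpha>. \<Sum>k\<in>K. c k * m k \<alpha>)"
    using assms(1) unfolding lattice_poly_def m_def[symmetric] by metis
  obtain L d where L: "finite L" "q = (\<lambda>\<alpha>. \<Sum>k\<in>L. d k * m k \<alpha>)"
    using assms(2) unfolding lattice_poly_def m_def[symmetric] by metis
  let ?c = "\<lambda>k. (if k \<in> K then c k else 0) + (if k \<in> L then d k else 0)"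
  have "p \<alpha> + q \<alpha> = (\<Sum>k\<in>K \<union> L. ?c k * m k \<alpha>)" for \<alpha>
  proof -
    have "p \<alpha> = (\<Sum>k\<in>K \<union> L. (if k \<in> K then c k else 0) * m k \<alpha>)"
      unfolding K using K L by (intro sum.mono_neutral_cong_left) auto
    moreover have "q \<alpha> = (\<Sum>k\<in>K \<union> L. (if k \<in> L then d k else 0) * m k \<alpha>)"
      unfolding L using K L by (intro sum.mono_neutral_cong_left) auto
    ultimately show ?thesis by (simp add: sum.distrib[symmetric] algebra_simps)
  qed
  then show ?thesis
    unfolding lattice_poly_def m_def[symmetric]
    by (intro exI[of _ "K \<union> L"] exI[of _ ?c] conjI ext) (use K(1) L(1) in auto)
qed

lemma lattice_poly_coord_mult:
  fixes p :: "int ^ 's \<Rightarrow> complex"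
  assumes "lattice_poly p"
  shows "lattice_poly (\<lambda>\<alpha>. of_int (\<alpha> $ i) * p \<alpha>)"
proof -
  define m :: "('s \<Rightarrow> nat) \<Rightarrow> int ^ 's \<Rightarrow> complex"
    where "m k \<alpha> = (\<Prod>i\<in>UNIV. of_int (\<alpha> $ i) ^ k i)" for k \<alpha>
  obtain K c where K: "finite K" "p = (\<lambda>\<alpha>. \<Sum>k\<in>K. c k * m k \<alpha>)"
    using assms(1) unfolding lattice_poly_def m_def[symmetric] by metis
  define up :: "('s \<Rightarrow> nat) \<Rightarrow> 's \<Rightarrow> nat" where "up k = k(i := Suc (k i))" for k
  define down :: "('s \<Rightarrow> nat) \<Rightarrow> 's \<Rightarrow> nat" where "down k = k(i := k i - 1)" for k
  have du: "down (up k) = k" for k by (simp add: up_def down_def)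
  then have inj: "inj_on up K" by (metis inj_on_inverseI)
  have m_up: "m (up k) \<alpha> = of_int (\<alpha> $ i) * m k \<alpha>" for k \<alpha>
  proof -
    have "m (up k) \<alpha> = (\<Prod>j\<in>UNIV. (if j = i then of_int (\<alpha> $ i) else 1) * of_int (\<alpha> $ j) ^ k j)"
      unfolding m_def up_def by (intro prod.cong) auto
    then show ?thesis by (simp add: prod.distrib m_def)
  qed
  have "of_int (\<alpha> $ i) * p \<alpha> = (\<Sum>k\<in>up ` K. c (down k) * m k \<alpha>)" for \<alpha>
    unfolding K sum.reindex[OF inj] by (simp add: du m_up sum_distrib_left algebra_simps)
  then show ?thesis
    unfolding lattice_poly_def m_def[symmetric]
    by (intro exI[of _ "up ` K"] exI[of _ "\<lambda>k. c (down k)"] conjI ext) (use K(1) in auto)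
qed

text \<open>Sums and multiplication by single coordinates build every polynomial from constants, so
  the closure proofs below need no bookkeeping of exponents.\<close>

lemma lattice_poly_induct [consumes 1, case_names const add coord]:
  fixes p :: "int ^ 's \<Rightarrow> complex"
  assumes "lattice_poly p"
    and const: "\<And>c. P (\<lambda>\<alpha>. c)"
    and add: "\<And>p q. lattice_poly p \<Longrightarrow> lattice_poly q \<Longrightarrow> P p \<Longrightarrow> P q \<Longrightarrow> P (\<lambda>\<alpha>. p \<alpha> + q \<alpha>)"
    and coord: "\<And>p i. lattice_poly p \<Longrightarrow> P p \<Longrightarrow> P (\<lambda>\<alpha>. of_int (\<alpha> $ i) * p \<alpha>)"
  shows "P p"
proof -
  define Q where "Q p \<longleftrightarrow> lattice_poly p \<and> P p" for p
  obtain K :: "('s \<Rightarrow> nat) set" and c where K: "finite K"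
    "p = (\<lambda>\<alpha>. \<Sum>k\<in>K. c k * (\<Prod>i\<in>UNIV. of_int (\<alpha> $ i) ^ k i))"
    using assms(1) unfolding lattice_poly_def by (elim exE conjE)
  have pw: "Q (\<lambda>\<alpha>. of_int (\<alpha> $ i) ^ n * p \<alpha>)" if "Q p" for i n p
  proof (induction n)
    case (Suc n)
    then have "Q (\<lambda>\<alpha>. of_int (\<alpha> $ i) * (of_int (\<alpha> $ i) ^ n * p \<alpha>))"
      unfolding Q_def by (auto intro: coord lattice_poly_coord_mult)
    then show ?case by (simp add: mult.assoc)
  qed (use that in simp)
  have mon: "Q (\<lambda>\<alpha>. d * (\<Prod>i\<in>I. of_int (\<alpha> $ i) ^ k i))" if "finite I" for d I k
    using that
  proof (induction I)
    case empty
    then show ?case by (simp add: Q_def const lattice_poly_const)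
  next
    case (insert i I)
    then show ?case using pw[OF insert.IH, of i "k i"] by (simp add: algebra_simps)
  qed
  have "Q (\<lambda>\<alpha>. \<Sum>k\<in>K. c k * (\<Prod>i\<in>UNIV. of_int (\<alpha> $ i) ^ k i))"
    using K(1)
  proof (induction K)
    case empty
    then show ?case by (simp add: Q_def const lattice_poly_const)
  next
    case (insert k K)
    then show ?case
      using mon[of UNIV "c k" k] by (auto simp: Q_def intro: add lattice_poly_add)
  qed
  then show ?thesis using K(2) by (simp add: Q_def)
qed

lemma lattice_poly_mult:
  assumes "lattice_poly p" "lattice_poly q"
  shows "lattice_poly (\<lambda>\<alpha>. p \<alpha> * q \<alpha>)"
  using assms(1)
proof (induction p rule: lattice_poly_induct)
  case (const c)
  show ?case using assms(2)
  proof (induction q rule: lattice_poly_induct)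
    case (const d)
    show ?case by (rule lattice_poly_const)
  next
    case (add p q)
    then show ?case by (simp add: distrib_left lattice_poly_add)
  next
    case (coord p i)
    then show ?case using lattice_poly_coord_mult[OF coord(2), of i] by (simp add: algebra_simps)
  qed
next
  case (add p q)
  then show ?case by (simp add: distrib_right lattice_poly_add)
next
  case (coord p i)
  then show ?case using lattice_poly_coord_mult[OF coord(2), of i] by (simp add: algebra_simps)
qed

lemma lattice_poly_coord: "lattice_poly (\<lambda>\<alpha> :: int ^ 's. of_int (\<alpha> $ i))"
  using lattice_poly_coord_mult[OF lattice_poly_const[of 1], of i] by simp

lemma lattice_poly_diff:
  assumes "lattice_poly p" "lattice_poly q"
  shows "lattice_poly (\<lambda>\<alpha>. p \<alpha> - q \<alpha>)"
  using lattice_poly_add[OF assms(1) lattice_poly_mult[OF lattice_poly_const[of "-1"] assms(2)]]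
  by simp

lemma lattice_poly_subst:
  assumes "lattice_poly p" "\<And>i. lattice_poly (\<lambda>\<alpha>. of_int (\<phi> \<alpha> $ i))"
  shows "lattice_poly (\<lambda>\<alpha>. p (\<phi> \<alpha>))"
  using assms(1)
proof (induction p rule: lattice_poly_induct)
  case (coord p i)
  then show ?case by (simp add: lattice_poly_mult assms(2))
qed (simp_all add: lattice_poly_const lattice_poly_add)

lemma lattice_poly_shift:
  assumes "lattice_poly p"
  shows "lattice_poly (\<lambda>\<alpha>. p (\<alpha> + y))"
  by (rule lattice_poly_subst[OF assms])
    (simp add: lattice_poly_add lattice_poly_coord lattice_poly_const)

lemma lattice_poly_pochhammer:
  "lattice_poly (\<lambda>\<alpha> :: int ^ 's. pochhammer (of_int (\<alpha> $ i)) k)"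
proof (induction k)
  case (Suc k)
  then show ?case
    by (simp add: pochhammer_Suc lattice_poly_mult lattice_poly_add lattice_poly_coord lattice_poly_const)
qed (simp add: lattice_poly_const)

text \<open>Rising factorials are to the backward difference what powers are to the
  derivative.\<close>

lemma bdiff_pochhammer:
  "pochhammer (x :: complex) (Suc k) - pochhammer (x - 1) (Suc k) = of_nat (Suc k) * pochhammer x k"
  by (subst pochhammer_Suc, subst pochhammer_rec) (simp add: algebra_simps)

text \<open>
  Rising factorials are summed in closed form; multiplying by the summation coordinate raises
  the rising factorial, whence the auxiliary factor in the induction.
\<close>

lemma lattice_poly_antidiff:
  fixes p :: "int ^ 's \<Rightarrow> complex"
  assumes "lattice_poly p"
  obtains S where "lattice_poly S" "bdiff (axis i 1) S = p" "\<And>\<alpha>. \<alpha> $ i = 0 \<Longrightarrow> S \<alpha> = 0"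
proof -
  define ad where "ad p \<longleftrightarrow>
    (\<exists>S. lattice_poly S \<and> bdiff (axis i 1) S = p \<and> (\<forall>\<alpha>. \<alpha> $ i = 0 \<longrightarrow> S \<alpha> = 0))" for p
  have ad_add: "ad (\<lambda>\<alpha>. p \<alpha> + q \<alpha>)" if pq: "ad p" "ad q" for p q
  proof -
    obtain S T where "lattice_poly S" "bdiff (axis i 1) S = p" "\<forall>\<alpha>. \<alpha> $ i = 0 \<longrightarrow> S \<alpha> = 0"
      "lattice_poly T" "bdiff (axis i 1) T = q" "\<forall>\<alpha>. \<alpha> $ i = 0 \<longrightarrow> T \<alpha> = 0"
      using pq unfolding ad_def by blast
    then show ?thesis
      unfolding ad_def by (intro exI[of _ "\<lambda>\<alpha>. S \<alpha> + T \<alpha>"])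
        (auto simp: lattice_poly_add bdiff_def)
  qed
  have ad_mult: "ad (\<lambda>\<alpha>. g \<alpha> * p \<alpha>)" if p: "ad p" and g: "lattice_poly g" "\<And>\<alpha>. g (\<alpha> - axis i 1) = g \<alpha>" for p g
  proof -
    obtain S where "lattice_poly S" "bdiff (axis i 1) S = p" "\<forall>\<alpha>. \<alpha> $ i = 0 \<longrightarrow> S \<alpha> = 0"
      using p unfolding ad_def by blast
    then show ?thesis
      unfolding ad_def using g by (intro exI[of _ "\<lambda>\<alpha>. g \<alpha> * S \<alpha>"])
        (auto simp: lattice_poly_mult bdiff_def algebra_simps)
  qed
  have ad_poch: "ad (\<lambda>\<alpha>. pochhammer (of_int (\<alpha> $ i)) k)" for k
    unfolding ad_def
  proof (intro exI[of _ "\<lambda>\<alpha>. (1 / of_nat (Suc k)) * pochhammer (of_int (\<alpha> $ i)) (Suc k)"] conjI allI impI)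
    show "bdiff (axis i 1) (\<lambda>\<alpha>. 1 / of_nat (Suc k) * pochhammer (of_int (\<alpha> $ i)) (Suc k))
      = (\<lambda>\<alpha>. pochhammer (of_int (\<alpha> $ i)) k)"
      by (auto simp: bdiff_def fun_eq_iff axis_def right_diff_distrib[symmetric]
          diff_divide_distrib[symmetric] bdiff_pochhammer simp del: of_nat_Suc)
    show "lattice_poly (\<lambda>\<alpha>. 1 / of_nat (Suc k) * pochhammer (of_int (\<alpha> $ i)) (Suc k))"
      by (intro lattice_poly_mult lattice_poly_const lattice_poly_pochhammer)
  qed (simp add: pochhammer_0_left)
  have "ad (\<lambda>\<alpha>. pochhammer (of_int (\<alpha> $ i)) k * p \<alpha>)" for k
    using assms
  proof (induction p arbitrary: k rule: lattice_poly_induct)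
    case (const c)
    show ?case using ad_mult[OF ad_poch[of k] lattice_poly_const[of c]] by (simp add: mult.commute)
  next
    case (add p q)
    then show ?case using ad_add by (simp add: distrib_left)
  next
    case (coord p j)
    show ?case
    proof (cases "j = i")
      case True
      have "ad (\<lambda>\<alpha>. pochhammer (of_int (\<alpha> $ i)) (Suc k) * p \<alpha>
        + (- of_nat k) * (pochhammer (of_int (\<alpha> $ i)) k * p \<alpha>))"
        by (intro ad_add coord ad_mult lattice_poly_const refl)
      then show ?thesis using True by (simp add: pochhammer_Suc algebra_simps)
    next
      case False
      have "ad (\<lambda>\<alpha>. of_int (\<alpha> $ j) * (pochhammer (of_int (\<alpha> $ i)) k * p \<alpha>))"
        using False by (intro ad_mult coord lattice_poly_coord) (simp add: axis_def)
      then show ?thesis by (simp add: algebra_simps)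
    qed
  qed
  from this[of 0] that show thesis unfolding ad_def by auto
qed

text \<open>The difference equation can be solved for either of its two values, so the values spread
  from the hyperplane \<open>\<alpha> $ i = 0\<close> in both directions.\<close>

lemma bdiff_axis_determines:
  fixes f g :: "int ^ 's \<Rightarrow> complex"
  assumes "bdiff (axis i 1) f = bdiff (axis i 1) g" "\<And>\<alpha>. \<alpha> $ i = 0 \<Longrightarrow> f \<alpha> = g \<alpha>"
  shows "f \<alpha> = g \<alpha>"
proof -
  have step: "f \<alpha> - f (\<alpha> - axis i 1) = g \<alpha> - g (\<alpha> - axis i 1)" for \<alpha>
    using fun_cong[OF assms(1), of \<alpha>] by (simp add: bdiff_def)
  have eq: "f \<alpha> = g \<alpha>" if "\<alpha> $ i = k" for \<alpha> and k :: int
    using that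
  proof (induction k arbitrary: \<alpha> rule: int_induct[where k = 0])
    case base
    then show ?case by (simp add: assms(2))
  next
    case (step1 k)
    then have "f (\<alpha> - axis i 1) = g (\<alpha> - axis i 1)" by (intro step1) (simp add: axis_def)
    then show ?case using step[of \<alpha>] by simp
  next
    case (step2 k)
    then have "f (\<alpha> + axis i 1) = g (\<alpha> + axis i 1)" by (intro step2) (simp add: axis_def)
    then show ?case using step[of "\<alpha> + axis i 1"] by simp
  qed
  show ?thesis by (rule eq[OF refl])
qed

lemma lattice_poly_if_bdiff_axis:
  fixes h :: "int ^ 's \<Rightarrow> complex"
  assumes "\<And>i. lattice_poly (bdiff (axis i 1) h)"
  shows "lattice_poly h"
proof -
  define cut :: "'s set \<Rightarrow> int ^ 's \<Rightarrow> int ^ 's"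
    where "cut I \<alpha> = (\<chi> i. if i \<in> I then \<alpha> $ i else 0)" for I \<alpha>
  have cut_poly: "lattice_poly (\<lambda>\<alpha>. p (cut I \<alpha>))" if "lattice_poly p" for p I
  proof (rule lattice_poly_subst[OF that])
    show "lattice_poly (\<lambda>\<alpha>. of_int (cut I \<alpha> $ i))" for i
      by (cases "i \<in> I") (simp_all add: cut_def lattice_poly_coord lattice_poly_const)
  qed
  have "lattice_poly (\<lambda>\<alpha>. h (cut I \<alpha>))" if "finite I" for I
    using that
  proof (induction I)
    case empty
    have "cut {} = (\<lambda>\<alpha>. 0)" by (auto simp: cut_def vec_eq_iff fun_eq_iff)
    then show ?case by (simp add: lattice_poly_const)
  next
    case (insert i I)
    obtain S where S: "lattice_poly S" "bdiff (axis i 1) S = bdiff (axis i 1) h"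
      "\<And>\<alpha>. \<alpha> $ i = 0 \<Longrightarrow> S \<alpha> = 0"
      using lattice_poly_antidiff[OF assms] by metis
    have cut_axis: "cut (insert i I) (\<alpha> - axis i 1) = cut (insert i I) \<alpha> - axis i 1"
      "cut I (\<alpha> - axis i 1) = cut I \<alpha>" for \<alpha>
      using insert.hyps by (auto simp: cut_def vec_eq_iff axis_def)
    have cut0: "cut (insert i I) \<alpha> = cut I \<alpha>" if "\<alpha> $ i = 0" for \<alpha>
      using that by (auto simp: cut_def vec_eq_iff)
    \<comment> \<open>Both sides have the same difference along axis i, and they agree at
      \<open>\<alpha> $ i = 0\<close> because \<open>S\<close> is normalised to vanish
      there.\<close>
    have "h (cut (insert i I) \<alpha>) = h (cut I \<alpha>) + S (cut (insert i I) \<alpha>)" for \<alpha>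
    proof (rule bdiff_axis_determines[where i = i and \<alpha> = \<alpha>
          and f = "\<lambda>\<alpha>. h (cut (insert i I) \<alpha>)"])
      show "bdiff (axis i 1) (\<lambda>\<alpha>. h (cut (insert i I) \<alpha>))
        = bdiff (axis i 1) (\<lambda>\<alpha>. h (cut I \<alpha>) + S (cut (insert i I) \<alpha>))"
        using fun_cong[OF S(2)] by (simp add: bdiff_def cut_axis fun_eq_iff)
      show "h (cut (insert i I) \<alpha>) = h (cut I \<alpha>) + S (cut (insert i I) \<alpha>)" if "\<alpha> $ i = 0" for \<alpha>
        using that S(3)[of "cut I \<alpha>"] insert.hyps by (simp add: cut0[OF that]) (simp add: cut_def)
    qed
    then show ?case by (simp add: insert.IH lattice_poly_add cut_poly S(1))
  qed
  from this[of UNIV] show ?thesis by (simp add: cut_def)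
qed

section \<open>Iterated differences of polynomials\<close>

lemma bdiff_const_zero [simp]: "bdiff y (\<lambda>\<alpha>. 0) = (\<lambda>\<alpha>. 0)"
  by (simp add: bdiff_def)

lemma funpow_bdiff_zero [simp]: "(bdiff y ^^ N) (\<lambda>\<alpha>. 0) = (\<lambda>\<alpha>. 0)"
  by (induction N) simp_all

lemma funpow_bdiff_add:
  "(bdiff y ^^ N) (\<lambda>\<alpha>. f \<alpha> + g \<alpha>) = (\<lambda>\<alpha>. (bdiff y ^^ N) f \<alpha> + (bdiff y ^^ N) g \<alpha>)"
  by (induction N) (simp_all add: bdiff_def fun_eq_iff)

lemma funpow_bdiff_scale:
  "(bdiff y ^^ N) (\<lambda>\<alpha>. c * f \<alpha>) = (\<lambda>\<alpha>. c * (bdiff y ^^ N) f \<alpha>)"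
  by (induction N) (simp_all add: bdiff_def fun_eq_iff algebra_simps)

lemma funpow_bdiff_shift:
  "(bdiff y ^^ N) (\<lambda>\<alpha>. f (\<alpha> - z)) = (\<lambda>\<alpha>. (bdiff y ^^ N) f (\<alpha> - z))"
  by (induction N) (simp_all add: bdiff_def fun_eq_iff algebra_simps)

lemma funpow_bdiff_zero_mono:
  assumes "(bdiff y ^^ N) f = (\<lambda>\<alpha>. 0)" "N \<le> N'"
  shows "(bdiff y ^^ N') f = (\<lambda>\<alpha>. 0)"
proof -
  have "(bdiff y ^^ N') f = (bdiff y ^^ (N' - N)) ((bdiff y ^^ N) f)"
    using assms(2) by (metis add.commute comp_apply funpow_add le_add_diff_inverse)
  then show ?thesis by (simp add: assms(1))
qed

text \<open>By the product rule, a difference of x_i p is x_i times a difference of p plus a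
  constant multiple of a shift of p. Multiplication by a coordinate therefore costs one more
  difference.\<close>

lemma funpow_bdiff_coord_mult:
  assumes "(bdiff y ^^ N) p = (\<lambda>\<alpha>. 0)"
  shows "(bdiff y ^^ Suc N) (\<lambda>\<alpha>. of_int (\<alpha> $ i) * p \<alpha>) = (\<lambda>\<alpha>. 0)"
  using assms
proof (induction N arbitrary: p)
  case 0
  then show ?case by (simp add: bdiff_def)
next
  case (Suc N)
  have "bdiff y (\<lambda>\<alpha>. of_int (\<alpha> $ i) * p \<alpha>)
    = (\<lambda>\<alpha>. of_int (\<alpha> $ i) * bdiff y p \<alpha> + of_int (y $ i) * p (\<alpha> - y))"
    by (simp add: bdiff_def fun_eq_iff algebra_simps)
  then have "(bdiff y ^^ Suc (Suc N)) (\<lambda>\<alpha>. of_int (\<alpha> $ i) * p \<alpha>)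
    = (bdiff y ^^ Suc N) (\<lambda>\<alpha>. of_int (\<alpha> $ i) * bdiff y p \<alpha> + of_int (y $ i) * p (\<alpha> - y))"
    by (simp add: funpow_swap1)
  also have "\<dots> = (\<lambda>\<alpha>. (bdiff y ^^ Suc N) (\<lambda>\<alpha>. of_int (\<alpha> $ i) * bdiff y p \<alpha>) \<alpha>
    + of_int (y $ i) * (bdiff y ^^ Suc N) p (\<alpha> - y))"
    by (simp only: funpow_bdiff_add funpow_bdiff_scale funpow_bdiff_shift)
  also have "\<dots> = (\<lambda>\<alpha>. 0)"
    using Suc.IH[of "bdiff y p"] Suc.prems by (simp only: funpow_Suc_right comp_apply) simp
  finally show ?case .
qed

text \<open>Supplies the exponent with which twisted differences later remove one character from an
  exponential sum.\<close>

lemma lattice_poly_nilpotent: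
  assumes "lattice_poly p"
  obtains N where "(bdiff y ^^ N) p = (\<lambda>\<alpha>. 0)"
proof -
  have "\<exists>N. (bdiff y ^^ N) p = (\<lambda>\<alpha>. 0)"
    using assms
  proof (induction p rule: lattice_poly_induct)
    case (const c)
    show ?case by (rule exI[of _ 1]) (simp add: bdiff_def)
  next
    case (add p q)
    then obtain N N' where "(bdiff y ^^ N) p = (\<lambda>\<alpha>. 0)" "(bdiff y ^^ N') q = (\<lambda>\<alpha>. 0)" by blast
    then have "(bdiff y ^^ max N N') p = (\<lambda>\<alpha>. 0)" "(bdiff y ^^ max N N') q = (\<lambda>\<alpha>. 0)"
      by (auto intro: funpow_bdiff_zero_mono)
    then show ?case by (intro exI[of _ "max N N'"]) (simp add: funpow_bdiff_add)
  next
    case (coord p i)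
    then show ?case using funpow_bdiff_coord_mult by metis
  qed
  then show thesis using that by blast
qed

section \<open>Difference operators and exponential polynomials\<close>

lemma bdiff_commute: "bdiff y (bdiff z f) = bdiff z (bdiff y f)"
  by (simp add: bdiff_def fun_eq_iff algebra_simps)

lemma bdiff_shift: "bdiff y (\<lambda>\<alpha>. f (\<alpha> + z)) = (\<lambda>\<alpha>. bdiff y f (\<alpha> + z))"
  by (simp add: bdiff_def fun_eq_iff algebra_simps)

lemma bdiff_lincomb:
  "bdiff y (\<lambda>\<alpha>. f \<alpha> + c * g \<alpha>) = (\<lambda>\<alpha>. bdiff y f \<alpha> + c * bdiff y g \<alpha>)"
  by (simp add: bdiff_def fun_eq_iff algebra_simps)

text \<open>These cocycle identities carry a property of the column differences over to the whole
  lattice generated by the columns. Shifts are written as additions, and the negative as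
  \<open>0 + (-1) * ...\<close>, so that closure under shifts and under linear combinations applies
  literally.\<close>

lemma bdiff_plus: "bdiff (y + z) f = (\<lambda>\<alpha>. bdiff y f \<alpha> + bdiff z f (\<alpha> + - y))"
  by (simp add: bdiff_def fun_eq_iff algebra_simps)

lemma bdiff_minus: "bdiff (- y) f = (\<lambda>\<alpha>. 0 + (-1) * bdiff y f (\<alpha> + y))"
  by (simp add: bdiff_def fun_eq_iff algebra_simps)

lemma bdiff_zero_arg: "bdiff 0 f = (\<lambda>\<alpha>. 0)"
  by (simp add: bdiff_def)

lemma bdiffs_empty [simp]: "bdiffs M {} f = f"
  by (simp add: bdiffs_def)

lemma bdiffs_insert:
  fixes M :: "int ^ 'n ^ 's"
  assumes "j \<notin> Y"
  shows "bdiffs M (insert j Y) f = bdiff (column j M) (bdiffs M Y f)"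
    and "bdiffs M (insert j Y) f = bdiffs M Y (bdiff (column j M) f)"
proof -
  interpret comp_fun_commute "\<lambda>j. bdiff (column j M)"
    by standard (simp add: fun_eq_iff bdiff_commute)
  show "bdiffs M (insert j Y) f = bdiff (column j M) (bdiffs M Y f)"
    unfolding bdiffs_def using assms by (intro fold_insert) auto
  show "bdiffs M (insert j Y) f = bdiffs M Y (bdiff (column j M) f)"
    unfolding bdiffs_def using assms by (intro fold_insert2) auto
qed

lemma bdiffs_remove:
  fixes M :: "int ^ 'n ^ 's"
  assumes "j \<in> Y"
  shows "bdiffs M Y f = bdiff (column j M) (bdiffs M (Y - {j}) f)"
    and "bdiffs M Y f = bdiffs M (Y - {j}) (bdiff (column j M) f)"
  using bdiffs_insert[of j "Y - {j}" M f] assms by (simp_all add: insert_absorb)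

lemma bdiffs_lincomb:
  fixes M :: "int ^ 'n ^ 's"
  shows "bdiffs M Y (\<lambda>\<alpha>. f \<alpha> + c * g \<alpha>) = (\<lambda>\<alpha>. bdiffs M Y f \<alpha> + c * bdiffs M Y g \<alpha>)"
proof (induction rule: finite_induct[OF finite[of Y]])
  case (2 j Y)
  then show ?case by (simp add: bdiffs_insert(1) bdiff_lincomb)
qed simp

lemma bdiffs_shift:
  fixes M :: "int ^ 'n ^ 's"
  shows "bdiffs M Y (\<lambda>\<alpha>. f (\<alpha> + z)) = (\<lambda>\<alpha>. bdiffs M Y f (\<alpha> + z))"
proof (induction rule: finite_induct[OF finite[of Y]])
  case (2 j Y)
  then show ?case by (simp add: bdiffs_insert(1) bdiff_shift)
qed simp

lemma bdiffs_zero [simp]: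
  fixes M :: "int ^ 'n ^ 's"
  shows "bdiffs M Y (\<lambda>\<alpha>. 0) = (\<lambda>\<alpha>. 0)"
  by (induction rule: finite_induct[OF finite[of Y]]) (simp_all add: bdiffs_insert(1))

section \<open>The difference equations for a subset of the columns\<close>

lemma spanning_mono: "spanning M I \<Longrightarrow> I \<subseteq> J \<Longrightarrow> spanning M J"
  unfolding spanning_def by (metis image_mono span_mono top.extremum_uniqueI)

text \<open>The space nabla of the submatrix on \<open>J\<close>, kept on the index type of M so
  that deleting a column changes no types. If \<open>J\<close> does not span, \<open>Y = {}\<close>
  is admissible and the space is zero, which starts the inductions.\<close>

definition nabla_on :: "int ^ 'n ^ 's \<Rightarrow> 'n set \<Rightarrow> (int ^ 's \<Rightarrow> complex) set" where
  "nabla_on M J = {f. \<forall>Y\<subseteq>J. \<not> spanning M (J - Y) \<longrightarrow> bdiffs M Y f = (\<lambda>\<alpha>. 0)}"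

lemma nabla_on_UNIV: "nabla_on M UNIV = nabla M"
  by (simp add: nabla_on_def nabla_def cospan_def Compl_eq_Diff_UNIV)

lemma nabla_on_zero [simp]: "(\<lambda>\<alpha>. 0) \<in> nabla_on M J"
  by (simp add: nabla_on_def)

lemma nabla_on_lincomb:
  assumes "f \<in> nabla_on M J" "g \<in> nabla_on M J"
  shows "(\<lambda>\<alpha>. f \<alpha> + c * g \<alpha>) \<in> nabla_on M J"
  using assms by (simp add: nabla_on_def bdiffs_lincomb)

lemma nabla_on_shift:
  assumes "f \<in> nabla_on M J"
  shows "(\<lambda>\<alpha>. f (\<alpha> + z)) \<in> nabla_on M J"
  using assms by (simp add: nabla_on_def bdiffs_shift)

lemma nabla_on_bdiff:
  assumes "f \<in> nabla_on M J"
  shows "bdiff z f \<in> nabla_on M J"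
proof -
  have "(\<lambda>\<alpha>. f \<alpha> + (-1) * f (\<alpha> + - z)) \<in> nabla_on M J"
    by (rule nabla_on_lincomb[OF assms nabla_on_shift[OF assms]])
  then show ?thesis by (simp add: bdiff_def[abs_def])
qed

text \<open>If \<open>J - Y\<close> does not span, neither does the smaller set
  \<open>I - Y\<close>. The differences along \<open>Y \<inter> I\<close> already give zero, and
  further differences keep it.\<close>

lemma nabla_on_mono:
  fixes M :: "int ^ 'n ^ 's"
  assumes "f \<in> nabla_on M I" "I \<subseteq> J"
  shows "f \<in> nabla_on M J"
proof -
  have extend: "bdiffs M (X \<union> Y) f = (\<lambda>\<alpha>. 0)" if "bdiffs M X f = (\<lambda>\<alpha>. 0)" "Y \<inter> X = {}" for X Y
    using finite[of Y] that(2)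
  proof (induction Y)
    case (insert j Y)
    then show ?case by (simp add: bdiffs_insert(1))
  qed (use that in simp)
  show ?thesis
    unfolding nabla_on_def mem_Collect_eq
  proof (intro allI impI)
    fix Y assume Y: "Y \<subseteq> J" "\<not> spanning M (J - Y)"
    have "\<not> spanning M (I - (Y \<inter> I))"
      using Y(2) assms(2) spanning_mono[of M "I - Y \<inter> I" "J - Y"] by blast
    then have "bdiffs M (Y \<inter> I) f = (\<lambda>\<alpha>. 0)" using assms(1) by (simp add: nabla_on_def)
    from extend[OF this, of "Y - I"] show "bdiffs M Y f = (\<lambda>\<alpha>. 0)"
      by (metis Diff_Int2 Int_Diff_Un Int_Diff_disjoint Int_commute)
  qed
qed

lemma nabla_on_bdiff_column:
  fixes M :: "int ^ 'n ^ 's"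
  assumes "f \<in> nabla_on M J" "y \<in> J"
  shows "bdiff (column y M) f \<in> nabla_on M (J - {y})"
  unfolding nabla_on_def mem_Collect_eq
proof (intro allI impI)
  fix Y assume Y: "Y \<subseteq> J - {y}" "\<not> spanning M (J - {y} - Y)"
  have "J - insert y Y = J - {y} - Y" "insert y Y \<subseteq> J" using assms(2) Y(1) by auto
  then have "bdiffs M (insert y Y) f = (\<lambda>\<alpha>. 0)"
    using assms(1) Y(2) by (simp add: nabla_on_def)
  then show "bdiffs M Y (bdiff (column y M) f) = (\<lambda>\<alpha>. 0)"
    using Y(1) bdiffs_insert(2)[of y Y M f] by (metis Diff_iff insertI1 subsetD)
qed

text \<open>Since \<open>J\<close> spans, no admissible \<open>Y\<close> is empty, so there is
  always a column to take the first difference along.\<close>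

lemma nabla_onI:
  fixes M :: "int ^ 'n ^ 's"
  assumes "spanning M J" "\<And>y. y \<in> J \<Longrightarrow> bdiff (column y M) f \<in> nabla_on M (J - {y})"
  shows "f \<in> nabla_on M J"
  unfolding nabla_on_def mem_Collect_eq
proof (intro allI impI)
  fix Y assume Y: "Y \<subseteq> J" "\<not> spanning M (J - Y)"
  then obtain y where y: "y \<in> Y" using assms(1) by fastforce
  have "J - {y} - (Y - {y}) = J - Y" "Y - {y} \<subseteq> J - {y}" "y \<in> J" using Y(1) y by auto
  then have "bdiffs M (Y - {y}) (bdiff (column y M) f) = (\<lambda>\<alpha>. 0)"
    using assms(2)[of y] Y(2) by (simp add: nabla_on_def)
  then show "bdiffs M Y f = (\<lambda>\<alpha>. 0)" using bdiffs_remove(2)[OF y, of M f] by simp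
qed

section \<open>Characters of the integer lattice\<close>

lemma vpow_add: "(\<And>i. \<theta> $ i \<noteq> 0) \<Longrightarrow> vpow \<theta> (\<alpha> + \<beta>) = vpow \<theta> \<alpha> * vpow \<theta> \<beta>"
  by (simp add: vpow_def power_int_add prod.distrib)

lemma vpow_0 [simp]: "vpow \<theta> 0 = 1"
  by (simp add: vpow_def)

lemma vpow_one [simp]: "vpow (\<chi> i. 1) \<alpha> = 1"
  by (simp add: vpow_def)

lemma vpow_nonzero: "(\<And>i. \<theta> $ i \<noteq> 0) \<Longrightarrow> vpow \<theta> \<alpha> \<noteq> 0"
  by (simp add: vpow_def)

lemma vpow_smult: "vpow \<theta> (k *s \<alpha>) = vpow \<theta> \<alpha> powi k"
proof -
  have "(\<Prod>i\<in>I. f i powi k) = (\<Prod>i\<in>I. f i) powi k" for I and f :: "'a \<Rightarrow> complex"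
    by (induction I rule: infinite_finite_induct) (simp_all add: power_int_mult_distrib)
  then show ?thesis
    by (simp add: vpow_def power_int_mult mult.commute[of k])
qed

lemma vpow_minus: "vpow \<theta> (- \<alpha>) = inverse (vpow \<theta> \<alpha>)"
  using prod_inversef[of "\<lambda>i. \<theta> $ i powi \<alpha> $ i" UNIV] by (simp add: vpow_def power_int_minus comp_def)

lemma vpow_axis: "vpow \<theta> (k *s axis i 1) = \<theta> $ i powi k"
proof -
  have "vpow \<theta> (axis i 1) = (\<Prod>j\<in>UNIV. if j = i then \<theta> $ i else 1)"
    unfolding vpow_def by (intro prod.cong) (auto simp: axis_def)
  then show ?thesis by (simp add: vpow_smult)
qed

text \<open>The form a difference takes after a character is factored out: along axis i,
  \<open>twdiff c\<close> acts on a term with character \<theta> as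
  \<open>twdiff (c / \<theta> $ i)\<close> on its polynomial coefficient.\<close>

definition twdiff :: "complex \<Rightarrow> int ^ 's \<Rightarrow> (int ^ 's \<Rightarrow> complex) \<Rightarrow> int ^ 's \<Rightarrow> complex" where
  "twdiff c y f = (\<lambda>\<alpha>. f \<alpha> - c * f (\<alpha> - y))"

lemma twdiff_1: "twdiff 1 y = bdiff y"
  by (simp add: twdiff_def bdiff_def fun_eq_iff)

lemma lattice_poly_twdiff:
  assumes "lattice_poly p"
  shows "lattice_poly (twdiff c y p)"
  using lattice_poly_diff[OF assms lattice_poly_mult[OF lattice_poly_const lattice_poly_shift[OF assms]],
      of c "- y"]
  by (simp add: twdiff_def)

text \<open>For \<open>c = 0\<close> the operator is the identity. Otherwise a kernel element is an
  eigenvector of \<open>bdiff y\<close> with eigenvalue 1 - 1/c, which is nonzero, while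
  \<open>bdiff y\<close> is nilpotent on polynomials.\<close>

lemma twdiff_inj:
  assumes p: "lattice_poly p" and tw: "twdiff c y p = (\<lambda>\<alpha>. 0)" and c: "c \<noteq> 1"
  shows "p = (\<lambda>\<alpha>. 0)"
proof (cases "c = 0")
  case True
  then show ?thesis using tw by (simp add: twdiff_def)
next
  case False
  obtain N where N: "(bdiff y ^^ N) p = (\<lambda>\<alpha>. 0)" using lattice_poly_nilpotent[OF p] by blast
  have "p (\<alpha> - y) = inverse c * p \<alpha>" for \<alpha>
    using fun_cong[OF tw, of \<alpha>] False by (simp add: twdiff_def)
  then have "bdiff y p = (\<lambda>\<alpha>. (1 - inverse c) * p \<alpha>)"
    by (simp add: bdiff_def fun_eq_iff algebra_simps)
  then have "(bdiff y ^^ n) p = (\<lambda>\<alpha>. (1 - inverse c) ^ n * p \<alpha>)" for n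
    by (induction n) (simp_all add: bdiff_def fun_eq_iff algebra_simps)
  with N show ?thesis using c False by (simp add: fun_eq_iff field_simps)
qed

lemma funpow_twdiff_inj:
  assumes "lattice_poly p" "(twdiff c y ^^ N) p = (\<lambda>\<alpha>. 0)" "c \<noteq> 1"
  shows "p = (\<lambda>\<alpha>. 0)"
  using assms(2)
proof (induction N)
  case (Suc N)
  have "lattice_poly ((twdiff c y ^^ N) p)"
    by (induction N) (simp_all add: assms(1) lattice_poly_twdiff)
  then have "(twdiff c y ^^ N) p = (\<lambda>\<alpha>. 0)"
    by (rule twdiff_inj[OF _ _ assms(3)]) (use Suc.prems in simp)
  then show ?case by (rule Suc.IH)
qed simp

lemma funpow_twdiff_exp_poly:
  assumes "\<And>\<theta> i. \<theta> \<in> A \<Longrightarrow> \<theta> $ i \<noteq> 0"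
  shows "(twdiff c (axis i 1) ^^ N) (\<lambda>\<alpha>. \<Sum>\<theta>\<in>A. vpow \<theta> \<alpha> * p \<theta> \<alpha>)
    = (\<lambda>\<alpha>. \<Sum>\<theta>\<in>A. vpow \<theta> \<alpha> * (twdiff (c / \<theta> $ i) (axis i 1) ^^ N) (p \<theta>) \<alpha>)"
proof -
  have step: "vpow \<theta> (\<alpha> - axis i 1) = vpow \<theta> \<alpha> / \<theta> $ i" if "\<theta> \<in> A" for \<theta> \<alpha>
    using vpow_add[of \<theta> \<alpha> "- axis i 1"] vpow_axis[of \<theta> 1 i] assms[OF that]
    by (simp add: vpow_minus field_simps)
  have "twdiff c (axis i 1) (\<lambda>\<alpha>. \<Sum>\<theta>\<in>A. vpow \<theta> \<alpha> * q \<theta> \<alpha>)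
    = (\<lambda>\<alpha>. \<Sum>\<theta>\<in>A. vpow \<theta> \<alpha> * twdiff (c / \<theta> $ i) (axis i 1) (q \<theta>) \<alpha>)" for q
    unfolding twdiff_def sum_distrib_left sum_subtractf[symmetric] fun_eq_iff
    by (intro allI sum.cong refl) (simp add: step algebra_simps)
  then show ?thesis by (induction N) simp_all
qed

text \<open>Linear independence of characters over polynomials, by removing one character \<eta>
  other than \<theta>. A power of the difference twisted by a coordinate of \<eta> where it differs
  from \<theta> kills the \<eta>-term and is injective on the coefficient of \<theta>.\<close>

lemma exp_poly_eq_0:
  fixes p :: "complex ^ 's \<Rightarrow> int ^ 's \<Rightarrow> complex"
  assumes "finite A" "\<And>\<theta> i. \<theta> \<in> A \<Longrightarrow> \<theta> $ i \<noteq> 0" "\<And>\<theta>. \<theta> \<in> A \<Longrightarrow> lattice_poly (p \<theta>)"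
    and "\<And>\<alpha>. (\<Sum>\<theta>\<in>A. vpow \<theta> \<alpha> * p \<theta> \<alpha>) = 0" and "\<theta> \<in> A"
  shows "p \<theta> = (\<lambda>\<alpha>. 0)"
  using assms
proof (induction "card A" arbitrary: A p rule: less_induct)
  case less
  show ?case
  proof (cases "A = {\<theta>}")
    case True
    then show ?thesis using less.prems(2)[of \<theta>] less.prems(4) by (auto simp: vpow_nonzero fun_eq_iff)
  next
    case False
    then obtain \<eta> where \<eta>: "\<eta> \<in> A" "\<eta> \<noteq> \<theta>" using less.prems(5) by blast
    then obtain i where i: "\<eta> $ i \<noteq> \<theta> $ i" by (auto simp: vec_eq_iff)
    obtain N where N: "(bdiff (axis i 1) ^^ N) (p \<eta>) = (\<lambda>\<alpha>. 0)"
      using lattice_poly_nilpotent[OF less.prems(3)[OF \<eta>(1)]] by blast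
    define q where "q \<zeta> = (twdiff (\<eta> $ i / \<zeta> $ i) (axis i 1) ^^ N) (p \<zeta>)" for \<zeta>
    have q_poly: "lattice_poly (q \<zeta>)" if "\<zeta> \<in> A" for \<zeta>
      unfolding q_def by (induction N) (simp_all add: lattice_poly_twdiff less.prems(3) that)
    have "(\<lambda>\<alpha>. \<Sum>\<theta>\<in>A. vpow \<theta> \<alpha> * q \<theta> \<alpha>)
      = (twdiff (\<eta> $ i) (axis i 1) ^^ N) (\<lambda>\<alpha>. \<Sum>\<theta>\<in>A. vpow \<theta> \<alpha> * p \<theta> \<alpha>)"
      unfolding q_def by (rule funpow_twdiff_exp_poly[symmetric]) (rule less.prems(2))
    also have "\<dots> = (\<lambda>\<alpha>. 0)"
      unfolding less.prems(4) by (induction N) (simp_all add: twdiff_def)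
    finally have "(\<Sum>\<theta>\<in>A. vpow \<theta> \<alpha> * q \<theta> \<alpha>) = 0" for \<alpha> by (rule fun_cong)
    \<comment> \<open>At \<eta> itself the twist is 1, so the operator is the ordinary
      difference.\<close>
    moreover have "q \<eta> = (\<lambda>\<alpha>. 0)"
      using N less.prems(2)[OF \<eta>(1)] by (simp add: q_def twdiff_1)
    ultimately have sum0: "(\<Sum>\<theta>\<in>A - {\<eta>}. vpow \<theta> \<alpha> * q \<theta> \<alpha>) = 0" for \<alpha>
      using less.prems(1) \<eta>(1) by (simp add: sum_diff1)
    have "q \<theta> = (\<lambda>\<alpha>. 0)"
    proof (rule less.hyps)
      show "card (A - {\<eta>}) < card A" using less.prems(1) \<eta>(1) by (rule card_Diff1_less)
    qed (use less.prems(1,2,5) q_poly sum0 \<eta> in auto)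
    moreover have "\<eta> $ i / \<theta> $ i \<noteq> 1" using i less.prems(2)[OF less.prems(5), of i] by simp
    ultimately show ?thesis
      unfolding q_def using funpow_twdiff_inj less.prems(3)[OF less.prems(5)] by blast
  qed
qed

section \<open>Lattices spanned by columns\<close>

lemma of_int_vec_0 [simp]: "of_int_vec 0 = 0"
  by (simp add: of_int_vec_def vec_eq_iff)

lemma of_int_vec_add: "of_int_vec (a + b) = of_int_vec a + of_int_vec b"
  by (simp add: of_int_vec_def vec_eq_iff)

lemma of_int_vec_smult: "of_int_vec (k *s a) = of_int k *\<^sub>R of_int_vec a"
  by (simp add: of_int_vec_def vec_eq_iff)

lemma of_int_vec_sum: "of_int_vec (sum f I) = (\<Sum>i\<in>I. of_int_vec (f i))"
  by (induction I rule: infinite_finite_induct) (simp_all add: of_int_vec_add)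

lemma of_int_vec_inj: "of_int_vec a = of_int_vec b \<longleftrightarrow> a = b"
  by (simp add: of_int_vec_def vec_eq_iff)

lemma rcol_eq: "rcol M j = of_int_vec (column j M)"
  by (simp add: rcol_def)

text \<open>Columns may coincide, so an independent set of vectors is pulled back to a set of
  indices on which \<open>rcol M\<close> is injective.\<close>

lemma spanning_imp_basis:
  fixes M :: "int ^ 'n ^ 's"
  assumes "spanning M J"
  obtains B where "B \<subseteq> J" "card B = CARD('s)" "spanning M B"
proof -
  obtain V where V: "V \<subseteq> rcol M ` J" "independent V" "rcol M ` J \<subseteq> span V"
    by (rule maximal_independent_subset)
  then obtain B where B: "B \<subseteq> J" "inj_on (rcol M) B" "V = rcol M ` B"
    by (auto simp: subset_image_inj)
  have span: "span V = UNIV"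
    using V(3) assms unfolding spanning_def by (metis span_mono span_span top.extremum_uniqueI)
  then have "card V = CARD('s)"
    using dim_eq_card_independent[OF V(2)] by (metis DIM_cart DIM_real dim_UNIV dim_span mult.right_neutral)
  then show thesis using that B span card_image[OF B(2)] by (simp add: spanning_def)
qed

lemma spanning_card_ge:
  fixes M :: "int ^ 'n ^ 's"
  assumes "spanning M J"
  shows "CARD('s) \<le> card J"
  using assms by (metis spanning_imp_basis card_mono finite)

lemma absdet_witness:
  fixes M :: "int ^ 'n ^ 's"
  assumes "card X = CARD('s)"
  obtains \<phi> :: "'s \<Rightarrow> 'n" where "bij_betw \<phi> UNIV X" "absdet M X = \<bar>det (\<chi> i k. M $ i $ \<phi> k)\<bar>"
proof -
  have "\<exists>\<phi> :: 's \<Rightarrow> 'n. bij_betw \<phi> UNIV X"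
    using assms by (intro finite_same_card_bij) auto
  then have "bij_betw (SOME \<phi> :: 's \<Rightarrow> 'n. bij_betw \<phi> UNIV X) UNIV X" by (rule someI_ex)
  then show thesis using that unfolding absdet_def Let_def by blast
qed

lemma det_of_int: "det (\<chi> i k. real_of_int (A i k)) = of_int (det (\<chi> i k. A i k))"
  by (simp add: det_def)

lemma det_cols_nonzero:
  fixes M :: "int ^ 'n ^ 's"
  assumes "bij_betw \<phi> (UNIV :: 's set) X" "spanning M X"
  shows "det (\<chi> i k. M $ i $ \<phi> k) \<noteq> 0"
proof -
  define R :: "real ^ 's ^ 's" where "R = (\<chi> i k. real_of_int (M $ i $ \<phi> k))"
  have "column k R = rcol M (\<phi> k)" for k
    by (simp add: R_def column_def rcol_def of_int_vec_def)
  then have "columns R = rcol M ` X"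
    using assms(1) by (auto simp: columns_def bij_betw_def)
  then have "span (columns R) = UNIV" using assms(2) by (simp add: spanning_def)
  then have "invertible R"
    by (simp add: invertible_right_inverse matrix_right_invertible_span_columns span_vec_eq)
  then have "det R \<noteq> 0" by (simp add: invertible_det_nz)
  then show ?thesis by (simp add: R_def det_of_int)
qed

lemma absdet_pos:
  fixes M :: "int ^ 'n ^ 's"
  assumes "card X = CARD('s)" "spanning M X"
  shows "absdet M X > 0"
  using absdet_witness[OF assms(1)] det_cols_nonzero[OF _ assms(2)] by (metis zero_less_abs_iff)

definition lattice_of :: "int ^ 'n ^ 's \<Rightarrow> 'n set \<Rightarrow> (int ^ 's) set" where
  "lattice_of M J = range (\<lambda>c. \<Sum>j\<in>J. c j *s column j M)"

lemma lattice_of_column: "j \<in> J \<Longrightarrow> column j M \<in> lattice_of M J"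
  for M :: "int ^ 'n ^ 's"
  unfolding lattice_of_def
  by (rule range_eqI[of _ _ "\<lambda>k. if k = j then 1 else 0"])
    (simp add: if_distrib[of "\<lambda>c. c *s _"] cong: if_cong)

lemma lattice_of_add: "a \<in> lattice_of M J \<Longrightarrow> b \<in> lattice_of M J \<Longrightarrow> a + b \<in> lattice_of M J"
  unfolding lattice_of_def
proof (elim rangeE)
  fix c d assume "a = (\<Sum>j\<in>J. c j *s column j M)" "b = (\<Sum>j\<in>J. d j *s column j M)"
  then show "a + b \<in> range (\<lambda>c. \<Sum>j\<in>J. c j *s column j M)"
    by (intro range_eqI[of _ _ "\<lambda>j. c j + d j"]) (simp add: sum.distrib vector_sadd_rdistrib)
qed

lemma lattice_of_minus: "a \<in> lattice_of M J \<Longrightarrow> - a \<in> lattice_of M J"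
  unfolding lattice_of_def
proof (elim rangeE)
  fix c assume "a = (\<Sum>j\<in>J. c j *s column j M)"
  then show "- a \<in> range (\<lambda>c. \<Sum>j\<in>J. c j *s column j M)"
    by (intro range_eqI[of _ _ "\<lambda>j. - c j"]) (simp add: sum_negf[symmetric] vec_eq_iff)
qed

lemma lattice_of_0: "0 \<in> lattice_of M J"
  unfolding lattice_of_def by (rule range_eqI[of _ _ "\<lambda>_. 0"]) simp

lemma subgroup_smult:
  fixes a :: "int ^ 's"
  assumes "P 0" "\<And>a b. P a \<Longrightarrow> P b \<Longrightarrow> P (a + b)" "\<And>a. P a \<Longrightarrow> P (- a)" "P a"
  shows "P (k *s a)"
proof (induction k rule: int_induct[where k = 0])
  case base
  then show ?case using assms(1) by simp
next
  case (step1 k)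
  then show ?case using assms(2)[of "k *s a" a] assms(4) by (simp add: vector_sadd_rdistrib)
next
  case (step2 k)
  have "(k - 1) *s a = k *s a + - a" by (simp add: vec_eq_iff algebra_simps)
  then show ?case using assms(2)[of "k *s a" "- a"] assms(3,4) step2 by simp
qed

lemma subgroup_sum:
  fixes f :: "'a \<Rightarrow> int ^ 's"
  assumes "P 0" "\<And>a b. P a \<Longrightarrow> P b \<Longrightarrow> P (a + b)" "\<And>j. j \<in> J \<Longrightarrow> P (f j)"
  shows "P (sum f J)"
  using assms(3) by (induction J rule: infinite_finite_induct) (auto intro: assms(1,2))

lemma lattice_of_induct [consumes 1, case_names column zero add minus]:
  assumes "a \<in> lattice_of M J" "\<And>j. j \<in> J \<Longrightarrow> P (column j M)" "P 0"
    "\<And>a b. P a \<Longrightarrow> P b \<Longrightarrow> P (a + b)" "\<And>a. P a \<Longrightarrow> P (- a)"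
  shows "P a"
proof -
  obtain c where "a = (\<Sum>j\<in>J. c j *s column j M)" using assms(1) by (auto simp: lattice_of_def)
  moreover have "P (\<Sum>j\<in>J. c j *s column j M)"
    by (intro subgroup_sum[where P = P] subgroup_smult[where P = P] assms)
  ultimately show ?thesis by simp
qed

lemma lattice_of_mono:
  assumes "I \<subseteq> J"
  shows "lattice_of M I \<subseteq> lattice_of M J"
proof
  fix a assume "a \<in> lattice_of M I"
  then show "a \<in> lattice_of M J"
    by (induction rule: lattice_of_induct)
      (use assms in \<open>auto intro: lattice_of_column lattice_of_0 lattice_of_add lattice_of_minus\<close>)
qed

lemma lattice_of_smult: "a \<in> lattice_of M J \<Longrightarrow> k *s a \<in> lattice_of M J"
  by (rule subgroup_smult[where P = "\<lambda>a. a \<in> lattice_of M J"])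
    (auto intro: lattice_of_0 lattice_of_add lattice_of_minus)

text \<open>Cramer's rule.\<close>

lemma absdet_smult_in_lattice:
  fixes M :: "int ^ 'n ^ 's"
  assumes "card X = CARD('s)" "spanning M X"
  shows "absdet M X *s a \<in> lattice_of M X"
proof -
  obtain \<phi> :: "'s \<Rightarrow> 'n" where \<phi>: "bij_betw \<phi> UNIV X"
    "absdet M X = \<bar>det (\<chi> i k. M $ i $ \<phi> k)\<bar>"
    using absdet_witness[OF assms(1)] by blast
  define d where "d = det (\<chi> i k. M $ i $ \<phi> k)"
  define z where "z k = det (\<chi> i j. if j = k then a $ i else M $ i $ \<phi> j)" for k
  define R :: "real ^ 's ^ 's" where "R = (\<chi> i k. real_of_int (M $ i $ \<phi> k))"
  have d0: "d \<noteq> 0" unfolding d_def by (rule det_cols_nonzero[OF \<phi>(1) assms(2)])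
  have detR: "det R = of_int d" by (simp add: R_def d_def det_of_int)
  have z: "det (\<chi> i j. if j = k then of_int_vec a $ i else R $ i $ j) = of_int (z k)" for k
    unfolding z_def det_of_int[symmetric]
    by (rule arg_cong[of _ _ det]) (simp add: R_def of_int_vec_def vec_eq_iff)
  have "R *v (\<chi> k. of_int (z k) / of_int d) = of_int_vec a"
    using cramer[of R "\<chi> k. of_int (z k) / of_int d" "of_int_vec a"] d0 by (simp add: detR z)
  then have "(\<Sum>k\<in>UNIV. real_of_int (M $ i $ \<phi> k) * (of_int (z k) / of_int d)) = of_int (a $ i)" for i
    by (simp add: R_def matrix_vector_mult_def of_int_vec_def vec_eq_iff)
  then have "(\<Sum>k\<in>UNIV. real_of_int (M $ i $ \<phi> k) * of_int (z k)) / of_int d = of_int (a $ i)" for i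
    by (simp add: sum_divide_distrib)
  then have "real_of_int (\<Sum>k\<in>UNIV. M $ i $ \<phi> k * z k) = of_int (d * a $ i)" for i
    using d0 by (simp add: field_simps)
  then have "(\<Sum>k\<in>UNIV. M $ i $ \<phi> k * z k) = d * a $ i" for i
    by (simp only: of_int_eq_iff)
  then have "d *s a = (\<Sum>k\<in>UNIV. z k *s column (\<phi> k) M)"
    by (simp add: vec_eq_iff column_def mult.commute)
  also have "\<dots> \<in> lattice_of M X"
    using \<phi>(1) by (intro subgroup_sum[where P = "\<lambda>a. a \<in> lattice_of M X"] lattice_of_0 lattice_of_add
        lattice_of_smult lattice_of_column) (auto simp: bij_betw_def)
  finally have "d *s a \<in> lattice_of M X" .
  moreover from lattice_of_minus[OF this] have "(- d) *s a \<in> lattice_of M X"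
    by (metis vector_smult_lneg)
  ultimately show ?thesis unfolding \<phi>(2) d_def[symmetric] abs_if by simp
qed

text \<open>The product of |det X| over all bases X is a multiple of each of them, so one
  \<open>D\<close> serves every spanning set. It bounds the orders of the characters and makes a
  single direction v available in all the lattices.\<close>

lemma common_lattice_multiple:
  fixes M :: "int ^ 'n ^ 's"
  obtains D :: int where "D > 0" "\<And>J a. spanning M J \<Longrightarrow> D *s a \<in> lattice_of M J"
proof
  let ?D = "\<Prod>X\<in>bases M UNIV. absdet M X"
  show "?D > 0" by (intro prod_pos) (auto simp: bases_def absdet_pos)
  fix J and a :: "int ^ 's" assume "spanning M J"
  then obtain B where B: "B \<subseteq> J" "card B = CARD('s)" "spanning M B" by (rule spanning_imp_basis)
  then have "absdet M B dvd ?D" by (intro dvd_prodI) (auto simp: bases_def)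
  then obtain k where "?D = k * absdet M B" by (metis dvd_def mult.commute)
  then have "?D *s a = k *s (absdet M B *s a)" by (simp add: vector_smult_assoc)
  then show "?D *s a \<in> lattice_of M J"
    using lattice_of_smult[OF absdet_smult_in_lattice[OF B(2,3)]] lattice_of_mono[OF B(1)] by auto
qed

lemma vpow_lattice_of:
  assumes "a \<in> lattice_of M J" "\<And>i. \<theta> $ i \<noteq> 0" "\<And>j. j \<in> J \<Longrightarrow> vpow \<theta> (column j M) = 1"
  shows "vpow \<theta> a = 1"
  using assms(1)
  by (induction rule: lattice_of_induct) (use assms(2,3) in \<open>simp_all add: vpow_add vpow_minus\<close>)

lemma finite_vec_set:
  assumes "\<And>i. finite (S i)"
  shows "finite {x :: 'a ^ 'n. \<forall>i. x $ i \<in> S i}"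
proof (rule finite_imageD)
  show "finite (vec_nth ` {x :: 'a ^ 'n. \<forall>i. x $ i \<in> S i})"
    by (rule finite_subset[OF _ finite_PiE[of UNIV S]]) (auto simp: assms)
  show "inj_on vec_nth {x :: 'a ^ 'n. \<forall>i. x $ i \<in> S i}"
    by (simp add: inj_on_def vec_nth_inject)
qed

text \<open>\<theta> is trivial on the lattice of \<open>J\<close>, which contains \<open>D\<close>
  times each unit vector. Hence the coordinates are roots of unity, which gives both finiteness of
  A(M) and modulus 1.\<close>

lemma finite_characters:
  fixes M :: "int ^ 'n ^ 's"
  obtains D where "D > 0"
    "\<And>J \<theta> i. spanning M J \<Longrightarrow> (\<And>i. \<theta> $ i \<noteq> 0) \<Longrightarrow> (\<And>j. j \<in> J \<Longrightarrow> vpow \<theta> (column j M) = 1)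
      \<Longrightarrow> \<theta> $ i ^ D = 1"
proof -
  obtain D :: int where D: "D > 0" "\<And>J a. spanning M J \<Longrightarrow> D *s a \<in> lattice_of M J"
    using common_lattice_multiple by blast
  show thesis
  proof (rule that[of "nat D"])
    fix J and \<theta> :: "complex ^ 's" and i
    assume "spanning M J" "\<And>i. \<theta> $ i \<noteq> 0" "\<And>j. j \<in> J \<Longrightarrow> vpow \<theta> (column j M) = 1"
    then have "vpow \<theta> (D *s axis i 1) = 1" using vpow_lattice_of[OF D(2)] by blast
    then show "\<theta> $ i ^ nat D = 1" using D(1) by (simp add: vpow_axis power_int_def)
  qed (use D in simp)
qed

lemma finite_A_set: "finite (A_set M)" for M :: "int ^ 'n ^ 's"
proof -
  obtain D where D: "D > 0"
    "\<And>J \<theta> i. spanning M J \<Longrightarrow> (\<And>i. \<theta> $ i \<noteq> 0) \<Longrightarrow> (\<And>j. j \<in> J \<Longrightarrow> vpow \<theta> (column j M) = 1)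
      \<Longrightarrow> \<theta> $ i ^ D = 1"
    using finite_characters by blast
  have "A_set M \<subseteq> {\<theta>. \<forall>i. \<theta> $ i \<in> {z. z ^ D = 1}}"
    using D(2) by (auto simp: A_set_def cols_at_def)
  moreover have "finite {z :: complex. z ^ D = 1}" using D(1) by (intro finite_roots_unity) simp
  ultimately show ?thesis using finite_vec_set[of "\<lambda>_. {z. z ^ D = 1}"] finite_subset by blast
qed

section \<open>Lattices of 1-prime matrices\<close>

lemma Gcd_in_subgroup:
  fixes T :: "int set"
  assumes "finite T" "\<And>t. t \<in> T \<Longrightarrow> P t" "P 0" "\<And>a b. P a \<Longrightarrow> P b \<Longrightarrow> P (a + b)"
    and "\<And>k a. P a \<Longrightarrow> P (k * a)"
  shows "P (Gcd T)"
  using assms(1,2)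
proof (induction T)
  case (insert t T)
  obtain u v where "u * t + v * Gcd T = gcd t (Gcd T)" using bezout_int by blast
  then show ?case using insert assms(4,5) by (metis Gcd_insert insertCI)
qed (simp add: assms(3))

text \<open>A basis inside \<open>J\<close> together with one more column of \<open>J\<close>
  belongs to \<open>S1 M\<close>. Each determinant of a basis in it moves \<open>a\<close> into the
  lattice by Cramer's rule, and Bezout combines these multiples into their gcd, which is 1.\<close>

lemma one_prime_lattice:
  fixes M :: "int ^ 'n ^ 's"
  assumes "one_prime M" "spanning M J" "card J \<noteq> CARD('s)"
  shows "a \<in> lattice_of M J"
proof -
  obtain B where B: "B \<subseteq> J" "card B = CARD('s)" "spanning M B"
    using assms(2) by (rule spanning_imp_basis)
  then obtain j where j: "j \<in> J" "j \<notin> B" using assms(3) by (metis subsetI subset_antisym)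
  let ?Y = "insert j B"
  have Y: "?Y \<in> S1 M"
    using B j by (auto simp: S1_def intro: spanning_mono)
  have "Gcd (absdet M ` bases M ?Y) *s a \<in> lattice_of M J"
  proof (rule Gcd_in_subgroup)
    fix t assume "t \<in> absdet M ` bases M ?Y"
    then obtain X where X: "X \<subseteq> ?Y" "card X = CARD('s)" "spanning M X" "t = absdet M X"
      by (auto simp: bases_def)
    then have "X \<subseteq> J" using B j by auto
    then show "t *s a \<in> lattice_of M J"
      using absdet_smult_in_lattice[OF X(2,3)] X(4) lattice_of_mono[of X J M] by auto
  next
    fix k t assume "t *s a \<in> lattice_of M J"
    then show "(k * t) *s a \<in> lattice_of M J"
      using lattice_of_smult[of "t *s a" M J k] by (simp add: vector_smult_assoc)
  qed (auto simp: lattice_of_0 lattice_of_add vector_sadd_rdistrib)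
  moreover have "Gcd (absdet M ` bases M ?Y) = 1"
    using assms(1) Y by (simp add: one_prime_def)
  ultimately show ?thesis by simp
qed

text \<open>Otherwise the columns on which \<theta> is trivial would generate all integer vectors,
  forcing \<theta> = e.\<close>

lemma one_prime_card_cols_at:
  fixes M :: "int ^ 'n ^ 's"
  assumes "one_prime M" "\<theta> \<in> A_set M" "\<theta> \<noteq> (\<chi> i. 1)"
  shows "card (cols_at M \<theta>) = CARD('s)"
proof (rule ccontr)
  assume c: "card (cols_at M \<theta>) \<noteq> CARD('s)"
  have "\<theta> $ i = 1" for i
  proof -
    have "axis i 1 \<in> lattice_of M (cols_at M \<theta>)"
      using assms(2) by (intro one_prime_lattice[OF assms(1) _ c]) (simp add: A_set_def)
    then have "vpow \<theta> (axis i 1) = 1"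
      by (rule vpow_lattice_of) (use assms(2) in \<open>simp_all add: A_set_def cols_at_def\<close>)
    then show ?thesis using vpow_axis[of \<theta> 1 i] by simp
  qed
  then show False using assms(3) by (simp add: vec_eq_iff)
qed

section \<open>Volume and integer points of a parallelepiped\<close>

text \<open>
  \<open>measure_linear_image\<close> assumes a well-ordered index type.
\<close>

lemma measure_matrix_image:
  fixes A :: "real ^ 'n ^ 'n"
  assumes "S \<in> lmeasurable"
  shows "(*v) A ` S \<in> lmeasurable \<and> measure lebesgue ((*v) A ` S) = \<bar>det A\<bar> * measure lebesgue S"
proof -
  define P where "P A \<longleftrightarrow> (\<forall>S\<in>lmeasurable. (*v) A ` S \<in> lmeasurable \<and>
    measure lebesgue ((*v) A ` S) = \<bar>det A\<bar> * measure lebesgue S)" for A :: "real ^ 'n ^ 'n"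
  have boxes: "P A" if "\<And>a b. measure lebesgue ((*v) A ` cbox a b) = \<bar>det A\<bar> * measure lebesgue (cbox a b)"
    for A
    unfolding P_def using measure_linear_sufficient[OF matrix_vector_mul_linear _ that] by auto
  have "P A"
  proof (induction A rule: induct_matrix_elementary_alt)
    case (1 A B)
    have "(*v) (A ** B) ` S = (*v) A ` (*v) B ` S" for S
      by (simp add: image_comp comp_def matrix_vector_mul_assoc)
    with 1 show ?case unfolding P_def by (simp add: det_mul abs_mult)
  next
    case (2 A i)
    have "negligible ((*v) A ` S)" for S
    proof (rule negligible_subset[OF negligible_standard_hyperplane_cart[of i]])
      show "(*v) A ` S \<subseteq> {x. x $ i = 0}"
        using 2 by (auto simp: matrix_vector_mult_def row_def vec_eq_iff)
    qed
    then show ?case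
      using det_zero_row(1)[OF 2] unfolding P_def
      by (auto simp: negligible_iff_measure)
  next
    case (3 A)
    have "(*v) A = (\<lambda>x. \<chi> i. A $ i $ i * x $ i)"
    proof
      fix x
      have "(\<Sum>j\<in>UNIV. A $ i $ j * x $ j) = A $ i $ i * x $ i" for i
        using 3 by (subst sum.remove[of _ i]) (auto intro!: sum.neutral)
      then show "A *v x = (\<chi> i. A $ i $ i * x $ i)" by (simp add: matrix_vector_mult_def)
    qed
    then show ?case
      unfolding P_def using measurable_stretch measure_stretch det_diagonal[of A] 3 by auto
  next
    case (4 m n)
    let ?A = "(\<chi> i j. mat 1 $ i $ Transposition.transpose m n j) :: real ^ 'n ^ 'n"
    let ?h = "\<lambda>x :: real ^ 'n. \<chi> i. x $ Transposition.transpose m n i"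
    have A: "(*v) ?A = ?h"
    proof
      fix x :: "real ^ 'n"
      have "(\<Sum>j\<in>UNIV. mat 1 $ i $ Transposition.transpose m n j * x $ j) = x $ Transposition.transpose m n i"
        for i
      proof -
        have "(\<Sum>j\<in>UNIV. mat 1 $ i $ Transposition.transpose m n j * x $ j)
          = (\<Sum>j\<in>UNIV. if j = Transposition.transpose m n i then x $ j else 0)"
          by (intro sum.cong) (auto simp: mat_def)
        then show ?thesis by simp
      qed
      then show "?A *v x = ?h x" by (simp add: matrix_vector_mult_def)
    qed
    have det: "\<bar>det ?A\<bar> = 1"
      by (simp add: det_permute_columns permutes_swap_id sign_swap_id abs_mult)
    show ?case
    proof (rule boxes)
      fix a b :: "real ^ 'n"
      have hh: "?h (?h x) = x" for x by (simp add: vec_eq_iff)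
      have "?h ` cbox a b = cbox (?h a) (?h b)"
      proof (intro equalityI subsetI)
        fix x assume x: "x \<in> cbox (?h a) (?h b)"
        have "?h x \<in> cbox a b"
          unfolding mem_box_cart
        proof
          fix i
          show "a $ i \<le> ?h x $ i \<and> ?h x $ i \<le> b $ i"
            using x[unfolded mem_box_cart, rule_format, of "Transposition.transpose m n i"] by simp
        qed
        then show "x \<in> ?h ` cbox a b" using hh[of x] by (metis image_eqI)
      qed (auto simp: mem_box_cart)
      moreover have "measure lebesgue (cbox (?h a) (?h b)) = measure lebesgue (cbox a b)"
      proof (cases "cbox a b = {}")
        case False
        then have "cbox (?h a) (?h b) \<noteq> {}" using calculation by (metis image_is_empty)
        then show ?thesis
          using False prod.permute[OF permutes_swap_id[of m UNIV n], of "\<lambda>i. (b - a) $ i"]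
          by (simp add: content_cbox_cart comp_def)
      qed (use calculation in simp)
      ultimately show "measure lebesgue ((*v) ?A ` cbox a b) = \<bar>det ?A\<bar> * measure lebesgue (cbox a b)"
        unfolding A det by simp
    qed
  next
    case (5 m n)
    let ?A = "(\<chi> i j. of_bool (i = m \<and> j = n \<or> i = j)) :: real ^ 'n ^ 'n"
    let ?h = "\<lambda>x :: real ^ 'n. \<chi> i. if i = m then x $ m + x $ n else x $ i"
    have A: "(*v) ?A = ?h"
    proof
      fix x :: "real ^ 'n"
      have "(\<Sum>j\<in>UNIV. of_bool (i = m \<and> j = n \<or> i = j) * x $ j) = (if i = m then x $ m + x $ n else x $ i)"
        for i
      proof -
        have "(\<Sum>j\<in>UNIV. of_bool (i = m \<and> j = n \<or> i = j) * x $ j)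
          = (\<Sum>j\<in>UNIV. (if j = i then x $ j else 0) + (if j = n then if i = m then x $ j else 0 else 0))"
          using 5 by (intro sum.cong) auto
        then show ?thesis by (simp add: sum.distrib)
      qed
      then show "?A *v x = ?h x" by (simp add: matrix_vector_mult_def)
    qed
    have "?A = (\<chi> k. if k = m then row m (mat 1) + 1 *s row n (mat 1) else row k (mat 1))"
      using 5 by (auto simp: vec_eq_iff row_def mat_def)
    then have det: "det ?A = 1"
      using det_row_operation[OF 5, of "mat 1" 1] by simp
    show ?case
    proof (rule boxes)
      fix a b :: "real ^ 'n"
      show "measure lebesgue ((*v) ?A ` cbox a b) = \<bar>det ?A\<bar> * measure lebesgue (cbox a b)"
      proof (cases "cbox a b = {}")
        case False
        \<comment> \<open>The box is moved to have its lower corner at 0, as the volume formula for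
          sheared boxes wants a nonnegative corner.\<close>
        have cb: "cbox a b = (+) a ` cbox 0 (b - a)" by (simp add: cbox_translation[symmetric])
        have "?h (a + x) = ?h a + ?h x" for x by (simp add: vec_eq_iff)
        then have "?h ` cbox a b = (+) (?h a) ` ?h ` cbox 0 (b - a)"
          unfolding cb image_image by simp
        then have "measure lebesgue (?h ` cbox a b) = measure lebesgue (?h ` cbox 0 (b - a))"
          by (simp only: measure_translation)
        also have "\<dots> = measure lebesgue (cbox 0 (b - a))"
          using 5 False unfolding cb by (intro measure_shear_interval) auto
        also have "\<dots> = measure lebesgue (cbox a b)" unfolding cb measure_translation ..
        finally show ?thesis unfolding A det by simp
      qed simp
    qed
  qed
  then show ?thesis using assms by (simp add: P_def)
qed

text \<open>Half-open, so that integer translates tile space without overlap: \<open>vfrac x\<close>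
  is the only representative of x in the cell.\<close>

definition unit_cell :: "(real ^ 'n) set" where
  "unit_cell = {x. \<forall>i. 0 \<le> x $ i \<and> x $ i < 1}"

definition int_points :: "(real ^ 'n) set" where
  "int_points = {x. \<forall>i. x $ i \<in> \<int>}"

definition vfrac :: "real ^ 'n \<Rightarrow> real ^ 'n" where
  "vfrac x = (\<chi> i. frac (x $ i))"

lemma vfrac_in_unit_cell: "vfrac x \<in> unit_cell"
  by (simp add: vfrac_def unit_cell_def frac_lt_1)

lemma vfrac_diff_int: "x - vfrac x \<in> int_points"
  by (simp add: vfrac_def int_points_def frac_def)

lemma int_points_diff: "x \<in> int_points \<Longrightarrow> y \<in> int_points \<Longrightarrow> x - y \<in> int_points"
  by (simp add: int_points_def)

lemma int_points_minus: "x \<in> int_points \<Longrightarrow> - x \<in> int_points"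
  by (simp add: int_points_def)

lemma vfrac_unique:
  assumes "x - y \<in> int_points" "y \<in> unit_cell"
  shows "vfrac x = y"
  using assms by (simp add: vfrac_def int_points_def unit_cell_def vec_eq_iff frac_unique_iff)

lemma unit_cell_measure: "(unit_cell :: (real ^ 'n) set) \<in> lmeasurable" "measure lebesgue (unit_cell :: (real ^ 'n) set) = 1"
proof -
  let ?B = "cbox 0 (\<chi> i. 1) :: (real ^ 'n) set"
  have "?B - unit_cell \<union> (unit_cell - ?B) \<subseteq> ?B - box 0 (\<chi> i. 1)"
    by (auto simp: mem_box_cart unit_cell_def less_imp_le)
  then have "negligible (?B - unit_cell \<union> (unit_cell - ?B))"
    using negligible_frontier_interval negligible_subset by blast
  moreover have "measure lebesgue ?B = 1" by (simp add: content_cbox_cart interval_ne_empty_cart)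
  ultimately show "(unit_cell :: (real ^ 'n) set) \<in> lmeasurable" "measure lebesgue (unit_cell :: (real ^ 'n) set) = 1"
    using lmeasurable_negligible_symdiff[of ?B unit_cell] measure_negligible_symdiff[of ?B unit_cell]
    by simp_all
qed

lemma finite_bounded_int_points:
  assumes "bounded S"
  shows "finite (S \<inter> int_points :: (real ^ 'n) set)"
proof -
  obtain B where B: "\<And>x. x \<in> S \<Longrightarrow> norm x \<le> B" using assms by (auto simp: bounded_iff)
  have "S \<inter> int_points \<subseteq> {x. \<forall>i. x $ i \<in> {k \<in> \<int>. \<bar>k\<bar> \<le> B}}"
    using order_trans[OF component_le_norm_cart B] by (auto simp: int_points_def)
  moreover have "finite {k :: real \<in> \<int>. \<bar>k\<bar> \<le> B}"
    by (rule finite_abs_int_segment)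
  ultimately show ?thesis using finite_vec_set[of "\<lambda>_. {k :: real \<in> \<int>. \<bar>k\<bar> \<le> B}"] finite_subset by blast
qed

text \<open>
  Both \<open>unit_cell\<close> and its image under \<open>A\<close> are cut up by integer translates of \<open>unit_cell\<close>.  Moving
  all pieces of the image into \<open>unit_cell\<close> covers every point equally often, since the integer points
  form a group; hence the covering multiplicity is the volume of the image.
\<close>

lemma card_unit_cell_preimage:
  fixes A :: "real ^ 'n ^ 'n"
  assumes int: "\<And>i j. A $ i $ j \<in> \<int>" and det: "det A \<noteq> 0"
  shows "real (card {u \<in> unit_cell. A *v u \<in> int_points}) = \<bar>det A\<bar>"
proof -
  let ?Q = "unit_cell :: (real ^ 'n) set"
  define U where "U = {u \<in> ?Q. A *v u \<in> int_points}"
  define P where "P = (*v) A ` ?Q"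
  have inj: "inj ((*v) A)" using det by (simp add: invertible_det_nz inj_matrix_vector_mult)
  have A_int: "A *v z \<in> int_points" if "z \<in> int_points" for z
    using that int by (auto simp: int_points_def matrix_vector_mult_def)
  have bQ: "bounded ?Q"
    by (rule bounded_subset[of "cbox 0 (\<chi> i. 1)"])
      (auto simp: unit_cell_def mem_box_cart less_imp_le)
  then have bP: "bounded P" unfolding P_def
    by (intro bounded_linear_image matrix_vector_mul_bounded_linear)
  have bPQ: "bounded {p - q | p q. p \<in> P \<and> q \<in> ?Q}"
  proof -
    obtain b c where "\<And>p. p \<in> P \<Longrightarrow> norm p \<le> b" "\<And>q. q \<in> ?Q \<Longrightarrow> norm q \<le> c"
      using bP bQ by (auto simp: bounded_iff)
    then show ?thesis
      unfolding bounded_iff by (intro exI[of _ "b + c"]) (auto intro: order_trans[OF norm_triangle_ineq4] add_mono)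
  qed
  \<comment> \<open>The only integer vectors that can carry a point of the cell into
    \<open>P\<close>; there are finitely many because both sets are bounded.\<close>
  define Z where "Z = {p - q | p q. p \<in> P \<and> q \<in> ?Q} \<inter> int_points"
  have finZ: "finite Z"
    unfolding Z_def by (rule finite_bounded_int_points[OF bPQ])
  have cover: "card {z \<in> Z. x + z \<in> P} = card U" if x: "x \<in> ?Q" for x
  proof -
    have "surj ((*v) A)" using inj linear_injective_imp_surjective matrix_vector_mul_linear by blast
    then obtain u0 where u0: "A *v u0 = x" by (metis surjD)
    \<comment> \<open>Adding \<open>u0\<close> modulo integer points turns a solution of
      \<open>A *v u \<in> int_points\<close> into a point of the cell whose image differs from
      \<open>x\<close> by an integer vector; subtracting \<open>u0\<close> reverses this. So the
      fibre over \<open>x\<close> is a coset of the same group for every \<open>x\<close>.\<close>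
    have "bij_betw (\<lambda>u. A *v vfrac (u + u0) - x) U {z \<in> Z. x + z \<in> P}"
    proof (rule bij_betw_imageI)
      have eq: "A *v vfrac (u + u0) - x = A *v u - A *v (u + u0 - vfrac (u + u0))" for u
        by (simp add: matrix_vector_mult_diff_distrib matrix_vector_right_distrib u0)
      show "inj_on (\<lambda>u. A *v vfrac (u + u0) - x) U"
      proof (rule inj_onI)
        fix u v assume uv: "u \<in> U" "v \<in> U" "A *v vfrac (u + u0) - x = A *v vfrac (v + u0) - x"
        then have e: "vfrac (u + u0) = vfrac (v + u0)" using inj by (simp add: inj_eq)
        have "u - v = (u + u0 - vfrac (u + u0)) - (v + u0 - vfrac (v + u0))" using e by simp
        then have "u - v \<in> int_points" using int_points_diff vfrac_diff_int by metis
        then have "vfrac u = v" using uv by (intro vfrac_unique) (auto simp: U_def)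
        moreover have "vfrac u = u" using uv
          by (intro vfrac_unique) (auto simp: U_def int_points_def)
        ultimately show "u = v" by simp
      qed
      show "(\<lambda>u. A *v vfrac (u + u0) - x) ` U = {z \<in> Z. x + z \<in> P}"
      proof (intro equalityI subsetI)
        fix z assume "z \<in> (\<lambda>u. A *v vfrac (u + u0) - x) ` U"
        then obtain u where u: "u \<in> U" "z = A *v vfrac (u + u0) - x" by blast
        have "z \<in> int_points" unfolding u(2) eq
          using u(1) by (intro int_points_diff[OF _ A_int[OF vfrac_diff_int]]) (simp add: U_def)
        moreover have "A *v vfrac (u + u0) \<in> P" unfolding P_def using vfrac_in_unit_cell by blast
        ultimately show "z \<in> {z \<in> Z. x + z \<in> P}" using x u(2) by (auto simp: Z_def)
      next
        fix z assume "z \<in> {z \<in> Z. x + z \<in> P}"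
        then obtain w where w: "w \<in> ?Q" "z = A *v w - x" "z \<in> int_points"
          by (auto simp: Z_def P_def) (metis add_diff_cancel_left')
        have shift: "w - (vfrac (w - u0) + u0) \<in> int_points"
          using vfrac_diff_int[of "w - u0"] by (simp add: algebra_simps)
        have "vfrac (vfrac (w - u0) + u0) = w"
          using int_points_minus[OF shift] w(1) by (intro vfrac_unique) simp_all
        moreover have "vfrac (w - u0) \<in> U"
        proof -
          have "A *v vfrac (w - u0) = z - A *v (w - u0 - vfrac (w - u0))"
            using w(2) u0 by (simp add: matrix_vector_mult_diff_distrib)
          then show ?thesis
            using w(3) by (simp add: U_def vfrac_in_unit_cell int_points_diff A_int vfrac_diff_int)
        qed
        ultimately show "z \<in> (\<lambda>u. A *v vfrac (u + u0) - x) ` U"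
          using w(2) by (intro image_eqI[of _ _ "vfrac (w - u0)"]) auto
      qed
    qed
    then show ?thesis by (simp add: bij_betw_same_card)
  qed
  define piece where "piece z = {x \<in> ?Q. x + z \<in> P}" for z
  have mP: "P \<in> lmeasurable" "measure lebesgue P = \<bar>det A\<bar>"
    using measure_matrix_image[OF unit_cell_measure(1), of A] by (simp_all add: P_def unit_cell_measure(2))
  have piece_eq: "piece z = ?Q \<inter> (+) (- z) ` P" for z
    by (auto simp: piece_def image_iff) (metis add.commute uminus_add_conv_diff add_diff_cancel_right')
  have m_piece: "piece z \<in> lmeasurable" for z
    unfolding piece_eq using mP(1) unit_cell_measure(1)
    by (intro fmeasurable.Int measurable_translation)
  have P_eq: "P = (\<Union>z\<in>Z. (+) z ` piece z)"
  proof (intro equalityI subsetI)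
    fix p assume p: "p \<in> P"
    have "p - vfrac p \<in> Z" using p vfrac_in_unit_cell vfrac_diff_int by (auto simp: Z_def)
    moreover have "p \<in> (+) (p - vfrac p) ` piece (p - vfrac p)"
      using p vfrac_in_unit_cell[of p] by (intro image_eqI[of _ _ "vfrac p"]) (auto simp: piece_def)
    ultimately show "p \<in> (\<Union>z\<in>Z. (+) z ` piece z)" by blast
  qed (auto simp: piece_def add.commute)
  have "\<bar>det A\<bar> = (\<Sum>z\<in>Z. measure lebesgue ((+) z ` piece z))"
    unfolding mP(2)[symmetric]
  proof (subst P_eq, rule measure_finite_Union[OF finZ])
    show "disjoint_family_on (\<lambda>z. (+) z ` piece z) Z"
      unfolding disjoint_family_on_def
    proof (intro ballI impI, rule ccontr)
      fix z w assume zw: "z \<in> Z" "w \<in> Z" "z \<noteq> w" "(+) z ` piece z \<inter> (+) w ` piece w \<noteq> {}"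
      then obtain x y where xy: "x \<in> ?Q" "y \<in> ?Q" "z + x = w + y" by (auto simp: piece_def)
      have zw_int: "z \<in> int_points" "w \<in> int_points" using zw by (auto simp: Z_def)
      have "vfrac (z + x) = x" using zw_int(1) xy(1) by (intro vfrac_unique) simp_all
      moreover have "vfrac (z + x) = y"
        unfolding xy(3) using zw_int(2) xy(2) by (intro vfrac_unique) simp_all
      ultimately show False using xy zw by simp
    qed
    show "(\<lambda>z. (+) z ` piece z) ` Z \<subseteq> sets lebesgue"
      using m_piece measurable_translation by (auto dest: fmeasurableD)
    show "emeasure lebesgue ((+) z ` piece z) \<noteq> \<infinity>" for z
      using measurable_translation[OF m_piece[of z], of z] by (auto simp: fmeasurable_def)
  qed
  also have "\<dots> = (\<Sum>z\<in>Z. measure lebesgue (piece z))" by (simp add: measure_translation)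
  also have "\<dots> = (\<Sum>z\<in>Z. \<integral>x. indicator (piece z) x \<partial>lebesgue)"
    by simp
  also have "\<dots> = (\<integral>x. (\<Sum>z\<in>Z. indicator (piece z) x) \<partial>lebesgue)"
    using m_piece by (intro Bochner_Integration.integral_sum[symmetric])
      (simp add: lmeasurable_iff_integrable)
  \<comment> \<open>At a point of the cell the sum counts the translates landing in
    \<open>P\<close>, which \<open>cover\<close> evaluates independently of the point.\<close>
  also have "(\<lambda>x. (\<Sum>z\<in>Z. indicator (piece z) x)) = (\<lambda>x. real (card U) * indicator ?Q x)"
  proof
    fix x
    show "(\<Sum>z\<in>Z. indicator (piece z) x) = real (card U) * indicator ?Q x"
    proof (cases "x \<in> ?Q")
      case True
      then have "(\<Sum>z\<in>Z. indicator (piece z) x) = (\<Sum>z\<in>Z. if x + z \<in> P then 1 else 0 :: real)"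
        by (intro sum.cong) (auto simp: piece_def)
      also have "\<dots> = real (card {z \<in> Z. x + z \<in> P})" using finZ by (simp add: sum.If_cases Int_def)
      finally show ?thesis using True cover[OF True] by simp
    qed (simp add: piece_def)
  qed
  also have "(\<integral>x. real (card U) * indicator ?Q x \<partial>lebesgue) = real (card U)"
    using unit_cell_measure(2)[where 'n = 'n] by simp
  finally show ?thesis by (simp add: U_def)
qed

section \<open>Characters of the quotient by a basis lattice\<close>

text \<open>The dual of the quotient of Z^s by the lattice of \<open>X\<close>, a character being
  recorded by its values at the unit vectors.\<close>

definition characters :: "int ^ 'n ^ 's \<Rightarrow> 'n set \<Rightarrow> (complex ^ 's) set" where
  "characters M X = {\<theta>. (\<forall>i. \<theta> $ i \<noteq> 0) \<and> (\<forall>j\<in>X. vpow \<theta> (column j M) = 1)}"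

definition unitary :: "real ^ 's \<Rightarrow> complex ^ 's" where
  "unitary u = (\<chi> i. cis (2 * pi * u $ i))"

lemma prod_cis: "(\<Prod>i\<in>I. cis (f i)) = cis (\<Sum>i\<in>I. f i)"
  by (induction I rule: infinite_finite_induct) (simp_all add: cis_mult)

lemma vpow_unitary: "vpow (unitary u) \<beta> = cis (2 * pi * (u \<bullet> of_int_vec \<beta>))"
proof -
  have "vpow (unitary u) \<beta> = cis (\<Sum>i\<in>UNIV. of_int (\<beta> $ i) * (2 * pi * u $ i))"
    by (simp add: vpow_def unitary_def cis_power_int prod_cis)
  also have "(\<Sum>i\<in>UNIV. of_int (\<beta> $ i) * (2 * pi * u $ i)) = 2 * pi * (u \<bullet> of_int_vec \<beta>)"
    by (simp add: inner_vec_def of_int_vec_def sum_distrib_left algebra_simps)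
  finally show ?thesis .
qed

lemma cis_2pi_eq_1_iff: "cis (2 * pi * x) = 1 \<longleftrightarrow> x \<in> \<int>"
proof
  assume "cis (2 * pi * x) = 1"
  then have "cos (2 * pi * x) = 1" by (simp add: complex_eq_iff)
  then obtain n :: int where "2 * pi * x = n * 2 * pi" by (auto simp: cos_one_2pi_int)
  then show "x \<in> \<int>" by simp
qed simp

lemma cis_2pi_frac: "cis (2 * pi * frac x) = cis (2 * pi * x)"
proof -
  have "cis (2 * pi * x) = cis (2 * pi * frac x + 2 * pi * of_int \<lfloor>x\<rfloor>)"
    by (simp add: frac_def algebra_simps)
  also have "\<dots> = cis (2 * pi * frac x)"
    unfolding cis_mult[symmetric] using cis_2pi_eq_1_iff[of "of_int \<lfloor>x\<rfloor>"] by simp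
  finally show ?thesis by simp
qed

lemma unitary_in_characters:
  "unitary u \<in> characters M X \<longleftrightarrow> (\<forall>j\<in>X. u \<bullet> rcol M j \<in> \<int>)"
  unfolding characters_def mem_Collect_eq vpow_unitary cis_2pi_eq_1_iff rcol_eq
  by (simp add: unitary_def)

lemma inj_on_unitary: "inj_on unitary unit_cell"
proof (rule inj_onI)
  fix u v :: "real ^ 's" assume uv: "u \<in> unit_cell" "v \<in> unit_cell" "unitary u = unitary v"
  have "cis (2 * pi * (u $ i - v $ i)) = 1" for i
  proof -
    have "cis (2 * pi * u $ i) = cis (2 * pi * v $ i)"
      using uv(3) by (simp add: unitary_def vec_eq_iff)
    then have "cis (2 * pi * u $ i - 2 * pi * v $ i) = 1"
      by (simp add: cis_divide[symmetric])
    then show ?thesis by (simp add: algebra_simps)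
  qed
  then have "u - v \<in> int_points" by (simp add: int_points_def cis_2pi_eq_1_iff)
  then have "vfrac u = v" using uv(2) by (rule vfrac_unique)
  moreover have "vfrac u = u" using uv(1) by (intro vfrac_unique) (simp_all add: int_points_def)
  ultimately show "u = v" by simp
qed

text \<open>The coordinates are roots of unity, so they are determined by their arguments, reduced
  modulo a full turn.\<close>

lemma characters_unitary:
  fixes M :: "int ^ 'n ^ 's"
  assumes "spanning M X" "\<theta> \<in> characters M X"
  obtains u where "u \<in> unit_cell" "\<theta> = unitary u"
proof
  let ?u = "vfrac (\<chi> i. Arg (\<theta> $ i) / (2 * pi))"
  show "?u \<in> unit_cell" by (rule vfrac_in_unit_cell)
  obtain D where D: "D > 0"
    "\<And>J \<theta> i. spanning M J \<Longrightarrow> (\<And>i. \<theta> $ i \<noteq> 0) \<Longrightarrow> (\<And>j. j \<in> J \<Longrightarrow> vpow \<theta> (column j M) = 1)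
      \<Longrightarrow> \<theta> $ i ^ D = 1"
    using finite_characters by blast
  have "\<theta> $ i = cis (Arg (\<theta> $ i))" for i
  proof -
    have "\<theta> $ i ^ D = 1" using D(2)[OF assms(1)] assms(2) by (simp add: characters_def)
    then have "norm (\<theta> $ i) = 1"
      using D(1) by (metis norm_one norm_power power_eq_1_iff norm_ge_zero neq0_conv)
    then show ?thesis using rcis_cmod_Arg[of "\<theta> $ i"] by (simp add: rcis_def)
  qed
  then show "\<theta> = unitary ?u"
    by (simp add: unitary_def vfrac_def cis_2pi_frac vec_eq_iff)
qed

text \<open>Writing \<theta> = \<open>unitary u\<close>, triviality on \<open>X\<close> says that
  the transposed basis matrix sends \<open>u\<close> to an integer point. Such \<open>u\<close> in
  the unit cell are counted by the determinant.\<close>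

lemma card_characters:
  fixes M :: "int ^ 'n ^ 's"
  assumes "card X = CARD('s)" "spanning M X"
  shows "finite (characters M X)" "int (card (characters M X)) = absdet M X"
proof -
  obtain \<phi> :: "'s \<Rightarrow> 'n" where \<phi>: "bij_betw \<phi> UNIV X"
    "absdet M X = \<bar>det (\<chi> i k. M $ i $ \<phi> k)\<bar>"
    using absdet_witness[OF assms(1)] by blast
  define A :: "real ^ 's ^ 's" where "A = transpose (\<chi> i k. real_of_int (M $ i $ \<phi> k))"
  have det: "det A = of_int (det (\<chi> i k. M $ i $ \<phi> k))"
    by (simp add: A_def det_of_int)
  have det0: "det A \<noteq> 0"
    unfolding det using det_cols_nonzero[OF \<phi>(1) assms(2)] by simp
  let ?U = "{u \<in> unit_cell. A *v u \<in> int_points}"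
  have comp: "(A *v u) $ k = u \<bullet> rcol M (\<phi> k)" for u k
    by (simp add: A_def matrix_vector_mult_def transpose_def inner_vec_def rcol_def of_int_vec_def
        column_def mult.commute)
  have U: "u \<in> ?U \<longleftrightarrow> u \<in> unit_cell \<and> unitary u \<in> characters M X" for u
    using \<phi>(1) by (auto simp: int_points_def comp unitary_in_characters bij_betw_def)
  have bij: "bij_betw unitary ?U (characters M X)"
  proof (rule bij_betw_imageI)
    show "inj_on unitary ?U" by (rule inj_on_subset[OF inj_on_unitary]) auto
    show "unitary ` ?U = characters M X"
    proof (intro equalityI subsetI)
      fix \<theta> assume \<theta>: "\<theta> \<in> characters M X"
      then obtain u where "u \<in> unit_cell" "\<theta> = unitary u"
        using characters_unitary[OF assms(2)] by blast
      then show "\<theta> \<in> unitary ` ?U" using \<theta> U by blast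
    qed (use U in blast)
  qed
  have "real (card ?U) = \<bar>det A\<bar>"
    by (rule card_unit_cell_preimage[OF _ det0]) (simp add: A_def transpose_def)
  then have "real (card (characters M X)) = of_int (absdet M X)"
    unfolding det using bij_betw_same_card[OF bij] by (simp add: \<phi>(2))
  then show card: "int (card (characters M X)) = absdet M X"
    by (metis of_int_eq_iff of_int_of_nat_eq)
  show "finite (characters M X)"
    using card absdet_pos[OF assms] by (intro card_ge_0_finite) simp
qed

text \<open>Some coordinate of \<alpha> in the basis \<open>X\<close> is not an integer. The
  corresponding row of the inverse basis matrix takes integer values on \<open>X\<close>, so it is
  the exponent of a character that detects \<alpha>.\<close>

lemma characters_separate:
  fixes M :: "int ^ 'n ^ 's"
  assumes "card X = CARD('s)" "spanning M X" "\<alpha> \<notin> lattice_of M X"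
  obtains \<theta> where "\<theta> \<in> characters M X" "vpow \<theta> \<alpha> \<noteq> 1"
proof -
  obtain \<phi> :: "'s \<Rightarrow> 'n" where \<phi>: "bij_betw \<phi> UNIV X"
    using absdet_witness[OF assms(1)] by blast
  define R :: "real ^ 's ^ 's" where "R = (\<chi> i k. real_of_int (M $ i $ \<phi> k))"
  have "det R \<noteq> 0"
    using det_cols_nonzero[OF \<phi> assms(2)] by (simp add: R_def det_of_int)
  then have "invertible R" by (simp add: invertible_det_nz)
  then obtain S where S: "S ** R = mat 1" "R ** S = mat 1" by (auto simp: invertible_def)
  have R_axis: "R *v axis l 1 = rcol M (\<phi> l)" for l
    by (simp add: matrix_vector_mult_basis R_def column_def rcol_def of_int_vec_def)
  have "\<exists>k. (S *v of_int_vec \<alpha>) $ k \<notin> \<int>"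
  proof (rule ccontr)
    assume "\<nexists>k. (S *v of_int_vec \<alpha>) $ k \<notin> \<int>"
    then have z: "(S *v of_int_vec \<alpha>) $ k = of_int \<lfloor>(S *v of_int_vec \<alpha>) $ k\<rfloor>" for k
      by (auto elim: Ints_cases)
    define z where "z k = \<lfloor>(S *v of_int_vec \<alpha>) $ k\<rfloor>" for k
    have S_eq: "S *v of_int_vec \<alpha> = (\<chi> k. of_int (z k))"
      unfolding vec_eq_iff z_def using z by simp
    have "of_int_vec \<alpha> = R *v (S *v of_int_vec \<alpha>)"
      by (simp add: matrix_vector_mul_assoc S)
    also have "\<dots> = (\<Sum>k\<in>UNIV. of_int (z k) *\<^sub>R rcol M (\<phi> k))"
      unfolding S_eq
      by (simp add: matrix_vector_mult_def R_def vec_eq_iff rcol_def of_int_vec_def column_def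
          mult.commute)
    also have "\<dots> = of_int_vec (\<Sum>k\<in>UNIV. z k *s column (\<phi> k) M)"
      by (simp add: of_int_vec_sum of_int_vec_smult rcol_eq)
    finally have "\<alpha> = (\<Sum>k\<in>UNIV. z k *s column (\<phi> k) M)" by (simp add: of_int_vec_inj)
    moreover have "(\<Sum>k\<in>UNIV. z k *s column (\<phi> k) M) \<in> lattice_of M X"
      using \<phi> by (intro subgroup_sum[where P = "\<lambda>a. a \<in> lattice_of M X"] lattice_of_0 lattice_of_add
        lattice_of_smult lattice_of_column) (auto simp: bij_betw_def)
    ultimately show False using assms(3) by simp
  qed
  then obtain k where k: "(S *v of_int_vec \<alpha>) $ k \<notin> \<int>" by blast
  show thesis
  proof
    have "S $ k \<bullet> rcol M j \<in> \<int>" if "j \<in> X" for j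
    proof -
      obtain l where "j = \<phi> l" using \<phi> \<open>j \<in> X\<close> by (auto simp: bij_betw_def)
      then have "S *v rcol M j = S *v rcol M (\<phi> l)" by simp
      then have "S *v rcol M j = axis l 1"
        unfolding R_axis[symmetric] by (simp add: matrix_vector_mul_assoc S)
      then show ?thesis
        using matrix_vector_mul_component[of S "rcol M j" k] by (cases "k = l") (simp_all add: axis_def)
    qed
    then show "unitary (S $ k) \<in> characters M X" by (simp add: unitary_in_characters)
    show "vpow (unitary (S $ k)) \<alpha> \<noteq> 1"
      using k by (simp add: vpow_unitary cis_2pi_eq_1_iff matrix_vector_mul_component)
  qed
qed

lemma vpow_mult: "vpow (\<chi> i. \<theta> $ i * \<eta> $ i) \<alpha> = vpow \<theta> \<alpha> * vpow \<eta> \<alpha>"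
  by (simp add: vpow_def power_int_mult_distrib prod.distrib)

text \<open>Orthogonality: multiplication by a character \<eta> with \<eta>^\<alpha> different from
  1 permutes the group and multiplies the sum by that value.\<close>

lemma sum_characters:
  fixes M :: "int ^ 'n ^ 's"
  assumes "card X = CARD('s)" "spanning M X"
  shows "(\<Sum>\<theta>\<in>characters M X. vpow \<theta> \<alpha>)
    = (if \<alpha> \<in> lattice_of M X then of_int (absdet M X) else 0)"
proof (cases "\<alpha> \<in> lattice_of M X")
  case True
  then have "vpow \<theta> \<alpha> = 1" if "\<theta> \<in> characters M X" for \<theta>
    using that by (intro vpow_lattice_of[OF True]) (auto simp: characters_def)
  then have "(\<Sum>\<theta>\<in>characters M X. vpow \<theta> \<alpha>) = of_int (int (card (characters M X)))" by simp
  then show ?thesis using True by (simp only: card_characters(2)[OF assms] if_True)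
next
  case False
  then obtain \<eta> where \<eta>: "\<eta> \<in> characters M X" "vpow \<eta> \<alpha> \<noteq> 1"
    using characters_separate[OF assms] by blast
  let ?m = "\<lambda>\<theta>. (\<chi> i. \<eta> $ i * \<theta> $ i) :: complex ^ 's"
  let ?d = "\<lambda>\<theta>. (\<chi> i. inverse (\<eta> $ i) * \<theta> $ i) :: complex ^ 's"
  have inv: "vpow (\<chi> i. inverse (\<eta> $ i)) \<beta> = inverse (vpow \<eta> \<beta>)" for \<beta>
    using prod_inversef[of "\<lambda>i. \<eta> $ i powi \<beta> $ i" UNIV]
    by (simp add: vpow_def power_int_inverse comp_def)
  have d: "?d \<theta> \<in> characters M X" if "\<theta> \<in> characters M X" for \<theta>
    using that \<eta>(1) vpow_mult[of "\<chi> i. inverse (\<eta> $ i)" \<theta>] by (simp add: characters_def inv)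
  have "bij_betw ?m (characters M X) (characters M X)"
    by (rule bij_betw_byWitness[where f' = ?d])
      (use \<eta>(1) d in \<open>auto simp: characters_def vec_eq_iff vpow_mult\<close>)
  then have "(\<Sum>\<theta>\<in>characters M X. vpow \<theta> \<alpha>) = (\<Sum>\<theta>\<in>characters M X. vpow (?m \<theta>) \<alpha>)"
    by (rule sum.reindex_bij_betw[symmetric])
  also have "\<dots> = vpow \<eta> \<alpha> * (\<Sum>\<theta>\<in>characters M X. vpow \<theta> \<alpha>)"
    by (simp add: vpow_mult sum_distrib_left)
  finally have "(1 - vpow \<eta> \<alpha>) * (\<Sum>\<theta>\<in>characters M X. vpow \<theta> \<alpha>) = 0"
    by (simp add: algebra_simps)
  then show ?thesis using \<eta>(2) False by simp
qed

section \<open>Partition functions and their extension from a cone\<close>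

text \<open>The representations counted by t for the submatrix on \<open>J\<close>; zero entries
  outside \<open>J\<close> keep all vectors in one type.\<close>

definition solutions :: "int ^ 'n ^ 's \<Rightarrow> 'n set \<Rightarrow> int ^ 's \<Rightarrow> (int ^ 'n) set" where
  "solutions M J \<alpha> = {\<beta>. (\<forall>j. 0 \<le> \<beta> $ j) \<and> (\<forall>j. j \<notin> J \<longrightarrow> \<beta> $ j = 0) \<and> M *v \<beta> = \<alpha>}"

lemma vpart_solutions: "vpart M \<alpha> = card (solutions M UNIV \<alpha>)"
  by (simp add: vpart_def solutions_def)

lemma of_int_vec_matrix_mult:
  fixes M :: "int ^ 'n ^ 's"
  shows "of_int_vec (M *v \<beta>) = (\<Sum>j\<in>UNIV. of_int (\<beta> $ j) *\<^sub>R rcol M j)"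
  by (simp add: matrix_mult_sum of_int_vec_sum of_int_vec_smult rcol_eq)

lemma solutions_imp_cone:
  fixes M :: "int ^ 'n ^ 's"
  assumes "solutions M J \<alpha> \<noteq> {}"
  obtains c where "\<And>j. 0 \<le> c j" "of_int_vec \<alpha> = (\<Sum>j\<in>J. c j *\<^sub>R rcol M j)"
proof -
  obtain \<beta> where \<beta>: "\<And>j. 0 \<le> \<beta> $ j" "\<And>j. j \<notin> J \<Longrightarrow> \<beta> $ j = 0" "M *v \<beta> = \<alpha>"
    using assms by (auto simp: solutions_def)
  have "of_int_vec \<alpha> = (\<Sum>j\<in>UNIV. of_int (\<beta> $ j) *\<^sub>R rcol M j)"
    unfolding \<beta>(3)[symmetric] by (rule of_int_vec_matrix_mult)
  also have "\<dots> = (\<Sum>j\<in>J. of_int (\<beta> $ j) *\<^sub>R rcol M j)"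
    by (rule sum.mono_neutral_right) (auto simp: \<beta>(2))
  finally show thesis using that[of "\<lambda>j. of_int (\<beta> $ j)"] \<beta>(1) by simp
qed

text \<open>A linear functional exceeding some b > 0 on every column bounds each entry of a
  solution. Without finiteness \<open>card\<close> would return its default 0 and the column
  recursion would be lost.\<close>

lemma finite_solutions:
  fixes M :: "int ^ 'n ^ 's"
  assumes "0 \<notin> convex hull (range (rcol M))"
  shows "finite (solutions M J \<alpha>)"
proof -
  have "closed (convex hull (range (rcol M)))"
    by (intro compact_imp_closed compact_convex_hull finite_imp_compact) simp
  then obtain a b where ab: "0 < b" "\<And>x. x \<in> convex hull (range (rcol M)) \<Longrightarrow> b < a \<bullet> x"
    using separating_hyperplane_closed_0[OF convex_convex_hull _ assms] by metis
  have pos: "b < a \<bullet> rcol M j" for j by (intro ab(2) hull_inc) simp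
  then have nonneg: "0 \<le> a \<bullet> rcol M j" for j using ab(1) by (meson less_imp_le less_trans)
  let ?B = "\<lfloor>(a \<bullet> of_int_vec \<alpha>) / b\<rfloor>"
  have "solutions M J \<alpha> \<subseteq> {\<beta>. \<forall>j. \<beta> $ j \<in> {0..?B}}"
  proof (intro subsetI CollectI allI)
    fix \<beta> j assume "\<beta> \<in> solutions M J \<alpha>"
    then have \<beta>: "\<And>j. 0 \<le> \<beta> $ j" "M *v \<beta> = \<alpha>" by (auto simp: solutions_def)
    have "of_int (\<beta> $ j) * b \<le> of_int (\<beta> $ j) * (a \<bullet> rcol M j)"
      using \<beta>(1)[of j] pos[of j] by (intro mult_left_mono) simp_all
    also have "\<dots> \<le> (\<Sum>i\<in>UNIV. of_int (\<beta> $ i) * (a \<bullet> rcol M i))"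
      using \<beta>(1) nonneg by (intro member_le_sum) simp_all
    also have "\<dots> = a \<bullet> of_int_vec \<alpha>"
      unfolding \<beta>(2)[symmetric] of_int_vec_matrix_mult by (simp add: inner_sum_right)
    finally have "of_int (\<beta> $ j) \<le> (a \<bullet> of_int_vec \<alpha>) / b" using ab(1) by (simp add: field_simps)
    then show "\<beta> $ j \<in> {0..?B}" using \<beta>(1) by (simp add: le_floor_iff)
  qed
  then show ?thesis using finite_vec_set[of "\<lambda>_. {0..?B}"] finite_subset by blast
qed

text \<open>Solutions are split by whether column \<open>y\<close> is used. Read as an equation for
  differences, \<open>bdiff (column y M)\<close> turns t for \<open>J\<close> into t for
  \<open>J - {y}\<close>.\<close>

lemma card_solutions_rec:
  fixes M :: "int ^ 'n ^ 's"
  assumes "0 \<notin> convex hull (range (rcol M))" "y \<in> J"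
  shows "card (solutions M J \<alpha>)
    = card (solutions M J (\<alpha> - column y M)) + card (solutions M (J - {y}) \<alpha>)"
proof -
  let ?up = "\<lambda>\<beta>. \<beta> + axis y 1 :: int ^ 'n"
  have mv: "M *v ?up \<beta> = M *v \<beta> + column y M" for \<beta>
    by (simp add: vec_eq_iff matrix_vector_mult_def column_def axis_def algebra_simps sum.distrib
        if_distrib[of "\<lambda>x. _ * x"] cong: if_cong)
  have "solutions M J \<alpha> = ?up ` solutions M J (\<alpha> - column y M) \<union> solutions M (J - {y}) \<alpha>"
  proof (intro equalityI subsetI)
    fix \<beta> assume \<beta>: "\<beta> \<in> solutions M J \<alpha>"
    show "\<beta> \<in> ?up ` solutions M J (\<alpha> - column y M) \<union> solutions M (J - {y}) \<alpha>"
    proof (cases "\<beta> $ y = 0")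
      case True
      then show ?thesis using \<beta> by (auto simp: solutions_def)
    next
      case False
      moreover have "0 \<le> \<beta> $ y" using \<beta> by (simp add: solutions_def)
      ultimately have "1 \<le> \<beta> $ y" by linarith
      then have "\<beta> - axis y 1 \<in> solutions M J (\<alpha> - column y M)"
        using \<beta> assms(2) mv[of "\<beta> - axis y 1"] by (auto simp: solutions_def axis_def)
      then show ?thesis by (intro UnI1 image_eqI[of _ _ "\<beta> - axis y 1"]) simp
    qed
  next
    fix \<beta> assume "\<beta> \<in> ?up ` solutions M J (\<alpha> - column y M) \<union> solutions M (J - {y}) \<alpha>"
    then show "\<beta> \<in> solutions M J \<alpha>"
      using assms(2) by (auto simp: solutions_def mv) (auto simp: axis_def)
  qed
  moreover have "?up ` solutions M J (\<alpha> - column y M) \<inter> solutions M (J - {y}) \<alpha> = {}"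
  proof -
    have "False" if "\<beta> \<in> solutions M J (\<alpha> - column y M)" "?up \<beta> \<in> solutions M (J - {y}) \<alpha>" for \<beta>
    proof -
      have "0 \<le> \<beta> $ y" "?up \<beta> $ y = 0" using that by (auto simp: solutions_def)
      then show False by (simp add: axis_def)
    qed
    then show ?thesis by blast
  qed
  moreover have "card (?up ` solutions M J (\<alpha> - column y M)) = card (solutions M J (\<alpha> - column y M))"
    by (intro card_image) (simp add: inj_on_def)
  ultimately show ?thesis
    using finite_solutions[OF assms(1)] by (simp add: card_Un_disjoint)
qed

text \<open>A linear, hence continuous, choice of coefficients, needed to follow zonotope
  coordinates as a point moves.\<close>

lemma linear_section:
  fixes M :: "int ^ 'n ^ 's"
  assumes "spanning M J"
  obtains \<sigma> :: "real ^ 's \<Rightarrow> real ^ 'n"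
  where "linear \<sigma>" "\<And>x. (\<Sum>j\<in>J. \<sigma> x $ j *\<^sub>R rcol M j) = x"
proof -
  let ?L = "\<lambda>a :: real ^ 'n. \<Sum>j\<in>J. a $ j *\<^sub>R rcol M j"
  have lin: "linear ?L"
    by (rule linearI) (simp_all add: scaleR_left_distrib sum.distrib scaleR_sum_right)
  have "rcol M j \<in> range ?L" if "j \<in> J" for j
  proof (rule range_eqI[of _ _ "axis j 1"])
    have "?L (axis j 1) = (\<Sum>i\<in>J. if i = j then rcol M j else 0)"
      by (intro sum.cong) (auto simp: axis_def)
    then show "rcol M j = ?L (axis j 1)" using that by simp
  qed
  then have "span (rcol M ` J) \<subseteq> range ?L"
    by (intro span_minimal linear_subspace_image[OF lin]) auto
  then have "surj ?L" using assms by (simp add: spanning_def top.extremum_unique)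
  then obtain g where "linear g" "?L \<circ> g = id"
    using linear_surjective_right_inverse[OF lin] by blast
  then show thesis using that[of g] by (simp add: fun_eq_iff)
qed

text \<open>v(\<Omega> | .) for the submatrix on \<open>J\<close>, with \<Omega> unchanged.\<close>

definition region :: "int ^ 'n ^ 's \<Rightarrow> (real ^ 's) set \<Rightarrow> 'n set \<Rightarrow> (int ^ 's) set" where
  "region M \<Omega> J = {\<alpha>. \<exists>\<omega>\<in>\<Omega>. \<exists>a. (\<forall>j\<in>J. 0 \<le> a j \<and> a j \<le> 1)
     \<and> of_int_vec \<alpha> = \<omega> - (\<Sum>j\<in>J. a j *\<^sub>R rcol M j)}"

lemma vset_region: "vset M \<Omega> = region M \<Omega> UNIV"
  by (auto simp: vset_def region_def zonotope_def)

text \<open>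
  In the application \<open>C\<close> is the cone over a small ball in \<open>\<Omega>\<close>; convexity of \<open>\<Omega>\<close>
  itself is never needed.
\<close>

locale cell =
  fixes M :: "int ^ 'n ^ 's" and \<Omega> C :: "(real ^ 's) set" and v :: "int ^ 's"
  assumes pointed: "0 \<notin> convex hull (range (rcol M))"
    and connected: "connected \<Omega>"
    and avoids: "\<not> spanning M J \<Longrightarrow> \<Omega> \<inter> col_cone M J = {}"
    and C_subset: "C \<subseteq> \<Omega>"
    and C_add: "x \<in> C \<Longrightarrow> y \<in> C \<Longrightarrow> x + y \<in> C"
    and v_in_C: "of_int_vec v \<in> C"
    and C_absorb: "\<exists>k0. \<forall>k\<ge>k0. \<forall>x. norm x \<le> B \<longrightarrow> real k *\<^sub>R of_int_vec v + x \<in> C"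
    and v_lattice: "spanning M J \<Longrightarrow> v \<in> lattice_of M J"
begin

text \<open>Validity on the lattice points of some translate of \<open>C\<close> by a multiple of v.
  Such predicates are closed under conjunction and under lattice shifts of the argument, and every
  ray in direction v eventually satisfies them.\<close>

definition deep :: "(int ^ 's \<Rightarrow> bool) \<Rightarrow> bool" where
  "deep P \<longleftrightarrow> (\<exists>k::nat. \<forall>\<alpha>. of_int_vec \<alpha> - real k *\<^sub>R of_int_vec v \<in> C \<longrightarrow> P \<alpha>)"

lemma C_ray: "x \<in> C \<Longrightarrow> x + real k *\<^sub>R of_int_vec v \<in> C"
proof (induction k)
  case (Suc k)
  then show ?case
    using C_add[OF Suc.IH[OF Suc.prems] v_in_C] by (simp add: algebra_simps)
qed simp

lemma C_mono:
  assumes "of_int_vec \<alpha> - real k *\<^sub>R of_int_vec v \<in> C" "l \<le> k"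
  shows "of_int_vec \<alpha> - real l *\<^sub>R of_int_vec v \<in> C"
  using C_ray[OF assms(1), of "k - l"] assms(2)
  by (simp add: of_nat_diff algebra_simps)

lemma deepI: "(\<And>\<alpha>. of_int_vec \<alpha> \<in> C \<Longrightarrow> P \<alpha>) \<Longrightarrow> deep P"
  unfolding deep_def by (rule exI[of _ 0]) simp

lemma deep_mono: "deep P \<Longrightarrow> (\<And>\<alpha>. P \<alpha> \<Longrightarrow> Q \<alpha>) \<Longrightarrow> deep Q"
  unfolding deep_def by blast

lemma deep_conj:
  assumes "deep P" "deep Q"
  shows "deep (\<lambda>\<alpha>. P \<alpha> \<and> Q \<alpha>)"
proof -
  obtain k l where "\<And>\<alpha>. of_int_vec \<alpha> - real k *\<^sub>R of_int_vec v \<in> C \<Longrightarrow> P \<alpha>"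
    "\<And>\<alpha>. of_int_vec \<alpha> - real l *\<^sub>R of_int_vec v \<in> C \<Longrightarrow> Q \<alpha>"
    using assms unfolding deep_def by blast
  then show ?thesis
    unfolding deep_def by (intro exI[of _ "max k l"]) (meson C_mono max.cobounded1 max.cobounded2)
qed

lemma deep_shift:
  assumes "deep P"
  shows "deep (\<lambda>\<alpha>. P (\<alpha> + z))"
proof -
  obtain k where k: "\<And>\<alpha>. of_int_vec \<alpha> - real k *\<^sub>R of_int_vec v \<in> C \<Longrightarrow> P \<alpha>"
    using assms unfolding deep_def by blast
  obtain l where l: "real l *\<^sub>R of_int_vec v + of_int_vec z \<in> C"
    using C_absorb[of "norm (of_int_vec z)"] by blast
  have "P (\<alpha> + z)" if "of_int_vec \<alpha> - real (k + l) *\<^sub>R of_int_vec v \<in> C" for \<alpha>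
    using C_add[OF that l] by (intro k) (simp add: of_int_vec_add algebra_simps)
  then show ?thesis unfolding deep_def by blast
qed

lemma deep_ray_all:
  assumes "deep P"
  shows "deep (\<lambda>\<alpha>. \<forall>l::nat. P (\<alpha> + int l *s v))"
proof -
  obtain k where k: "\<And>\<alpha>. of_int_vec \<alpha> - real k *\<^sub>R of_int_vec v \<in> C \<Longrightarrow> P \<alpha>"
    using assms unfolding deep_def by blast
  have "P (\<alpha> + int l *s v)" if "of_int_vec \<alpha> - real k *\<^sub>R of_int_vec v \<in> C" for \<alpha> l
    using C_ray[OF that, of l] by (intro k) (simp add: of_int_vec_add of_int_vec_smult algebra_simps)
  then show ?thesis unfolding deep_def by blast
qed

lemma deep_ray:
  assumes "deep P"
  obtains k0 :: nat where "\<And>k. k \<ge> k0 \<Longrightarrow> P (\<alpha> + int k *s v)"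
proof -
  obtain k where k: "\<And>\<alpha>. of_int_vec \<alpha> - real k *\<^sub>R of_int_vec v \<in> C \<Longrightarrow> P \<alpha>"
    using assms unfolding deep_def by blast
  obtain l where l: "\<And>m. m \<ge> l \<Longrightarrow> real m *\<^sub>R of_int_vec v + of_int_vec \<alpha> \<in> C"
    using C_absorb[of "norm (of_int_vec \<alpha>)"] by blast
  show thesis
  proof (rule that[of "k + l"])
    fix m assume m: "m \<ge> k + l"
    have "real (m - k) *\<^sub>R of_int_vec v + of_int_vec \<alpha> \<in> C" using m by (intro l) simp
    then show "P (\<alpha> + int m *s v)"
      using m by (intro k) (simp add: of_int_vec_add of_int_vec_smult of_nat_diff algebra_simps)
  qed
qed

lemma deep_bdiff_cong:
  assumes "deep (\<lambda>\<alpha>. f \<alpha> = g \<alpha>)"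
  shows "deep (\<lambda>\<alpha>. bdiff y f \<alpha> = bdiff y g \<alpha>)"
  using deep_conj[OF assms deep_shift[OF assms, of "- y"]]
  by (rule deep_mono) (simp add: bdiff_def)

lemma nabla_on_unique_zero:
  assumes "f \<in> nabla_on M J" "deep (\<lambda>\<alpha>. f \<alpha> = 0)"
  shows "f = (\<lambda>\<alpha>. 0)"
  using assms
proof (induction "card J" arbitrary: J f rule: less_induct)
  case less
  show ?case
  proof (cases "spanning M J")
    case False
    have "\<forall>Y\<subseteq>J. \<not> spanning M (J - Y) \<longrightarrow> bdiffs M Y f = (\<lambda>\<alpha>. 0)"
      using less.prems(1) by (simp add: nabla_on_def)
    from spec[OF this, of "{}"] False show ?thesis by simp
  next
    case True
    have col: "bdiff (column y M) f = (\<lambda>\<alpha>. 0)" if "y \<in> J" for y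
    proof (rule less.hyps)
      show "card (J - {y}) < card J" using that by (intro card_Diff1_less) auto
      show "bdiff (column y M) f \<in> nabla_on M (J - {y})"
        by (rule nabla_on_bdiff_column[OF less.prems(1) that])
      show "deep (\<lambda>\<alpha>. bdiff (column y M) f \<alpha> = 0)"
        using deep_bdiff_cong[OF less.prems(2), of "column y M"] by simp
    qed
    have "bdiff w f = (\<lambda>\<alpha>. 0)" if "w \<in> lattice_of M J" for w
      using that
      by (induction rule: lattice_of_induct) (simp_all add: col bdiff_zero_arg bdiff_plus bdiff_minus)
    \<comment> \<open>The vanishing column differences give only periods in the lattice of
      \<open>J\<close>. As v is such a period, the zeros far out along v return to every
      point.\<close>
    then have "bdiff v f = (\<lambda>\<alpha>. 0)" using v_lattice[OF True] by blast
    then have step: "f (\<alpha> - v) = f \<alpha>" for \<alpha> by (simp add: bdiff_def fun_eq_iff)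
    have per: "f (\<alpha> + int k *s v) = f \<alpha>" for \<alpha> and k :: nat
    proof (induction k)
      case (Suc k)
      then show ?case
        using step[of "\<alpha> + int (Suc k) *s v"] by (simp add: vector_sadd_rdistrib)
    qed simp
    show ?thesis
    proof
      fix \<alpha>
      obtain k where "f (\<alpha> + int k *s v) = 0" using deep_ray[OF less.prems(2)] by blast
      then show "f \<alpha> = 0" by (simp add: per)
    qed
  qed
qed

lemma nabla_on_unique:
  assumes "f \<in> nabla_on M J" "g \<in> nabla_on M J" "deep (\<lambda>\<alpha>. f \<alpha> = g \<alpha>)"
  shows "f = g"
proof -
  have "(\<lambda>\<alpha>. f \<alpha> + (-1) * g \<alpha>) = (\<lambda>\<alpha>. 0)"
    using nabla_on_lincomb[OF assms(1,2), of "-1"] deep_mono[OF assms(3)]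
    by (intro nabla_on_unique_zero[of _ J]) auto
  then show ?thesis by (simp add: fun_eq_iff)
qed

lemma region_if_C: "of_int_vec \<alpha> \<in> C \<Longrightarrow> \<alpha> \<in> region M \<Omega> J"
  unfolding region_def using C_subset by (auto intro!: bexI[of _ "of_int_vec \<alpha>"] exI[of _ "\<lambda>_. 0"])

text \<open>\<open>u\<close> obeys the difference equations only deep inside, whereas
  \<open>f\<close> has to obey them everywhere. The value of \<open>f\<close> at a point is read off
  far out along v and carried back by an element of nabla that continues
  \<open>bdiff v u\<close>.\<close>

lemma extension:
  assumes J: "spanning M J"
    and g: "\<And>y. y \<in> J \<Longrightarrow> g y \<in> nabla_on M (J - {y})"
    and u: "\<And>y. y \<in> J \<Longrightarrow> deep (\<lambda>\<alpha>. bdiff (column y M) u \<alpha> = g y \<alpha>)"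
  obtains f where "deep (\<lambda>\<alpha>. f \<alpha> = u \<alpha>)" "\<And>y. y \<in> J \<Longrightarrow> bdiff (column y M) f = g y"
proof -
  have g_J: "g y \<in> nabla_on M J" if "y \<in> J" for y
    by (rule nabla_on_mono[OF g[OF that]]) auto
  \<comment> \<open>Differences along sums and negatives are combinations of shifted differences, so
    from the columns the continuation reaches every lattice direction, in particular v.\<close>
  have "\<exists>G\<in>nabla_on M J. deep (\<lambda>\<alpha>. bdiff w u \<alpha> = G \<alpha>)" if "w \<in> lattice_of M J" for w
    using that
  proof (induction rule: lattice_of_induct)
    case (column y)
    then show ?case using u g_J by blast
  next
    case zero
    show ?case by (rule bexI[of _ "\<lambda>\<alpha>. 0"]) (auto simp: bdiff_zero_arg intro: deepI)
  next
    case (add a b)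
    then obtain F G where F: "F \<in> nabla_on M J" "deep (\<lambda>\<alpha>. bdiff a u \<alpha> = F \<alpha>)"
      and G: "G \<in> nabla_on M J" "deep (\<lambda>\<alpha>. bdiff b u \<alpha> = G \<alpha>)" by blast
    have "deep (\<lambda>\<alpha>. bdiff (a + b) u \<alpha> = F \<alpha> + 1 * G (\<alpha> + - a))"
      using deep_conj[OF F(2) deep_shift[OF G(2), of "- a"]]
      by (rule deep_mono) (simp add: bdiff_plus)
    then show ?case using nabla_on_lincomb[OF F(1) nabla_on_shift[OF G(1)]] by (rule rev_bexI[rotated])
  next
    case (minus a)
    then obtain F where F: "F \<in> nabla_on M J" "deep (\<lambda>\<alpha>. bdiff a u \<alpha> = F \<alpha>)" by blast
    have "deep (\<lambda>\<alpha>. bdiff (- a) u \<alpha> = 0 + (-1) * F (\<alpha> + a))"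
      using deep_shift[OF F(2), of a] by (rule deep_mono) (simp add: bdiff_minus)
    then show ?case using nabla_on_lincomb[OF nabla_on_zero nabla_on_shift[OF F(1)]] by (rule rev_bexI[rotated])
  qed
  then obtain G where G: "G \<in> nabla_on M J" "deep (\<lambda>\<alpha>. bdiff v u \<alpha> = G \<alpha>)"
    using v_lattice[OF J] by blast
  \<comment> \<open>Walk out k steps along v, take the value of \<open>u\<close>, and subtract the
    increments prescribed by \<open>G\<close>. This no longer depends on k once \<open>G\<close> and
    \<open>bdiff v u\<close> agree on the rest of the ray.\<close>
  define h where "h \<alpha> k = u (\<alpha> + int k *s v) - (\<Sum>i<k. G (\<alpha> + int (Suc i) *s v))" for \<alpha> k
  have h_Suc: "h \<alpha> (Suc k) = h \<alpha> k" if "bdiff v u (\<alpha> + int (Suc k) *s v) = G (\<alpha> + int (Suc k) *s v)" for \<alpha> k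
    using that by (simp add: h_def bdiff_def vector_sadd_rdistrib algebra_simps)
  have h_const: "h \<alpha> k = h \<alpha> k0"
    if "\<And>k. k > k0 \<Longrightarrow> bdiff v u (\<alpha> + int k *s v) = G (\<alpha> + int k *s v)" "k \<ge> k0" for \<alpha> k k0
    using that(2)
  proof (induction k rule: dec_induct)
    case (step k)
    then show ?case using h_Suc[of \<alpha> k] that(1)[of "Suc k"] by simp
  qed simp
  have "\<exists>k0. \<forall>k\<ge>k0. h \<alpha> k = h \<alpha> k0" for \<alpha>
    using deep_ray[OF G(2), of \<alpha>] h_const by (metis less_imp_le)
  then obtain K where K: "\<And>\<alpha> k. k \<ge> K \<alpha> \<Longrightarrow> h \<alpha> k = h \<alpha> (K \<alpha>)" by metis
  define f where "f \<alpha> = h \<alpha> (K \<alpha>)" for \<alpha>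
  show thesis
  proof
    show "deep (\<lambda>\<alpha>. f \<alpha> = u \<alpha>)"
      using deep_ray_all[OF G(2)]
    proof (rule deep_mono)
      fix \<alpha> assume "\<forall>l::nat. bdiff v u (\<alpha> + int l *s v) = G (\<alpha> + int l *s v)"
      then have "h \<alpha> (K \<alpha>) = h \<alpha> 0" by (intro h_const) simp_all
      then show "f \<alpha> = u \<alpha>" by (simp add: f_def h_def)
    qed
    fix y assume y: "y \<in> J"
    let ?y = "column y M"
    \<comment> \<open>Compatibility of the prescribed differences: deep inside both sides are the
      mixed difference of \<open>u\<close> along v and the column, so uniqueness in nabla makes them
      equal everywhere.\<close>
    have "bdiff ?y G = bdiff v (g y)"
    proof (rule nabla_on_unique)
      show "bdiff ?y G \<in> nabla_on M J" "bdiff v (g y) \<in> nabla_on M J"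
        by (intro nabla_on_bdiff G(1) g_J y)+
      show "deep (\<lambda>\<alpha>. bdiff ?y G \<alpha> = bdiff v (g y) \<alpha>)"
        using deep_conj[OF deep_bdiff_cong[OF G(2), of ?y] deep_bdiff_cong[OF u[OF y], of v]]
        by (rule deep_mono) (metis bdiff_commute)
    qed
    then have yG: "G \<alpha> - G (\<alpha> - ?y) = g y \<alpha> - g y (\<alpha> - v)" for \<alpha>
      by (simp add: bdiff_def fun_eq_iff)
    show "bdiff ?y f = g y"
    proof
      fix \<alpha>
      obtain k0 where k0: "\<And>k. k \<ge> k0 \<Longrightarrow> bdiff ?y u (\<alpha> + int k *s v) = g y (\<alpha> + int k *s v)"
        using deep_ray[OF u[OF y]] by blast
      \<comment> \<open>Far enough for both walks to have stabilised and for \<open>u\<close> to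
        satisfy the column equation at their common distance; the correction sums then
        telescope.\<close>
      define k where "k = max k0 (max (K \<alpha>) (K (\<alpha> - ?y)))"
      have f: "f \<alpha> = h \<alpha> k" "f (\<alpha> - ?y) = h (\<alpha> - ?y) k"
        unfolding f_def by (rule K[symmetric]; simp add: k_def)+
      have "(\<Sum>i<k. G (\<alpha> + int (Suc i) *s v)) - (\<Sum>i<k. G (\<alpha> - ?y + int (Suc i) *s v))
        = (\<Sum>i<k. g y (\<alpha> + int (Suc i) *s v) - g y (\<alpha> + int i *s v))"
        unfolding sum_subtractf[symmetric]
      proof (rule sum.cong[OF refl])
        fix i
        have "\<alpha> + int (Suc i) *s v - ?y = \<alpha> - ?y + int (Suc i) *s v"
          "\<alpha> + int (Suc i) *s v - v = \<alpha> + int i *s v"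
          by (simp_all add: vector_sadd_rdistrib)
        then show "G (\<alpha> + int (Suc i) *s v) - G (\<alpha> - ?y + int (Suc i) *s v)
          = g y (\<alpha> + int (Suc i) *s v) - g y (\<alpha> + int i *s v)"
          using yG[of "\<alpha> + int (Suc i) *s v"] by (simp only:)
      qed
      also have "\<dots> = g y (\<alpha> + int k *s v) - g y \<alpha>"
        by (subst sum_lessThan_telescope) simp
      finally have S: "(\<Sum>i<k. G (\<alpha> + int (Suc i) *s v)) - (\<Sum>i<k. G (\<alpha> - ?y + int (Suc i) *s v))
        = g y (\<alpha> + int k *s v) - g y \<alpha>" .
      have "\<alpha> + int k *s v - ?y = \<alpha> - ?y + int k *s v" by simp
      then have "u (\<alpha> + int k *s v) - u (\<alpha> - ?y + int k *s v) = g y (\<alpha> + int k *s v)"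
        using k0[of k] unfolding bdiff_def by (simp only: k_def max.cobounded1)
      then show "bdiff ?y f \<alpha> = g y \<alpha>"
        using S unfolding bdiff_def f h_def by (simp add: algebra_simps)
    qed
  qed
qed

end

text \<open>Near an integer x0 the floor may drop to x0 - 1, which still fits because the window is
  closed at 1.\<close>

lemma eventually_floor_window:
  fixes x0 :: real
  shows "eventually (\<lambda>x. 0 \<le> x0 - of_int \<lfloor>x\<rfloor> \<and> x0 - of_int \<lfloor>x\<rfloor> \<le> 1) (nhds x0)"
proof -
  have "eventually (\<lambda>x. x \<in> {of_int \<lceil>x0\<rceil> - 1 <..< of_int \<lfloor>x0\<rfloor> + 1}) (nhds x0)"
    by (intro eventually_nhds_in_open) (auto, linarith+)
  then show ?thesis
  proof eventually_elim
    case (elim x)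
    then have "\<lceil>x0\<rceil> - 1 \<le> \<lfloor>x\<rfloor>" "\<lfloor>x\<rfloor> < \<lfloor>x0\<rfloor> + 1"
      unfolding le_floor_iff floor_less_iff by simp_all
    then show ?case by linarith
  qed
qed

text \<open>A dependency would leave fewer than s columns that still span.\<close>

lemma basis_columns_independent:
  fixes M :: "int ^ 'n ^ 's"
  assumes J: "card J = CARD('s)" "spanning M J"
    and d: "(\<Sum>i\<in>J. d i *\<^sub>R rcol M i) = 0" and j: "j \<in> J"
  shows "d j = 0"
proof (rule ccontr)
  assume dj: "d j \<noteq> 0"
  have "d j *\<^sub>R rcol M j = - (\<Sum>i\<in>J - {j}. d i *\<^sub>R rcol M i)"
    using d j by (simp add: sum.remove[of J j] eq_neg_iff_add_eq_0)
  then have "rcol M j = (1 / d j) *\<^sub>R (- (\<Sum>i\<in>J - {j}. d i *\<^sub>R rcol M i))"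
    using dj by (metis (no_types, lifting) divide_self_if scaleR_one scaleR_scaleR times_divide_eq_left mult.left_neutral)
  also have "\<dots> \<in> span (rcol M ` (J - {j}))"
    by (intro span_scale span_neg span_sum) (auto intro: span_base)
  finally have "rcol M ` J \<subseteq> span (rcol M ` (J - {j}))"
    by (auto intro: span_base)
  then have "spanning M (J - {j})"
    using J(2) unfolding spanning_def by (metis span_mono span_span top.extremum_uniqueI)
  then have "CARD('s) \<le> card (J - {j})" by (rule spanning_card_ge)
  then show False using J(1) j by (metis card_Diff1_less finite leD)
qed

context cell
begin

text \<open>
  A lattice point \<open>\<omega> - b\<close> with \<open>b\<close> in the zonotope is carried along as \<open>\<omega>\<close> runs through \<open>\<Omega>\<close>: the
  coefficients of \<open>b\<close> follow \<open>\<omega>\<close> and are reduced to \<open>[0, 1]\<close> by adding columns.  Adding a column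
  happens only at times when the point lies in the region of the remaining columns.
\<close>

lemma region_zero:
  fixes D :: "int ^ 's \<Rightarrow> 'a::zero"
  assumes J: "spanning M J"
    and D: "\<And>j \<beta>. j \<in> J \<Longrightarrow> \<beta> \<in> region M \<Omega> (J - {j}) \<Longrightarrow> D \<beta> = D (\<beta> - column j M)"
    and deep: "deep (\<lambda>\<alpha>. D \<alpha> = 0)"
    and \<alpha>: "\<alpha> \<in> region M \<Omega> J"
  shows "D \<alpha> = 0"
proof -
  obtain \<sigma> :: "real ^ 's \<Rightarrow> real ^ 'n"
    where \<sigma>: "linear \<sigma>" "\<And>x. (\<Sum>j\<in>J. \<sigma> x $ j *\<^sub>R rcol M j) = x"
    using linear_section[OF J] by blast
  obtain \<omega>0 a where \<omega>0: "\<omega>0 \<in> \<Omega>" and a: "\<And>j. j \<in> J \<Longrightarrow> 0 \<le> a j" "\<And>j. j \<in> J \<Longrightarrow> a j \<le> 1"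
    and \<alpha>_eq: "of_int_vec \<alpha> = \<omega>0 - (\<Sum>j\<in>J. a j *\<^sub>R rcol M j)"
    using \<alpha> by (auto simp: region_def)
  \<comment> \<open>\<open>x \<omega>\<close> extends the zonotope coefficients of \<alpha> from
    \<open>\<omega>0\<close> to \<omega>, spreading the displacement over the columns by
    \<open>\<sigma>\<close>. \<open>pt n\<close> adds n_j copies of column j to \<alpha>, and
    \<open>adm\<close> says that lowering the coefficients by n brings them into [0, 1].\<close>
  define x where "x \<omega> j = a j + \<sigma> (\<omega> - \<omega>0) $ j" for \<omega> j
  define pt where "pt n = \<alpha> + (\<Sum>j\<in>J. n j *s column j M)" for n :: "'n \<Rightarrow> int"
  define adm where "adm \<omega> n \<longleftrightarrow> (\<forall>j\<in>J. 0 \<le> x \<omega> j - of_int (n j) \<and> x \<omega> j - of_int (n j) \<le> 1)" for \<omega> n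
  have pt_eq: "of_int_vec (pt n) = \<omega> - (\<Sum>j\<in>J. (x \<omega> j - of_int (n j)) *\<^sub>R rcol M j)" for n \<omega>
  proof -
    have "(\<Sum>j\<in>J. (x \<omega> j - of_int (n j)) *\<^sub>R rcol M j)
      = (\<Sum>j\<in>J. a j *\<^sub>R rcol M j) + (\<omega> - \<omega>0) - (\<Sum>j\<in>J. of_int (n j) *\<^sub>R rcol M j)"
      unfolding x_def by (simp add: scaleR_left_diff_distrib scaleR_left_distrib sum.distrib sum_subtractf \<sigma>(2))
    then show ?thesis
      by (simp add: pt_def of_int_vec_add of_int_vec_sum of_int_vec_smult \<alpha>_eq rcol_eq)
  qed
  have step_less: "D (pt p) = D (pt q)"
    if \<omega>: "\<omega> \<in> \<Omega>" "adm \<omega> p" "adm \<omega> q" and pq: "\<And>i. i \<noteq> j \<Longrightarrow> p i = q i" "p j < q j" "j \<in> J"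
    for p q j \<omega>
  proof -
    \<comment> \<open>Two distinct integers admissible at the same place are consecutive: the
      coefficient of column j is 1 for \<open>p\<close> and 0 for \<open>q\<close>. So
      \<open>pt q\<close> is a point of the region of the remaining columns.\<close>
    have bounds: "0 \<le> x \<omega> j - of_int (q j)" "x \<omega> j - of_int (p j) \<le> 1"
      using \<omega> pq(3) by (auto simp: adm_def)
    with pq(2) have qj: "q j = p j + 1" "x \<omega> j = of_int (q j)" by linarith+
    have "(\<Sum>i\<in>J - {j}. p i *s column i M) = (\<Sum>i\<in>J - {j}. q i *s column i M)"
      by (intro sum.cong) (auto simp: pq(1))
    then have pt: "pt p = pt q - column j M"
      using pq(3) by (simp add: pt_def sum.remove[of J j] qj(1) vector_sadd_rdistrib)
    have "of_int_vec (pt q) = \<omega> - (\<Sum>i\<in>J - {j}. (x \<omega> i - of_int (q i)) *\<^sub>R rcol M i)"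
      unfolding pt_eq[of q \<omega>] using pq(3) by (simp add: sum.remove[of J j] qj(2))
    then have "pt q \<in> region M \<Omega> (J - {j})"
      using \<omega> unfolding region_def mem_Collect_eq
      by (intro bexI[of _ \<omega>] exI[of _ "\<lambda>i. x \<omega> i - of_int (q i)"]) (auto simp: adm_def)
    then show ?thesis using D[OF pq(3)] pt by simp
  qed
  have step: "D (pt p) = D (pt q)"
    if \<omega>: "\<omega> \<in> \<Omega>" "adm \<omega> p" "adm \<omega> q" and eq: "\<And>i. i \<noteq> j \<Longrightarrow> p i = q i" for p q j \<omega>
  proof (cases "j \<in> J \<and> p j \<noteq> q j")
    case True
    then consider "p j < q j" | "q j < p j" by linarith
    then show ?thesis
    proof cases
      case 1
      then show ?thesis using True by (intro step_less[OF \<omega> eq]) auto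
    next
      case 2
      then show ?thesis using True by (intro step_less[OF \<omega>(1,3,2) eq[symmetric], symmetric]) auto
    qed
  next
    case False
    have "p i = q i" if "i \<in> J" for i using False eq that by (cases "i = j") auto
    then have "pt p = pt q" unfolding pt_def by (intro arg_cong2[of _ _ _ _ "(+)"] sum.cong) auto
    then show ?thesis by simp
  qed
  have same: "D (pt p) = D (pt q)" if \<omega>: "\<omega> \<in> \<Omega>" "adm \<omega> p" "adm \<omega> q" for p q \<omega>
  proof -
    have "D (pt (\<lambda>i. if i \<in> K then q i else p i)) = D (pt p)" if "finite K" for K
      using that
    proof (induction K)
      case (insert j K)
      have "D (pt (\<lambda>i. if i \<in> insert j K then q i else p i)) = D (pt (\<lambda>i. if i \<in> K then q i else p i))"
        using \<omega> by (intro step[of \<omega> _ _ j]) (auto simp: adm_def)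
      then show ?case using insert.IH by simp
    qed simp
    from this[of UNIV] show ?thesis by simp
  qed
  \<comment> \<open>The floors are a canonical admissible choice; by \<open>same\<close> any other
    admissible choice gives the same value.\<close>
  define val where "val \<omega> = D (pt (\<lambda>j. \<lfloor>x \<omega> j\<rfloor>))" for \<omega>
  have adm_floor: "adm \<omega> (\<lambda>j. \<lfloor>x \<omega> j\<rfloor>)" for \<omega>
    by (auto simp: adm_def) linarith
  have local_const: "eventually (\<lambda>w. val \<omega> = val w) (at \<omega> within \<Omega>)" if \<omega>: "\<omega> \<in> \<Omega>" for \<omega>
  proof -
    have lim: "((\<lambda>w. x w j) \<longlongrightarrow> x \<omega> j) (at \<omega> within \<Omega>)" for j
    proof -
      have "continuous_on UNIV \<sigma>"
        using \<sigma>(1) by (intro linear_continuous_on linear_conv_bounded_linear[THEN iffD1])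
      then have "continuous_on UNIV (\<lambda>w. \<sigma> (w - \<omega>0))"
        by (rule continuous_on_compose2)
          (auto intro!: continuous_on_diff continuous_on_id continuous_on_const)
      then have "continuous_on UNIV (\<lambda>w. x w j)"
        unfolding x_def by (intro continuous_on_add continuous_on_const continuous_on_component)
      then have "((\<lambda>w. x w j) \<longlongrightarrow> x \<omega> j) (at \<omega>)" by (simp add: continuous_on_def)
      then show ?thesis by (rule tendsto_within_subset) simp
    qed
    \<comment> \<open>The floors at a nearby w are still admissible at \<omega>, so the two values
      are compared at the single point \<omega>.\<close>
    have "eventually (\<lambda>w. \<forall>j\<in>J. 0 \<le> x \<omega> j - of_int \<lfloor>x w j\<rfloor> \<and> x \<omega> j - of_int \<lfloor>x w j\<rfloor> \<le> 1) (at \<omega> within \<Omega>)"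
      by (intro eventually_ball_finite ballI eventually_compose_filterlim[OF eventually_floor_window lim]) auto
    then show ?thesis
    proof eventually_elim
      case (elim w)
      then have "adm \<omega> (\<lambda>j. \<lfloor>x w j\<rfloor>)" by (simp add: adm_def)
      then show ?case unfolding val_def by (rule same[OF \<omega> adm_floor])
    qed
  qed
  have const: "val \<omega> = val \<omega>0" if "\<omega> \<in> \<Omega>" for \<omega>
    using connected_local_const[OF connected that \<omega>0] local_const by blast
  have "\<sigma> 0 = 0" using \<sigma>(1) by (rule linear_0)
  then have "adm \<omega>0 (\<lambda>_. 0)" using a by (simp add: adm_def x_def)
  then have "D (pt (\<lambda>_. 0)) = val \<omega>0" unfolding val_def by (rule same[OF \<omega>0 _ adm_floor])
  then have start: "D \<alpha> = val \<omega>0" by (simp add: pt_def)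
  obtain k0 where k0: "\<And>\<beta>. of_int_vec \<beta> - real k0 *\<^sub>R of_int_vec v \<in> C \<Longrightarrow> D \<beta> = 0"
    using deep unfolding deep_def by blast
  \<comment> \<open>\<open>B\<close> bounds the displacement between \<omega> and \<open>pt\<close>
    of its floors. Far out along v, \<open>k1\<close> steps absorb this displacement and
    \<open>k0\<close> steps bring the point to where \<open>D\<close> vanishes.\<close>
  define B where "B = (\<Sum>j\<in>J. norm (rcol M j))"
  obtain k1 where k1: "\<And>k y. k \<ge> k1 \<Longrightarrow> norm y \<le> B \<Longrightarrow> real k *\<^sub>R of_int_vec v + y \<in> C"
    using C_absorb[of B] by blast
  define \<omega> where "\<omega> = real (k0 + k1) *\<^sub>R of_int_vec v"
  have "B \<ge> 0" unfolding B_def by (simp add: sum_nonneg)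
  then have "\<omega> + 0 \<in> C" unfolding \<omega>_def by (intro k1) simp_all
  then have \<omega>: "\<omega> \<in> \<Omega>" using C_subset by auto
  define y where "y = - (\<Sum>j\<in>J. (x \<omega> j - of_int \<lfloor>x \<omega> j\<rfloor>) *\<^sub>R rcol M j)"
  have "norm y \<le> (\<Sum>j\<in>J. norm ((x \<omega> j - of_int \<lfloor>x \<omega> j\<rfloor>) *\<^sub>R rcol M j))"
    unfolding y_def norm_minus_cancel by (rule norm_sum)
  also have "\<dots> \<le> B"
    unfolding B_def
  proof (rule sum_mono)
    fix j
    have "\<bar>x \<omega> j - of_int \<lfloor>x \<omega> j\<rfloor>\<bar> \<le> 1" by linarith
    then show "norm ((x \<omega> j - of_int \<lfloor>x \<omega> j\<rfloor>) *\<^sub>R rcol M j) \<le> norm (rcol M j)"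
      using mult_right_mono[of _ 1 "norm (rcol M j)"] by simp
  qed
  finally have "real k1 *\<^sub>R of_int_vec v + y \<in> C" by (intro k1) simp_all
  moreover have "of_int_vec (pt (\<lambda>j. \<lfloor>x \<omega> j\<rfloor>)) - real k0 *\<^sub>R of_int_vec v = real k1 *\<^sub>R of_int_vec v + y"
    unfolding pt_eq[of _ \<omega>] y_def by (simp add: \<omega>_def algebra_simps)
  ultimately have "val \<omega> = 0" unfolding val_def by (intro k0) simp
  then show ?thesis using start const[OF \<omega>] by simp
qed

text \<open>\<Omega> misses the facets of the simplicial cone on \<open>J\<close>, since
  \<open>J - {i}\<close> does not span. It is therefore covered by two disjoint open sets, all
  coordinates positive and some coordinate negative; being connected and meeting the cone, it lies
  in the first.\<close>

lemma basis_coordinates_positive: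
  assumes J: "card J = CARD('s)" "spanning M J" and meet: "col_cone M J \<inter> \<Omega> \<noteq> {}"
    and \<omega>: "\<omega> \<in> \<Omega>" "\<omega> = (\<Sum>i\<in>J. c i *\<^sub>R rcol M i)" and j: "j \<in> J"
  shows "c j > 0"
proof -
  obtain \<sigma> :: "real ^ 's \<Rightarrow> real ^ 'n"
    where \<sigma>: "linear \<sigma>" "\<And>x. (\<Sum>j\<in>J. \<sigma> x $ j *\<^sub>R rcol M j) = x"
    using linear_section[OF J(2)] by blast
  have coord: "b i = \<sigma> x $ i" if "x = (\<Sum>i\<in>J. b i *\<^sub>R rcol M i)" "i \<in> J" for x b i
  proof -
    have "(\<Sum>i\<in>J. (b i - \<sigma> x $ i) *\<^sub>R rcol M i) = 0"
      using that(1) \<sigma>(2)[of x] by (simp add: scaleR_left_diff_distrib sum_subtractf)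
    from basis_columns_independent[OF J this that(2)] show ?thesis by simp
  qed
  have cont: "continuous_on UNIV (\<lambda>x. \<sigma> x $ i)" for i
    using \<sigma>(1) by (intro continuous_on_component) (intro linear_continuous_on linear_conv_bounded_linear[THEN iffD1])
  define U where "U = (\<Inter>i\<in>J. {x. 0 < \<sigma> x $ i})"
  define W where "W = (\<Union>i\<in>J. {x. \<sigma> x $ i < 0})"
  have "open U" "open W"
    unfolding U_def W_def
    by (intro open_INT open_UN ballI finite open_Collect_less continuous_on_const cont)+
  moreover have "U \<inter> W \<inter> \<Omega> = {}" by (force simp: U_def W_def)
  moreover have "\<Omega> \<subseteq> U \<union> W"
  proof
    fix x assume x: "x \<in> \<Omega>"
    show "x \<in> U \<union> W"
    proof (rule ccontr)
      assume "x \<notin> U \<union> W"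
      then obtain i where i: "i \<in> J" "\<sigma> x $ i = 0" and nonneg: "\<And>i. i \<in> J \<Longrightarrow> 0 \<le> \<sigma> x $ i"
        by (auto simp: U_def W_def) (metis linorder_neqE_linordered_idom not_less)
      have "x = (\<Sum>l\<in>J - {i}. \<sigma> x $ l *\<^sub>R rcol M l)"
        using \<sigma>(2)[of x] i by (simp add: sum.remove[of J i])
      then have "x \<in> col_cone M (J - {i})"
        unfolding col_cone_def mem_Collect_eq using nonneg by (intro exI[of _ "\<lambda>l. \<sigma> x $ l"]) auto
      moreover have "\<not> spanning M (J - {i})"
        using spanning_card_ge[of M "J - {i}"] J(1) card_Diff1_less[OF finite i(1)] by linarith
      ultimately show False using avoids x by blast
    qed
  qed
  moreover have "U \<inter> \<Omega> \<noteq> {}"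
  proof -
    obtain x where x: "x \<in> col_cone M J" "x \<in> \<Omega>" using meet by blast
    then obtain b where b: "x = (\<Sum>i\<in>J. b i *\<^sub>R rcol M i)" "\<And>i. i \<in> J \<Longrightarrow> 0 \<le> b i"
      by (auto simp: col_cone_def)
    have "x \<notin> W" using coord[OF b(1)] b(2) by (force simp: W_def)
    then show ?thesis using x \<open>\<Omega> \<subseteq> U \<union> W\<close> by blast
  qed
  ultimately have "W \<inter> \<Omega> = {}" using connectedD[OF connected, of U W] by blast
  then have "\<omega> \<in> U" using \<omega>(1) \<open>\<Omega> \<subseteq> U \<union> W\<close> by blast
  then show ?thesis using coord[OF \<omega>(2) j] j by (simp add: U_def)
qed

text \<open>Independence allows at most one solution, with the lattice coordinates of \<alpha> as
  entries. Whether these are nonnegative depends only on whether \<Omega> meets the cone.\<close>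

lemma card_solutions_basis:
  assumes J: "card J = CARD('s)" "spanning M J" and \<alpha>: "\<alpha> \<in> region M \<Omega> J"
  shows "of_nat (card (solutions M J \<alpha>))
    = (if \<alpha> \<in> lattice_of M J then meets (col_cone M J) \<Omega> else 0)"
proof -
  obtain \<omega> a where \<omega>: "\<omega> \<in> \<Omega>" and a: "\<And>j. j \<in> J \<Longrightarrow> 0 \<le> a j" "\<And>j. j \<in> J \<Longrightarrow> a j \<le> 1"
    and \<alpha>_eq: "of_int_vec \<alpha> = \<omega> - (\<Sum>j\<in>J. a j *\<^sub>R rcol M j)"
    using \<alpha> by (auto simp: region_def)
  have sol_sum: "M *v \<beta> = (\<Sum>j\<in>J. \<beta> $ j *s column j M)" if "\<And>j. j \<notin> J \<Longrightarrow> \<beta> $ j = 0" for \<beta>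
    unfolding matrix_mult_sum by (rule sum.mono_neutral_right) (auto simp: that)
  consider "\<alpha> \<notin> lattice_of M J" | "\<alpha> \<in> lattice_of M J" "col_cone M J \<inter> \<Omega> = {}"
    | "\<alpha> \<in> lattice_of M J" "col_cone M J \<inter> \<Omega> \<noteq> {}" by blast
  then show ?thesis
  proof cases
    case 1
    have "solutions M J \<alpha> = {}"
    proof (rule ccontr)
      assume "solutions M J \<alpha> \<noteq> {}"
      then obtain \<beta> where "\<And>j. j \<notin> J \<Longrightarrow> \<beta> $ j = 0" "M *v \<beta> = \<alpha>" by (auto simp: solutions_def)
      then have "\<alpha> = (\<Sum>j\<in>J. \<beta> $ j *s column j M)" using sol_sum by simp
      then show False using 1 unfolding lattice_of_def by blast
    qed
    then show ?thesis using 1 by simp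
  next
    case 2
    have "solutions M J \<alpha> = {}"
    proof (rule ccontr)
      assume "solutions M J \<alpha> \<noteq> {}"
      then obtain c where c: "\<And>j. 0 \<le> c j" "of_int_vec \<alpha> = (\<Sum>j\<in>J. c j *\<^sub>R rcol M j)"
        by (rule solutions_imp_cone) blast
      then have "\<omega> = (\<Sum>j\<in>J. (c j + a j) *\<^sub>R rcol M j)"
        using \<alpha>_eq by (simp add: scaleR_left_distrib sum.distrib algebra_simps)
      then have "\<omega> \<in> col_cone M J"
        unfolding col_cone_def mem_Collect_eq using c(1) a(1)
        by (intro exI[of _ "\<lambda>j. c j + a j"]) simp
      then show False using 2 \<omega> by blast
    qed
    then show ?thesis using 2 by (simp add: meets_def)
  next
    case 3
    obtain c where c: "\<alpha> = (\<Sum>j\<in>J. c j *s column j M)" using 3 by (auto simp: lattice_of_def)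
    have \<alpha>_c: "of_int_vec \<alpha> = (\<Sum>j\<in>J. of_int (c j) *\<^sub>R rcol M j)"
      by (simp add: c of_int_vec_sum of_int_vec_smult rcol_eq)
    then have \<omega>_eq: "\<omega> = (\<Sum>j\<in>J. (of_int (c j) + a j) *\<^sub>R rcol M j)"
      using \<alpha>_eq by (simp add: scaleR_left_distrib sum.distrib algebra_simps)
    have nonneg: "0 \<le> c j" if "j \<in> J" for j
    proof -
      \<comment> \<open>Strict positivity matters: with \<open>a j \<le> 1\<close> it yields c_j >
        -1, hence c_j \<ge> 0 for the integer c_j.\<close>
      have "0 < of_int (c j) + a j"
        by (rule basis_coordinates_positive[OF J 3(2) \<omega> \<omega>_eq that])
      then show ?thesis using a(2)[OF that] by linarith
    qed
    let ?\<beta> = "\<chi> j. if j \<in> J then c j else 0"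
    have "solutions M J \<alpha> = {?\<beta>}"
    proof (intro equalityI subsetI)
      fix \<beta> assume \<beta>: "\<beta> \<in> solutions M J \<alpha>"
      then have out: "\<And>j. j \<notin> J \<Longrightarrow> \<beta> $ j = 0" and "M *v \<beta> = \<alpha>" by (auto simp: solutions_def)
      then have "\<alpha> = (\<Sum>j\<in>J. \<beta> $ j *s column j M)" using sol_sum by simp
      then have "of_int_vec \<alpha> = (\<Sum>j\<in>J. of_int (\<beta> $ j) *\<^sub>R rcol M j)"
        by (simp add: of_int_vec_sum of_int_vec_smult rcol_eq)
      then have "(\<Sum>j\<in>J. (of_int (\<beta> $ j) - of_int (c j)) *\<^sub>R rcol M j) = 0"
        using \<alpha>_c by (simp add: scaleR_left_diff_distrib sum_subtractf)
      then have "of_int (\<beta> $ j) - of_int (c j) = (0 :: real)" if "j \<in> J" for j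
        using basis_columns_independent[OF J _ that, of "\<lambda>j. of_int (\<beta> $ j) - of_int (c j)"] by blast
      then show "\<beta> \<in> {?\<beta>}" using out by (simp add: vec_eq_iff)
    next
      fix \<beta> assume "\<beta> \<in> {?\<beta>}"
      then have \<beta>: "\<beta> = ?\<beta>" by simp
      have "M *v \<beta> = \<alpha>" unfolding c by (subst sol_sum) (auto simp: \<beta> intro!: sum.cong)
      then show "\<beta> \<in> solutions M J \<alpha>" using nonneg by (auto simp: solutions_def \<beta>)
    qed
    then show ?thesis using 3 by (simp add: meets_def)
  qed
qed

end

section \<open>The oscillating part\<close>

text \<open>When the columns generate all integer vectors, the cocycle identities pass polynomiality
  from the column differences to those along the axes.\<close>

lemma lattice_poly_if_bdiff_columns:
  fixes M :: "int ^ 'n ^ 's"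
  assumes "\<And>a. a \<in> lattice_of M J" "\<And>y. y \<in> J \<Longrightarrow> lattice_poly (bdiff (column y M) h)"
  shows "lattice_poly h"
proof (rule lattice_poly_if_bdiff_axis)
  fix i
  have "lattice_poly (bdiff a h)" for a
    using assms(1)[of a]
  proof (induction rule: lattice_of_induct)
    case (add a b)
    then show ?case unfolding bdiff_plus by (intro lattice_poly_add lattice_poly_shift)
  next
    case (minus a)
    then show ?case
      unfolding bdiff_minus
      by (intro lattice_poly_add lattice_poly_const lattice_poly_mult lattice_poly_shift)
  qed (simp_all add: assms(2) bdiff_zero_arg lattice_poly_const)
  then show "lattice_poly (bdiff (axis i 1) h)" .
qed

lemma A_set_nonzero: "\<theta> \<in> A_set M \<Longrightarrow> \<theta> $ i \<noteq> 0"
  by (simp add: A_set_def)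

lemma A_set_spanning: "\<theta> \<in> A_set M \<Longrightarrow> spanning M (cols_at M \<theta>)"
  by (simp add: A_set_def)

text \<open>For 1-prime M the columns at which such a \<theta> is trivial form a basis, so they
  still span inside \<open>J\<close> only if all of them remain.\<close>

definition osc_set :: "int ^ 'n ^ 's \<Rightarrow> 'n set \<Rightarrow> (complex ^ 's) set" where
  "osc_set M J = {\<theta> \<in> A_set M - {\<chi> i. 1}. cols_at M \<theta> \<subseteq> J}"

definition osc_coef :: "int ^ 'n ^ 's \<Rightarrow> (real ^ 's) set \<Rightarrow> 'n set \<Rightarrow> complex ^ 's \<Rightarrow> complex" where
  "osc_coef M \<Omega> J \<theta> = (1 / of_int (absdet M (cols_at M \<theta>)))
     * (\<Prod>w\<in>J - cols_at M \<theta>. 1 / (1 - vpow \<theta> (- column w M)))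
     * meets (col_cone M (cols_at M \<theta>)) \<Omega>"

definition osc :: "int ^ 'n ^ 's \<Rightarrow> (real ^ 's) set \<Rightarrow> 'n set \<Rightarrow> int ^ 's \<Rightarrow> complex" where
  "osc M \<Omega> J \<alpha> = (\<Sum>\<theta>\<in>osc_set M J. vpow \<theta> \<alpha> * osc_coef M \<Omega> J \<theta>)"

text \<open>The difference multiplies the \<theta>-term by 1 - \<theta>^(-y). This is zero if
  \<theta> is trivial on column y, matching the loss of \<theta> from the sum, and otherwise cancels
  the factor of that column.\<close>

lemma bdiff_osc:
  fixes M :: "int ^ 'n ^ 's"
  assumes "y \<in> J"
  shows "bdiff (column y M) (osc M \<Omega> J) = osc M \<Omega> (J - {y})"
proof
  fix \<alpha>
  have fin: "finite (osc_set M J)"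
    using finite_A_set[of M] by (auto simp: osc_set_def)
  have "bdiff (column y M) (osc M \<Omega> J) \<alpha>
    = (\<Sum>\<theta>\<in>osc_set M J. vpow \<theta> \<alpha> * ((1 - vpow \<theta> (- column y M)) * osc_coef M \<Omega> J \<theta>))"
    unfolding bdiff_def osc_def sum_subtractf[symmetric]
  proof (rule sum.cong[OF refl])
    fix \<theta> assume "\<theta> \<in> osc_set M J"
    then have nz: "\<And>i. \<theta> $ i \<noteq> 0" by (auto simp: osc_set_def A_set_nonzero)
    show "vpow \<theta> \<alpha> * osc_coef M \<Omega> J \<theta> - vpow \<theta> (\<alpha> - column y M) * osc_coef M \<Omega> J \<theta>
      = vpow \<theta> \<alpha> * ((1 - vpow \<theta> (- column y M)) * osc_coef M \<Omega> J \<theta>)"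
      using vpow_add[of \<theta> \<alpha> "- column y M"] nz by (simp add: algebra_simps)
  qed
  also have "\<dots> = (\<Sum>\<theta>\<in>osc_set M (J - {y}). vpow \<theta> \<alpha> * ((1 - vpow \<theta> (- column y M)) * osc_coef M \<Omega> J \<theta>))"
  proof (rule sum.mono_neutral_right[OF fin])
    show "osc_set M (J - {y}) \<subseteq> osc_set M J" by (auto simp: osc_set_def)
    show "\<forall>\<theta>\<in>osc_set M J - osc_set M (J - {y}).
      vpow \<theta> \<alpha> * ((1 - vpow \<theta> (- column y M)) * osc_coef M \<Omega> J \<theta>) = 0"
      by (auto simp: osc_set_def cols_at_def vpow_minus)
  qed
  also have "\<dots> = osc M \<Omega> (J - {y}) \<alpha>"
    unfolding osc_def
  proof (rule sum.cong[OF refl])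
    fix \<theta> assume "\<theta> \<in> osc_set M (J - {y})"
    then have y: "y \<notin> cols_at M \<theta>" by (auto simp: osc_set_def)
    then have "vpow \<theta> (- column y M) \<noteq> 1" by (simp add: cols_at_def vpow_minus)
    moreover have "(\<Prod>w\<in>J - cols_at M \<theta>. 1 / (1 - vpow \<theta> (- column w M)))
      = 1 / (1 - vpow \<theta> (- column y M)) * (\<Prod>w\<in>J - {y} - cols_at M \<theta>. 1 / (1 - vpow \<theta> (- column w M)))"
      using y assms by (subst prod.remove[of _ y]) (auto intro!: prod.cong)
    ultimately show "vpow \<theta> \<alpha> * ((1 - vpow \<theta> (- column y M)) * osc_coef M \<Omega> J \<theta>)
      = vpow \<theta> \<alpha> * osc_coef M \<Omega> (J - {y}) \<theta>"
      by (simp add: osc_coef_def)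
  qed
  finally show "bdiff (column y M) (osc M \<Omega> J) \<alpha> = osc M \<Omega> (J - {y}) \<alpha>" .
qed

text \<open>Every character trivial on the basis \<open>J\<close>, other than e, is trivial on
  exactly the columns in \<open>J\<close>, as both sets have s elements. Hence all coefficients
  equal the same constant and orthogonality of characters applies; the separate first summand is the
  share of e.\<close>

lemma osc_basis:
  fixes M :: "int ^ 'n ^ 's"
  assumes prime: "one_prime M" and J: "card J = CARD('s)" "spanning M J"
  shows "(if \<alpha> \<in> lattice_of M J then meets (col_cone M J) \<Omega> else 0)
    = meets (col_cone M J) \<Omega> / of_int (absdet M J) + osc M \<Omega> J \<alpha>"
proof -
  let ?e = "(\<chi> i. 1) :: complex ^ 's"
  have eq: "cols_at M \<theta> = J" if "\<theta> \<in> A_set M" "\<theta> \<noteq> ?e" "cols_at M \<theta> \<subseteq> J \<or> J \<subseteq> cols_at M \<theta>" for \<theta>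
    using one_prime_card_cols_at[OF prime that(1,2)] J(1) that(3)
    by (metis card_subset_eq finite)
  have "characters M J = insert ?e (osc_set M J)"
  proof (intro equalityI subsetI)
    fix \<theta> assume \<theta>: "\<theta> \<in> characters M J"
    then have sub: "J \<subseteq> cols_at M \<theta>" by (auto simp: characters_def cols_at_def)
    then have "\<theta> \<in> A_set M" using \<theta> spanning_mono[OF J(2) sub] by (auto simp: characters_def A_set_def)
    then show "\<theta> \<in> insert ?e (osc_set M J)" using eq sub by (auto simp: osc_set_def)
  next
    fix \<theta> assume \<theta>: "\<theta> \<in> insert ?e (osc_set M J)"
    show "\<theta> \<in> characters M J"
    proof (cases "\<theta> = ?e")
      case True
      then show ?thesis by (simp add: characters_def)
    next
      case False
      then have "\<theta> \<in> A_set M" "cols_at M \<theta> = J" using \<theta> eq by (auto simp: osc_set_def)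
      then show ?thesis by (auto simp: characters_def cols_at_def A_set_nonzero)
    qed
  qed
  moreover have "finite (osc_set M J)" using finite_A_set[of M] by (auto simp: osc_set_def)
  moreover have "?e \<notin> osc_set M J" by (simp add: osc_set_def)
  ultimately have "(\<Sum>\<theta>\<in>characters M J. vpow \<theta> \<alpha>) = 1 + (\<Sum>\<theta>\<in>osc_set M J. vpow \<theta> \<alpha>)" by simp
  moreover have "osc M \<Omega> J \<alpha> = (\<Sum>\<theta>\<in>osc_set M J. vpow \<theta> \<alpha>) * (meets (col_cone M J) \<Omega> / of_int (absdet M J))"
    unfolding osc_def sum_distrib_right
  proof (rule sum.cong[OF refl])
    fix \<theta> assume "\<theta> \<in> osc_set M J"
    then have "cols_at M \<theta> = J" using eq by (auto simp: osc_set_def)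
    then show "vpow \<theta> \<alpha> * osc_coef M \<Omega> J \<theta> = vpow \<theta> \<alpha> * (meets (col_cone M J) \<Omega> / of_int (absdet M J))"
      by (simp add: osc_coef_def)
  qed
  ultimately have "meets (col_cone M J) \<Omega> / of_int (absdet M J) + osc M \<Omega> J \<alpha>
    = (\<Sum>\<theta>\<in>characters M J. vpow \<theta> \<alpha>) * (meets (col_cone M J) \<Omega> / of_int (absdet M J))"
    by (simp add: distrib_right add_divide_distrib)
  then show ?thesis using sum_characters[OF J, of \<alpha>] absdet_pos[OF J] by auto
qed

context cell
begin

text \<open>The three assertions are carried by one induction because the column differences of
  \<open>f\<close> are the functions already obtained for \<open>J - {y}\<close>: their membership
  in nabla, their values and their shape give those of \<open>f\<close>.\<close>

lemma partition_function_formula: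
  assumes prime: "one_prime M"
  shows "\<exists>f p. f \<in> nabla_on M J \<and> (\<forall>\<alpha>\<in>region M \<Omega> J. f \<alpha> = of_nat (card (solutions M J \<alpha>)))
    \<and> lattice_poly p \<and> f = (\<lambda>\<alpha>. p \<alpha> + osc M \<Omega> J \<alpha>)"
proof (induction "card J" arbitrary: J rule: less_induct)
  case less
  show ?case
  proof (cases "spanning M J")
    case False
    have "osc_set M J = {}"
      using False A_set_spanning spanning_mono by (fastforce simp: osc_set_def)
    \<comment> \<open>Adding the zonotope vector to a represented \<alpha> would put a point of
      \<Omega> into the cone of the non-spanning set \<open>J\<close>.\<close>
    moreover have "solutions M J \<alpha> = {}" if \<alpha>: "\<alpha> \<in> region M \<Omega> J" for \<alpha>
    proof (rule ccontr)
      assume "solutions M J \<alpha> \<noteq> {}"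
      then obtain c where c: "\<And>j. 0 \<le> c j" "of_int_vec \<alpha> = (\<Sum>j\<in>J. c j *\<^sub>R rcol M j)"
        by (rule solutions_imp_cone) blast
      obtain \<omega> a where \<omega>: "\<omega> \<in> \<Omega>" and a: "\<And>j. j \<in> J \<Longrightarrow> 0 \<le> a j"
        and "of_int_vec \<alpha> = \<omega> - (\<Sum>j\<in>J. a j *\<^sub>R rcol M j)"
        using \<alpha> by (auto simp: region_def)
      then have "\<omega> = (\<Sum>j\<in>J. (c j + a j) *\<^sub>R rcol M j)"
        using c(2) by (simp add: scaleR_left_distrib sum.distrib algebra_simps)
      then have "\<omega> \<in> col_cone M J"
        unfolding col_cone_def mem_Collect_eq using c(1) a
        by (intro exI[of _ "\<lambda>j. c j + a j"]) simp
      then show False using avoids[OF False] \<omega> by blast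
    qed
    ultimately show ?thesis
      by (intro exI[of _ "\<lambda>\<alpha>. 0"]) (simp add: osc_def lattice_poly_const)
  next
    case True
    define u :: "int ^ 's \<Rightarrow> complex" where "u \<alpha> = of_nat (card (solutions M J \<alpha>))" for \<alpha>
    have bu: "bdiff (column y M) u \<alpha> = of_nat (card (solutions M (J - {y}) \<alpha>))" if "y \<in> J" for y \<alpha>
      using card_solutions_rec[OF pointed that, of \<alpha>] by (simp add: bdiff_def u_def)
    have "\<forall>y\<in>J. \<exists>g p. g \<in> nabla_on M (J - {y})
      \<and> (\<forall>\<alpha>\<in>region M \<Omega> (J - {y}). g \<alpha> = of_nat (card (solutions M (J - {y}) \<alpha>)))
      \<and> lattice_poly p \<and> g = (\<lambda>\<alpha>. p \<alpha> + osc M \<Omega> (J - {y}) \<alpha>)"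
      by (intro ballI less.hyps card_Diff1_less finite)
    then obtain g p where IH: "\<forall>y\<in>J. g y \<in> nabla_on M (J - {y})
      \<and> (\<forall>\<alpha>\<in>region M \<Omega> (J - {y}). g y \<alpha> = of_nat (card (solutions M (J - {y}) \<alpha>)))
      \<and> lattice_poly (p y) \<and> g y = (\<lambda>\<alpha>. p y \<alpha> + osc M \<Omega> (J - {y}) \<alpha>)"
      unfolding bchoice_iff by (elim exE)
    then have g: "\<And>y. y \<in> J \<Longrightarrow> g y \<in> nabla_on M (J - {y})"
      and g_sol: "\<And>y \<alpha>. y \<in> J \<Longrightarrow> \<alpha> \<in> region M \<Omega> (J - {y})
        \<Longrightarrow> g y \<alpha> = of_nat (card (solutions M (J - {y}) \<alpha>))"
      and p: "\<And>y. y \<in> J \<Longrightarrow> lattice_poly (p y)"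
      by blast+
    have gp: "g y \<alpha> = p y \<alpha> + osc M \<Omega> (J - {y}) \<alpha>" if "y \<in> J" for y \<alpha>
      using IH that by (metis (no_types))
    have "deep (\<lambda>\<alpha>. bdiff (column y M) u \<alpha> = g y \<alpha>)" if "y \<in> J" for y
      by (rule deepI) (simp add: bu g_sol region_if_C that)
    then obtain f where f: "deep (\<lambda>\<alpha>. f \<alpha> = u \<alpha>)" "\<And>y. y \<in> J \<Longrightarrow> bdiff (column y M) f = g y"
      using extension[OF True g] by metis
    have f_nabla: "f \<in> nabla_on M J"
      by (rule nabla_onI[OF True]) (simp add: f(2) g)
    have f_u: "f \<alpha> = u \<alpha>" if "\<alpha> \<in> region M \<Omega> J" for \<alpha>
    proof -
      \<comment> \<open>On the region of \<open>J - {j}\<close> the differences of \<open>f\<close>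
        and of \<open>u\<close> along column j are both t for \<open>J - {j}\<close>, so the
        discrepancy is transported without change.\<close>
      have "f \<alpha> - u \<alpha> = 0"
      proof (rule region_zero[OF True _ _ that, where D = "\<lambda>\<alpha>. f \<alpha> - u \<alpha>"])
        fix j \<beta> assume j: "j \<in> J" "\<beta> \<in> region M \<Omega> (J - {j})"
        have "bdiff (column j M) f \<beta> = bdiff (column j M) u \<beta>"
          using j by (simp add: f(2) bu g_sol)
        then show "f \<beta> - u \<beta> = f (\<beta> - column j M) - u (\<beta> - column j M)"
          by (simp add: bdiff_def algebra_simps)
      qed (use f(1) in simp)
      then show ?thesis by simp
    qed
    have "lattice_poly (\<lambda>\<alpha>. f \<alpha> - osc M \<Omega> J \<alpha>)"
    proof (cases "card J = CARD('s)")
      case False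
      show ?thesis
      proof (rule lattice_poly_if_bdiff_columns[OF one_prime_lattice[OF prime True False]])
        fix y assume y: "y \<in> J"
        have "bdiff (column y M) (\<lambda>\<alpha>. f \<alpha> - osc M \<Omega> J \<alpha>)
          = (\<lambda>\<alpha>. bdiff (column y M) f \<alpha> - bdiff (column y M) (osc M \<Omega> J) \<alpha>)"
          by (simp add: bdiff_def fun_eq_iff)
        also have "\<dots> = p y" using y by (simp add: f(2) bdiff_osc gp fun_eq_iff)
        finally show "lattice_poly (bdiff (column y M) (\<lambda>\<alpha>. f \<alpha> - osc M \<Omega> J \<alpha>))"
          using p[OF y] by simp
      qed
    next
      \<comment> \<open>Here the columns may generate a proper sublattice, so polynomial differences
        would not suffice. Instead \<open>f\<close> is identified by uniqueness with a multiple of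
        the indicator of that lattice.\<close>
      case basis: True
      define b :: "int ^ 's \<Rightarrow> complex"
        where "b \<alpha> = (if \<alpha> \<in> lattice_of M J then meets (col_cone M J) \<Omega> else 0)" for \<alpha>
      have "bdiff (column y M) b = (\<lambda>\<alpha>. 0)" if y: "y \<in> J" for y
      proof
        fix \<alpha>
        have "\<alpha> - column y M \<in> lattice_of M J \<longleftrightarrow> \<alpha> \<in> lattice_of M J"
          using lattice_of_add[of "\<alpha> - column y M" M J "column y M"]
            lattice_of_add[of \<alpha> M J "- column y M"] lattice_of_minus lattice_of_column[OF y] by auto
        then show "bdiff (column y M) b \<alpha> = 0" by (simp add: bdiff_def b_def)
      qed
      then have "b \<in> nabla_on M J" by (intro nabla_onI[OF True]) simp
      moreover have "deep (\<lambda>\<alpha>. f \<alpha> = b \<alpha>)"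
        by (rule deepI) (simp add: region_if_C f_u u_def b_def card_solutions_basis[OF basis True])
      ultimately have "f = b" by (intro nabla_on_unique[OF f_nabla])
      then have "(\<lambda>\<alpha>. f \<alpha> - osc M \<Omega> J \<alpha>) = (\<lambda>\<alpha>. meets (col_cone M J) \<Omega> / of_int (absdet M J))"
        using osc_basis[OF prime basis True] by (simp add: b_def fun_eq_iff)
      then show ?thesis by (simp add: lattice_poly_const)
    qed
    then show ?thesis
      using f_nabla f_u by (intro exI[of _ f] exI[of _ "\<lambda>\<alpha>. f \<alpha> - osc M \<Omega> J \<alpha>"]) (simp add: u_def)
  qed
qed

end

section \<open>Geometry of fundamental cones\<close>

lemma col_cone_hull:
  fixes M :: "int ^ 'n ^ 's"
  shows "col_cone M J = convex_cone hull (rcol M ` J)"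
proof
  show "col_cone M J \<subseteq> convex_cone hull (rcol M ` J)"
  proof
    fix x assume "x \<in> col_cone M J"
    then obtain a where a: "x = (\<Sum>j\<in>J. a j *\<^sub>R rcol M j)" "\<forall>j\<in>J. 0 \<le> a j"
      by (auto simp: col_cone_def)
    have "(\<Sum>j\<in>K. a j *\<^sub>R rcol M j) \<in> convex_cone hull (rcol M ` J)" if "finite K" "K \<subseteq> J" for K
      using that
    proof (induction K)
      case (insert j K)
      then have "a j *\<^sub>R rcol M j \<in> convex_cone hull (rcol M ` J)"
        using a(2) by (intro convex_cone_hull_mul hull_inc) auto
      then show ?case using insert by (simp add: convex_cone_hull_add)
    qed (simp add: convex_cone_hull_contains_0)
    then show "x \<in> convex_cone hull (rcol M ` J)" using a(1) by simp
  qed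
  show "convex_cone hull (rcol M ` J) \<subseteq> col_cone M J"
  proof (rule hull_minimal)
    show "rcol M ` J \<subseteq> col_cone M J"
    proof
      fix x assume "x \<in> rcol M ` J"
      then obtain j where j: "j \<in> J" "x = rcol M j" by blast
      have "x = (\<Sum>i\<in>J. (if i = j then 1 else 0) *\<^sub>R rcol M i)"
        using j by (simp add: if_distrib[of "\<lambda>c. c *\<^sub>R _"] cong: if_cong)
      then show "x \<in> col_cone M J"
        unfolding col_cone_def by (intro CollectI exI[of _ "\<lambda>i. if i = j then 1 else 0"]) simp
    qed
    have add: "x + y \<in> col_cone M J" if xy: "x \<in> col_cone M J" "y \<in> col_cone M J" for x y
    proof -
      obtain a b where "x = (\<Sum>j\<in>J. a j *\<^sub>R rcol M j)" "\<forall>j\<in>J. 0 \<le> a j"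
        "y = (\<Sum>j\<in>J. b j *\<^sub>R rcol M j)" "\<forall>j\<in>J. 0 \<le> b j"
        using xy by (auto simp: col_cone_def)
      then show ?thesis
        unfolding col_cone_def
        by (intro CollectI exI[of _ "\<lambda>j. a j + b j"]) (simp add: scaleR_left_distrib sum.distrib)
    qed
    have scale: "c *\<^sub>R x \<in> col_cone M J" if x: "x \<in> col_cone M J" "0 \<le> c" for x c
    proof -
      obtain a where "x = (\<Sum>j\<in>J. a j *\<^sub>R rcol M j)" "\<forall>j\<in>J. 0 \<le> a j"
        using x by (auto simp: col_cone_def)
      then show ?thesis
        unfolding col_cone_def using x(2)
        by (intro CollectI exI[of _ "\<lambda>j. c * a j"]) (simp add: scaleR_sum_right)
    qed
    have "0 \<in> col_cone M J"
      unfolding col_cone_def by (intro CollectI exI[of _ "\<lambda>j. 0"]) simp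
    then show "convex_cone (col_cone M J)"
      unfolding convex_cone_iff using add scale by blast
  qed
qed

lemma closed_col_cone: "closed (col_cone M J)"
  for M :: "int ^ 'n ^ 's"
  by (simp add: col_cone_hull closed_convex_cone_hull)

lemma col_cone_scale: "x \<in> col_cone M J \<Longrightarrow> 0 \<le> c \<Longrightarrow> c *\<^sub>R x \<in> col_cone M J"
  for M :: "int ^ 'n ^ 's"
  by (simp add: col_cone_hull convex_cone_hull_mul)

text \<open>The cut set is a finite union of closed cones, which makes the components open. It is
  also invariant under positive scaling, so the open ray through a point of \<Omega> is a connected
  set in the complement and stays in the same component.\<close>

lemma fundamental_cone_facts:
  fixes M :: "int ^ 'n ^ 's"
  assumes "fundamental_cone M \<Omega>"
  shows "open \<Omega>" "connected \<Omega>" "\<Omega> \<noteq> {}" "\<not> spanning M J \<Longrightarrow> \<Omega> \<inter> col_cone M J = {}"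
    and "x \<in> \<Omega> \<Longrightarrow> 0 < c \<Longrightarrow> c *\<^sub>R x \<in> \<Omega>"
proof -
  let ?S = "interior (col_cone M UNIV) - cut_set M"
  have \<Omega>: "\<Omega> \<in> components ?S" using assms by (simp add: fundamental_cone_def)
  have "closed (cut_set M)"
    unfolding cut_set_def by (intro closed_UN ballI closed_col_cone) simp
  then have "open ?S" by (intro open_Diff open_interior)
  then show "open \<Omega>" using \<Omega> open_components by blast
  show "connected \<Omega>" using \<Omega> by (rule in_components_connected)
  show "\<Omega> \<noteq> {}" using \<Omega> by (rule in_components_nonempty)
  have sub: "\<Omega> \<subseteq> ?S" using \<Omega> by (rule in_components_subset)
  show "\<Omega> \<inter> col_cone M J = {}" if "\<not> spanning M J"
  proof -
    have "- J \<in> cospan M" using that by (simp add: cospan_def)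
    then have "col_cone M J \<subseteq> cut_set M" unfolding cut_set_def by force
    then show ?thesis using sub by blast
  qed
  show "c *\<^sub>R x \<in> \<Omega>" if x: "x \<in> \<Omega>" and c: "0 < c"
  proof -
    have "r *\<^sub>R y \<in> ?S" if y: "y \<in> ?S" and r: "0 < r" for y r
    proof -
      have inv: "z \<in> col_cone M J \<longleftrightarrow> r *\<^sub>R z \<in> col_cone M J" for z J
        using col_cone_scale[of z M J r] col_cone_scale[of "r *\<^sub>R z" M J "1 / r"] r by auto
      have "(*\<^sub>R) r ` interior (col_cone M UNIV) \<subseteq> interior (col_cone M UNIV)"
      proof (rule interior_maximal)
        show "(*\<^sub>R) r ` interior (col_cone M UNIV) \<subseteq> col_cone M UNIV"
          using inv interior_subset by blast
        show "open ((*\<^sub>R) r ` interior (col_cone M UNIV))"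
          using r by (intro open_scaling) auto
      qed
      moreover have "r *\<^sub>R y \<notin> cut_set M" using y inv by (auto simp: cut_set_def)
      ultimately show ?thesis using y by blast
    qed
    moreover have "x \<in> ?S" using x sub by blast
    ultimately have "(\<lambda>r. r *\<^sub>R x) ` {0<..} \<subseteq> ?S" by auto
    moreover have "connected ((\<lambda>r. r *\<^sub>R x) ` {0<..})"
      by (intro connected_continuous_image continuous_intros) simp
    moreover have "x \<in> (\<lambda>r. r *\<^sub>R x) ` {0<..}" by (rule image_eqI[of _ _ 1]) simp_all
    ultimately have "(\<lambda>r. r *\<^sub>R x) ` {0<..} \<subseteq> \<Omega>"
      using components_maximal[OF \<Omega>] x by blast
    then show ?thesis using c by auto
  qed
qed

text \<open>\<open>C\<close> is the cone over a ball in \<Omega>, and v is the multiple by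
  \<open>D\<close> of an integer vector in \<open>C\<close>, so that v lies in the lattice of every
  spanning set.\<close>

lemma fundamental_cone_cell:
  fixes M :: "int ^ 'n ^ 's"
  assumes "0 \<notin> convex hull (range (rcol M))" "fundamental_cone M \<Omega>"
  obtains C v where "cell M \<Omega> C v"
proof -
  note facts = fundamental_cone_facts[OF assms(2)]
  obtain x0 where "x0 \<in> \<Omega>" using facts(3) by blast
  then obtain r where r: "r > 0" "ball x0 r \<subseteq> \<Omega>" using facts(1) by (meson open_contains_ball)
  define C where "C = {c *\<^sub>R x | c x. 0 < c \<and> x \<in> ball x0 r}"
  have C_I: "c *\<^sub>R x \<in> C" if "0 < c" "x \<in> ball x0 r" for c x
    using that unfolding C_def by blast
  have C_scale: "c *\<^sub>R x \<in> C" if x: "x \<in> C" and c: "0 < c" for x c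
  proof -
    obtain d y where "x = d *\<^sub>R y" "0 < d" "y \<in> ball x0 r" using x by (auto simp: C_def)
    then show ?thesis using C_I[of "c * d" y] c by simp
  qed
  have C_add: "x + y \<in> C" if xy: "x \<in> C" "y \<in> C" for x y
  proof -
    obtain c d a b where eq: "x = c *\<^sub>R a" "0 < c" "a \<in> ball x0 r" "y = d *\<^sub>R b" "0 < d" "b \<in> ball x0 r"
      using xy by (auto simp: C_def)
    let ?m = "(c / (c + d)) *\<^sub>R a + (d / (c + d)) *\<^sub>R b"
    have "?m \<in> ball x0 r"
      using eq by (intro convexD[OF convex_ball]) (simp_all add: add_divide_distrib[symmetric])
    then have "(c + d) *\<^sub>R ?m \<in> C" using eq by (intro C_I) simp_all
    then show ?thesis using eq by (simp add: scaleR_right_distrib)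
  qed
  have C_open: "\<exists>\<delta>>0. ball y \<delta> \<subseteq> C" if y: "y \<in> C" for y
  proof -
    obtain c x where x: "y = c *\<^sub>R x" "0 < c" "x \<in> ball x0 r" using y by (auto simp: C_def)
    have "open ((*\<^sub>R) c ` ball x0 r)" using x(2) by (intro open_scaling) auto
    moreover have "y \<in> (*\<^sub>R) c ` ball x0 r" using x by blast
    moreover have "(*\<^sub>R) c ` ball x0 r \<subseteq> C" using C_I[OF x(2)] by blast
    ultimately show ?thesis by (meson open_contains_ball order_trans)
  qed
  obtain D :: int where D: "D > 0" "\<And>J a. spanning M J \<Longrightarrow> D *s a \<in> lattice_of M J"
    using common_lattice_multiple by blast
  \<comment> \<open>Rounding \<open>N\<close> times \<open>x0\<close> down coordinatewise moves it
    by at most s in norm, which is less than r after division by \<open>N\<close>.\<close>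
  obtain N :: nat where N: "real CARD('s) / r < real N" using reals_Archimedean2 by blast
  have "0 < real CARD('s) / r" using r(1) by simp
  then have N0: "0 < N" using N by (metis of_nat_0_less_iff less_trans)
  define w :: "int ^ 's" where "w = (\<chi> i. \<lfloor>real N * x0 $ i\<rfloor>)"
  have "norm (real N *\<^sub>R x0 - of_int_vec w) \<le> (\<Sum>i\<in>UNIV. \<bar>(real N *\<^sub>R x0 - of_int_vec w) $ i\<bar>)"
    by (rule norm_le_l1_cart)
  also have "\<dots> \<le> (\<Sum>i\<in>(UNIV :: 's set). 1)"
  proof (rule sum_mono)
    fix i
    show "\<bar>(real N *\<^sub>R x0 - of_int_vec w) $ i\<bar> \<le> 1"
      unfolding w_def of_int_vec_def by simp linarith
  qed
  also have "\<dots> < real N * r" using N r(1) by (simp add: field_simps)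
  finally have w_near: "norm (real N *\<^sub>R x0 - of_int_vec w) < real N * r" .
  have scaled: "x0 - (1 / real N) *\<^sub>R of_int_vec w = (1 / real N) *\<^sub>R (real N *\<^sub>R x0 - of_int_vec w)"
    using N0 by (simp add: scaleR_right_diff_distrib)
  have "norm (x0 - (1 / real N) *\<^sub>R of_int_vec w) = norm (real N *\<^sub>R x0 - of_int_vec w) / real N"
    unfolding scaled by simp
  also have "\<dots> < r" using w_near N0 by (simp add: pos_divide_less_eq mult.commute)
  finally have "norm (x0 - (1 / real N) *\<^sub>R of_int_vec w) < r" .
  then have "(1 / real N) *\<^sub>R of_int_vec w \<in> ball x0 r" by (simp add: dist_norm)
  then have "real N *\<^sub>R (1 / real N) *\<^sub>R of_int_vec w \<in> C" using N0 by (intro C_I) simp_all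
  then have wC: "of_int_vec w \<in> C" using N0 by simp
  then have vC: "of_int_vec (D *s w) \<in> C"
    using D(1) by (simp add: of_int_vec_smult C_scale)
  show thesis
  proof (rule that[of C "D *s w"], unfold_locales)
    show "C \<subseteq> \<Omega>" using r(2) facts(5) by (auto simp: C_def)
    fix B
    obtain \<delta> where \<delta>: "\<delta> > 0" "ball (of_int_vec (D *s w)) \<delta> \<subseteq> C" using C_open[OF vC] by blast
    obtain k0 :: nat where k0: "B / \<delta> < real k0" using reals_Archimedean2 by blast
    show "\<exists>k0. \<forall>k\<ge>k0. \<forall>x. norm x \<le> B \<longrightarrow> real k *\<^sub>R of_int_vec (D *s w) + x \<in> C"
    \<comment> \<open>The successor keeps k positive for the division by k, also when
      \<open>k0\<close> is 0.\<close>
    proof (intro exI[of _ "Suc k0"] allI impI)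
      fix k and x :: "real ^ 's" assume k: "Suc k0 \<le> k" and x: "norm x \<le> B"
      have "B / \<delta> < real k" using k0 k by linarith
      then have "norm x < real k * \<delta>" using x \<delta>(1) by (simp add: field_simps)
      then have "norm ((1 / real k) *\<^sub>R x) < \<delta>" using k by (simp add: field_simps)
      then have "of_int_vec (D *s w) + (1 / real k) *\<^sub>R x \<in> ball (of_int_vec (D *s w)) \<delta>"
        by (simp add: dist_norm)
      then have "real k *\<^sub>R (of_int_vec (D *s w) + (1 / real k) *\<^sub>R x) \<in> C"
        using \<delta>(2) k by (intro C_scale) auto
      then show "real k *\<^sub>R of_int_vec (D *s w) + x \<in> C" using k by (simp add: scaleR_right_distrib)
    qed
  qed (use assms(1) facts C_add vC D(2) in auto)
qed

theorem theorem6p2: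
  fixes M :: "int ^ 'n ^ 's" and \<Omega> :: "(real ^ 's) set" and \<alpha> :: "int ^ 's"
  assumes "span (range (rcol M)) = UNIV"
    and "0 \<notin> convex hull (range (rcol M))"
    and "one_prime M"
    and "fundamental_cone M \<Omega>"
  shows "f_cone M \<Omega> \<alpha> = P_comp M (\<chi> i. 1) (f_cone M \<Omega>) \<alpha>
    + (\<Sum>\<theta>\<in>A_set M - {\<chi> i. 1}.
         vpow \<theta> \<alpha> * (1 / of_int (absdet M (cols_at M \<theta>)))
         * (\<Prod>w\<in>- cols_at M \<theta>. 1 / (1 - vpow \<theta> (- column w M)))
         * meets (col_cone M (cols_at M \<theta>)) \<Omega>)"
proof -
  obtain C v where cell: "cell M \<Omega> C v"
    using fundamental_cone_cell[OF assms(2,4)] by blast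
  interpret cell M \<Omega> C v by (rule cell)
  let ?e = "(\<chi> i. 1) :: complex ^ 's"
  have span: "spanning M UNIV" using assms(1) by (simp add: spanning_def)
  obtain f p where f: "f \<in> nabla M" "\<And>\<alpha>. \<alpha> \<in> vset M \<Omega> \<Longrightarrow> f \<alpha> = of_nat (vpart M \<alpha>)"
    and p: "lattice_poly p" and fp: "f = (\<lambda>\<alpha>. p \<alpha> + osc M \<Omega> UNIV \<alpha>)"
    using partition_function_formula[OF assms(3), of UNIV]
    unfolding nabla_on_UNIV vset_region vpart_solutions by blast
  \<comment> \<open>Lattice points of \<open>C\<close> belong to v(\<Omega>|M), with zero as
    zonotope vector, and agreement there already determines an element of nabla.\<close>
  have f_cone: "f_cone M \<Omega> = f"
    unfolding f_cone_def
  proof (rule the_equality)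
    fix h assume h: "h \<in> nabla M \<and> (\<forall>\<alpha>\<in>vset M \<Omega>. h \<alpha> = of_nat (vpart M \<alpha>))"
    show "h = f"
    proof (rule nabla_on_unique[of _ UNIV])
      show "deep (\<lambda>\<alpha>. h \<alpha> = f \<alpha>)"
        by (rule deepI) (use h f(2) region_if_C[of _ UNIV] in \<open>simp add: vset_region\<close>)
    qed (use h f(1) in \<open>simp_all add: nabla_on_UNIV\<close>)
  qed (use f in simp)
  \<comment> \<open>The candidate expansion: the polynomial at e, constants at the other points of
    A(M), and zero elsewhere to match the normalisation in \<open>P_comp\<close>.\<close>
  define q where "q \<theta> = (if \<theta> = ?e then p else if \<theta> \<in> A_set M
    then (\<lambda>\<alpha>. osc_coef M \<Omega> UNIV \<theta>) else (\<lambda>\<alpha>. 0))" for \<theta>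
  have e: "?e \<in> A_set M"
    using span by (simp add: A_set_def cols_at_def)
  have osc_eq: "osc M \<Omega> UNIV \<alpha> = (\<Sum>\<theta>\<in>A_set M - {?e}. vpow \<theta> \<alpha> * osc_coef M \<Omega> UNIV \<theta>)" for \<alpha>
    unfolding osc_def by (rule sum.cong) (auto simp: osc_set_def)
  have q_sum: "f \<alpha> = (\<Sum>\<theta>\<in>A_set M. vpow \<theta> \<alpha> * q \<theta> \<alpha>)" for \<alpha>
  proof -
    have "(\<Sum>\<theta>\<in>A_set M. vpow \<theta> \<alpha> * q \<theta> \<alpha>)
      = p \<alpha> + (\<Sum>\<theta>\<in>A_set M - {?e}. vpow \<theta> \<alpha> * q \<theta> \<alpha>)"
      using e by (simp add: sum.remove[OF finite_A_set] q_def)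
    also have "(\<Sum>\<theta>\<in>A_set M - {?e}. vpow \<theta> \<alpha> * q \<theta> \<alpha>) = osc M \<Omega> UNIV \<alpha>"
      unfolding osc_eq by (intro sum.cong) (auto simp: q_def)
    finally show ?thesis by (simp add: fp)
  qed
  have q_poly: "lattice_poly (q \<theta>)" for \<theta>
    by (simp add: q_def p lattice_poly_const)
  have "P_comp M ?e f = q ?e"
    unfolding P_comp_def
  proof (rule arg_cong[of _ _ "\<lambda>p. p ?e"], rule the_equality)
    show "(\<forall>\<theta>\<in>A_set M. lattice_poly (q \<theta>)) \<and> (\<forall>\<theta>. \<theta> \<notin> A_set M \<longrightarrow> q \<theta> = (\<lambda>\<alpha>. 0)) \<and>
      (\<forall>\<alpha>. f \<alpha> = (\<Sum>\<theta>\<in>A_set M. vpow \<theta> \<alpha> * q \<theta> \<alpha>))"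
      using q_poly q_sum e by (auto simp: q_def)
    fix r assume r: "(\<forall>\<theta>\<in>A_set M. lattice_poly (r \<theta>)) \<and> (\<forall>\<theta>. \<theta> \<notin> A_set M \<longrightarrow> r \<theta> = (\<lambda>\<alpha>. 0)) \<and>
      (\<forall>\<alpha>. f \<alpha> = (\<Sum>\<theta>\<in>A_set M. vpow \<theta> \<alpha> * r \<theta> \<alpha>))"
    show "r = q"
    proof
      fix \<theta>
      show "r \<theta> = q \<theta>"
      proof (cases "\<theta> \<in> A_set M")
        case True
        have "(\<lambda>\<alpha>. r \<theta> \<alpha> - q \<theta> \<alpha>) = (\<lambda>\<alpha>. 0)"
        proof (rule exp_poly_eq_0[OF finite_A_set _ _ _ True, where p = "\<lambda>\<theta> \<alpha>. r \<theta> \<alpha> - q \<theta> \<alpha>"])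
          show "(\<Sum>\<theta>\<in>A_set M. vpow \<theta> \<alpha> * (r \<theta> \<alpha> - q \<theta> \<alpha>)) = 0" for \<alpha>
            using r q_sum[of \<alpha>] by (simp add: right_diff_distrib sum_subtractf)
        qed (use r q_poly in \<open>auto simp: A_set_nonzero lattice_poly_diff\<close>)
        then show ?thesis by (simp add: fun_eq_iff)
      next
        case False
        then show ?thesis using r e by (auto simp: q_def)
      qed
    qed
  qed
  then have "P_comp M ?e (f_cone M \<Omega>) \<alpha> = p \<alpha>" by (simp add: f_cone q_def)
  moreover have "f_cone M \<Omega> \<alpha> = p \<alpha> + (\<Sum>\<theta>\<in>A_set M - {?e}. vpow \<theta> \<alpha> * osc_coef M \<Omega> UNIV \<theta>)"
    by (simp add: f_cone fp osc_eq)
  ultimately show ?thesis by (simp add: osc_coef_def Compl_eq_Diff_UNIV mult.assoc)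
qed

end
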